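(* Let $q$ be a real-valued distribution belonging to $H^{-1}_{\mathrm{loc}}(\mathbb{R})$. Then the following statements are equivalent. (i) $q\in\operatorname{Im}(B)$, i.e., $q=r'+r^{2}$ for some real-valued function $r\in L^{2}_{\mathrm{loc}}(\mathbb{R})$. (ii) The equation $L_q y=0$ has a strictly positive solution $y\in H^{1}_{\mathrm{loc}}(\mathbb{R})$. (iii) $L_q\geq 0$.
   Context: $H^{\alpha}(\mathbb{R})$ denotes the usual $L^2$-based Sobolev space; a distribution $u$ belongs to $H^{\alpha}_{\mathrm{loc}}(\mathbb{R})$ if $\chi u\in H^{\alpha}(\mathbb{R})$ for every $\chi\in C_0^\infty(\mathbb{R})$. The Miura map $B$ is $B(r)=r'+r^2$ (derivative in the sense of distributions), a map from real-valued functions in $L^2_{\mathrm{loc}}(\mathbb{R})$ to $H^{-1}_{\mathrm{loc}}(\mathbb{R})$; $\operatorname{Im}(B)$ is its image. For real-valued $q\in H^{-1}_{\mathrm{loc}}(\mathbb{R})$, $L_q=-d^2/dx^2+q$, acting in the sense of distributions on $H^1_{\mathrm{loc}}(\mathbb{R})$; here, for $y\in H^1_{\mathrm{loc}}(\mathbb{R})$, the product $qy$ is the distribution $qy=(Qy)'-Qy'$, where $Q\in L^2_{\mathrm{loc}}(\mathbb{R})$ is any function with $Q'=q$. We write $L_q\ge 0$ if $(L_q\varphi,\varphi)\ge 0$ for all $\varphi\in C_0^\infty(\mathbb{R})$, where $(L_q\varphi,\varphi)=\int_{\mathbb{R}}|\varphi'|^2\,dx+(q,|\varphi|^2)$ and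 $(\cdot,\cdot)$ is the pairing of distributions with test functions extending the $L^2$ inner product. Strictly positive means $y(x)>0$ for all $x\in\mathbb{R}$ (for the continuous representative). *)

theory Defs
  imports "HOL-Analysis.Analysis"
begin

section \<open>Test functions and distributions on the real line\<close>

definition nth_vderiv :: "nat \<Rightarrow> (real \<Rightarrow> complex) \<Rightarrow> real \<Rightarrow> complex" where
  "nth_vderiv n f = ((\<lambda>g x. vector_derivative g (at x)) ^^ n) f"

abbreviation vderiv :: "(real \<Rightarrow> complex) \<Rightarrow> real \<Rightarrow> complex" where
  "vderiv \<equiv> nth_vderiv 1"

definition test_fun :: "(real \<Rightarrow> complex) set" where
  "test_fun = {\<phi>. (\<forall>n x. nth_vderiv n \<phi> differentiable (at x)) \<and>
                  compact (closure {x. \<phi> x \<noteq> 0})}"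

text \<open>A distribution is a continuous linear functional on the test functions. Functionals are kept
  \<^const>\<open>undefined\<close> off \<open>test_fun\<close> (via \<^const>\<open>extensional\<close>), so that equality of distributions is
  equality in HOL. The pairing \<open>T \<phi>\<close> is bilinear, without complex conjugation.\<close>

type_synonym functional = "(real \<Rightarrow> complex) \<Rightarrow> complex"

definition distributions :: "functional set" where
  "distributions = {T \<in> extensional test_fun.
     (\<forall>\<phi>\<in>test_fun. \<forall>\<psi>\<in>test_fun. T (\<lambda>x. \<phi> x + \<psi> x) = T \<phi> + T \<psi>) \<and>
     (\<forall>c. \<forall>\<phi>\<in>test_fun. T (\<lambda>x. c * \<phi> x) = c * T \<phi>) \<and>
     (\<forall>K. compact K \<longrightarrow> (\<exists>C N. \<forall>\<phi>\<in>test_fun. {x. \<phi> x \<noteq> 0} \<subseteq> K \<longrightarrow>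
        norm (T \<phi>) \<le> C * (\<Sum>k\<le>N. SUP x. norm (nth_vderiv k \<phi> x))))}"

definition real_valued_dist :: "functional \<Rightarrow> bool" where
  "real_valued_dist T \<longleftrightarrow> (\<forall>\<phi>\<in>test_fun. (\<forall>x. \<phi> x \<in> \<real>) \<longrightarrow> T \<phi> \<in> \<real>)"

definition zero_dist :: functional where
  "zero_dist = (\<lambda>\<phi>\<in>test_fun. 0)"

definition add_dist :: "functional \<Rightarrow> functional \<Rightarrow> functional" where
  "add_dist S T = (\<lambda>\<phi>\<in>test_fun. S \<phi> + T \<phi>)"

definition diff_dist :: "functional \<Rightarrow> functional \<Rightarrow> functional" where
  "diff_dist S T = (\<lambda>\<phi>\<in>test_fun. S \<phi> - T \<phi>)"

definition deriv_dist :: "functional \<Rightarrow> functional" where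
  "deriv_dist T = (\<lambda>\<phi>\<in>test_fun. - T (vderiv \<phi>))"

definition mult_dist :: "(real \<Rightarrow> complex) \<Rightarrow> functional \<Rightarrow> functional" where
  "mult_dist \<eta> T = (\<lambda>\<phi>\<in>test_fun. T (\<lambda>x. \<eta> x * \<phi> x))"

text \<open>The regular distribution of a locally integrable function.\<close>

definition dist_of :: "(real \<Rightarrow> complex) \<Rightarrow> functional" where
  "dist_of f = (\<lambda>\<phi>\<in>test_fun. integral\<^sup>L lborel (\<lambda>x. f x * \<phi> x))"


section \<open>Local Lebesgue and Sobolev spaces\<close>

text \<open>Elements are functions, not classes modulo null sets. Restricting to Borel functions loses
  nothing, since every Lebesgue measurable function agrees almost everywhere with a Borel one.\<close>

definition L2_loc :: "(real \<Rightarrow> 'a::real_normed_vector) set" where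
  "L2_loc = {f \<in> borel_measurable borel.
     \<forall>K. compact K \<longrightarrow> set_integrable lborel K (\<lambda>x. (norm (f x))\<^sup>2)}"

definition inv_fourier :: "(real \<Rightarrow> complex) \<Rightarrow> real \<Rightarrow> complex" where
  "inv_fourier \<phi> \<xi> = (1 / (2 * pi)) * integral\<^sup>L lborel (\<lambda>x. cis (\<xi> * x) * \<phi> x)"

text \<open>The \<open>L\<^sup>2\<close>-based Sobolev space of order \<open>\<alpha>\<close>: the Fourier transform of \<open>u\<close> is a function \<open>g\<close> with
  \<open>(1 + \<xi>\<^sup>2)\<^bsup>\<alpha>/2\<^esup> g\<close> in \<open>L\<^sup>2\<close>. That \<open>g\<close> is the Fourier transform of \<open>u\<close> is expressed by the defining
  identity \<open>\<langle>u, \<phi>\<rangle> = \<langle>g, inv_fourier \<phi>\<rangle>\<close>; as the test functions are dense in the Schwartz space, testing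
  against them suffices, and such a \<open>u\<close> is automatically tempered.\<close>

definition sobolev :: "real \<Rightarrow> functional set" where
  "sobolev \<alpha> = {u \<in> distributions. \<exists>g \<in> borel_measurable borel.
     integrable lborel (\<lambda>\<xi>. (1 + \<xi>\<^sup>2) powr \<alpha> * (norm (g \<xi>))\<^sup>2) \<and>
     (\<forall>\<phi>\<in>test_fun. u \<phi> = integral\<^sup>L lborel (\<lambda>\<xi>. g \<xi> * inv_fourier \<phi> \<xi>))}"

definition sobolev_loc :: "real \<Rightarrow> functional set" where
  "sobolev_loc \<alpha> = {u \<in> distributions. \<forall>\<eta>\<in>test_fun. mult_dist \<eta> u \<in> sobolev \<alpha>}"


section \<open>The Miura map and Schroedinger operators\<close>

definition miura :: "(real \<Rightarrow> real) \<Rightarrow> functional" where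
  "miura r = add_dist (deriv_dist (dist_of (\<lambda>x. complex_of_real (r x))))
                      (dist_of (\<lambda>x. complex_of_real ((r x)\<^sup>2)))"

text \<open>The product \<open>q y = (Q y)' - Q y'\<close> for \<open>q\<close> locally in \<open>H\<^bsup>-1\<^esup>\<close> and \<open>y\<close> a continuous function locally
  in \<open>H\<^sup>1\<close>. For such \<open>q\<close> and \<open>y\<close> the functions chosen below exist, and the product does not depend
  on the choice: \<open>Q\<close> is unique up to a null set and an additive constant, \<open>y'\<close> up to a null set.\<close>

definition L2_primitive :: "functional \<Rightarrow> real \<Rightarrow> complex" where
  "L2_primitive q = (SOME Q. Q \<in> L2_loc \<and> deriv_dist (dist_of Q) = q)"

definition weak_deriv :: "(real \<Rightarrow> complex) \<Rightarrow> real \<Rightarrow> complex" where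
  "weak_deriv y = (SOME g. g \<in> L2_loc \<and> deriv_dist (dist_of y) = dist_of g)"

definition potential_prod :: "functional \<Rightarrow> (real \<Rightarrow> complex) \<Rightarrow> functional" where
  "potential_prod q y =
     diff_dist (deriv_dist (dist_of (\<lambda>x. L2_primitive q x * y x)))
               (dist_of (\<lambda>x. L2_primitive q x * weak_deriv y x))"

definition schroedinger :: "functional \<Rightarrow> (real \<Rightarrow> complex) \<Rightarrow> functional" where
  "schroedinger q y =
     diff_dist (potential_prod q y) (deriv_dist (deriv_dist (dist_of y)))"

text \<open>\<open>(L\<^sub>q \<phi>, \<phi>)\<close> for a test function \<open>\<phi>\<close>. Since \<open>|\<phi>|\<^sup>2\<close> is real, the bilinear pairing used here agrees
  with the sesquilinear one.\<close>

definition schroedinger_form :: "functional \<Rightarrow> (real \<Rightarrow> complex) \<Rightarrow> complex" where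
  "schroedinger_form q \<phi> =
     complex_of_real (integral\<^sup>L lborel (\<lambda>x. (norm (vderiv \<phi> x))\<^sup>2)) +
     q (\<lambda>x. complex_of_real ((norm (\<phi> x))\<^sup>2))"

definition schroedinger_nonneg :: "functional \<Rightarrow> bool" where
  "schroedinger_nonneg q \<longleftrightarrow> (\<forall>\<phi>\<in>test_fun. schroedinger_form q \<phi> \<in> \<real>\<^sub>\<ge>\<^sub>0)"

end

theory Submission
  imports Defs "HOL-Probability.Probability"
begin

text \<open>Write \<open>q = Q'\<close> with a real function \<open>Q\<close> locally in \<open>L\<^sup>2\<close>. Such a \<open>Q\<close> exists because \<open>q\<close> is bounded, on
  test functions supported in a fixed interval, by the \<open>L\<^sup>2\<close> norm of their derivative (Bessel's inequality
  for the Fourier transform), and Riesz' representation theorem applies.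

  If \<open>q = r' + r\<^sup>2\<close>, then \<open>y = exp (\<integral>r)\<close> is a positive solution and \<open>(L\<^sub>q \<phi>, \<phi>)\<close> is the square of the norm of
  \<open>\<phi>' - r \<phi>\<close>. Conversely, a positive solution \<open>y\<close> gives \<open>r = y' / y\<close>. Here \<open>y' - Q y\<close>, and hence \<open>r - Q\<close>, is
  absolutely continuous, so that \<open>r\<close> can be differentiated by the product rule. Finally, let \<open>L\<^sub>q \<ge> 0\<close>. The
  equation \<open>L\<^sub>q y = 0\<close> is a linear first-order system for \<open>y\<close> and \<open>u = y' - Q y\<close> with locally integrable
  coefficients. A solution with two zeros, cut off outside them, is a null vector of the nonnegative
  form, which forces \<open>u\<close> to vanish at the zeros and the solution to be trivial. So nontrivial solutions
  have at most one zero, and the limit of solutions whose zero moves to infinity is positive.\<close>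

section \<open>Smooth functions and test functions\<close>

text \<open>Otherwise the simplifier turns \<open>vderiv\<close>, an abbreviation for \<open>nth_vderiv 1\<close>, into \<open>nth_vderiv (Suc 0)\<close>.\<close>

declare One_nat_def [simp del]

text \<open>For \<open>q\<close> in \<open>H^-1\<close> locally, \<open>Q\<close> has no pointwise
  meaning and \<open>y'\<close> is merely square integrable, so a second derivative of
  \<open>y\<close> is never available. Derivatives are therefore expressed by integral identities:
  \<open>ac\<close> replaces differentiability, and its product and exponential rules come from
  Fubini's theorem and the power series rather than from almost everywhere differentiation. The
  Fourier conditions on \<open>q\<close> and \<open>y\<close> enter through two estimates against
  test functions, which Riesz' theorem turns into functions.

  The delicate direction starts from nonnegativity. The form is given on test functions only, while
  a truncated solution is merely in \<open>H^1\<close>; the form has to be extended by density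
  first, and there uniform convergence of the functions makes up for \<open>Q\<close> being only
  locally square integrable. A limit of positive solutions is a priori only nonnegative. Excluding a
  zero requires a sign change at zeros with \<open>u\<close> different from 0, although
  \<open>y\<close> may fail to be differentiable there; dividing by the exponential of a primitive
  of \<open>Q\<close> repairs this.\<close>

definition smooth :: "(real \<Rightarrow> complex) \<Rightarrow> bool" where
  "smooth f \<longleftrightarrow> (\<forall>n x. nth_vderiv n f differentiable (at x))"

lemma nth_vderiv_0 [simp]: "nth_vderiv 0 f = f"
  by (simp add: nth_vderiv_def)

lemma nth_vderiv_Suc: "nth_vderiv (Suc n) f = nth_vderiv n (vderiv f)"
  by (simp add: nth_vderiv_def funpow_Suc_right One_nat_def del: funpow.simps)

lemma vderiv_eq: "vderiv f x = vector_derivative f (at x)"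
  by (simp add: nth_vderiv_def One_nat_def)

lemma vderiv_eqI: "(\<And>x. (f has_vector_derivative g x) (at x)) \<Longrightarrow> vderiv f = g"
  by (rule ext) (simp add: vderiv_eq vector_derivative_at)

lemma smooth_has_vderiv: "smooth f \<Longrightarrow> (f has_vector_derivative vderiv f x) (at x)"
  unfolding smooth_def vderiv_eq
  by (metis nth_vderiv_0 vector_derivative_works)

lemma smooth_vderiv: "smooth f \<Longrightarrow> smooth (vderiv f)"
  unfolding smooth_def by (metis nth_vderiv_Suc)

text \<open>Smoothness is a greatest fixed point, so a closure property takes one differentiation
  inside a suitable set instead of a formula for every \<open>nth_vderiv n\<close>.\<close>

lemma smooth_coinduct [consumes 1, case_names deriv]:
  assumes "f \<in> S"
    and step: "\<And>f. f \<in> S \<Longrightarrow> \<exists>g\<in>S. \<forall>x. (f has_vector_derivative g x) (at x)"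
  shows "smooth f"
proof -
  have "nth_vderiv n f \<in> S" if "f \<in> S" for n f
    using that
  proof (induction n arbitrary: f)
    case (Suc n)
    obtain g where g: "g \<in> S" "\<forall>x. (f has_vector_derivative g x) (at x)"
      using step[OF Suc.prems] by blast
    then have "vderiv f = g" by (intro vderiv_eqI) auto
    then show ?case using Suc.IH[OF g(1)] by (simp only: nth_vderiv_Suc)
  qed simp
  then show ?thesis
    unfolding smooth_def using assms(1) step
    by (metis differentiableI_vector)
qed

lemma smooth_primitive:
  assumes "smooth f" "\<And>x. (F has_vector_derivative f x) (at x)"
  shows "smooth F"
proof -
  have "F \<in> insert F (Collect smooth)" by simp
  then show ?thesis
  proof (rule smooth_coinduct)
    fix g assume "g \<in> insert F (Collect smooth)"
    then show "\<exists>h\<in>insert F (Collect smooth). \<forall>x. (g has_vector_derivative h x) (at x)"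
      using assms smooth_has_vderiv smooth_vderiv by blast
  qed
qed

lemma smooth_const [simp]: "smooth (\<lambda>x. c)"
proof -
  have "(\<lambda>x. c) \<in> range (\<lambda>c (x::real). c :: complex)" by blast
  then show ?thesis
  proof (rule smooth_coinduct)
    fix g :: "real \<Rightarrow> complex" assume "g \<in> range (\<lambda>c x. c)"
    then show "\<exists>h\<in>range (\<lambda>c x. c). \<forall>x. (g has_vector_derivative h x) (at x)"
      by (auto intro!: exI[of _ 0] has_vector_derivative_const)
  qed
qed

lemma smooth_add:
  assumes "smooth f" "smooth g"
  shows "smooth (\<lambda>x. f x + g x)"
proof -
  let ?S = "{\<lambda>x. f x + g x | f g. smooth f \<and> smooth g}"
  have "(\<lambda>x. f x + g x) \<in> ?S" using assms by blast
  then show ?thesis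
  proof (rule smooth_coinduct)
    fix h assume "h \<in> ?S"
    then obtain f g where "h = (\<lambda>x. f x + g x)" "smooth f" "smooth g" by blast
    then show "\<exists>k\<in>?S. \<forall>x. (h has_vector_derivative k x) (at x)"
      by (intro bexI[of _ "\<lambda>x. vderiv f x + vderiv g x"])
        (auto intro!: has_vector_derivative_add smooth_has_vderiv smooth_vderiv)
  qed
qed

text \<open>Products of smooth functions are not closed under differentiation, but their finite sums are.\<close>

inductive_set prod_sums :: "(real \<Rightarrow> complex) set" where
  prod: "smooth f \<Longrightarrow> smooth g \<Longrightarrow> (\<lambda>x. f x * g x) \<in> prod_sums"
| add: "f \<in> prod_sums \<Longrightarrow> g \<in> prod_sums \<Longrightarrow> (\<lambda>x. f x + g x) \<in> prod_sums"

lemma smooth_mult: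
  assumes "smooth f" "smooth g"
  shows "smooth (\<lambda>x. f x * g x)"
proof -
  have "(\<lambda>x. f x * g x) \<in> prod_sums" using assms by (rule prod_sums.prod)
  then show ?thesis
  proof (rule smooth_coinduct)
    fix h assume "h \<in> prod_sums"
    then show "\<exists>k\<in>prod_sums. \<forall>x. (h has_vector_derivative k x) (at x)"
    proof induction
      case (prod f g)
      then have "(\<lambda>x. f x * vderiv g x + vderiv f x * g x) \<in> prod_sums"
        by (intro prod_sums.add prod_sums.prod smooth_vderiv)
      then show ?case
        using prod by (intro bexI) (auto intro!: has_vector_derivative_mult smooth_has_vderiv)
    next
      case (add f g)
      then obtain f' g' where "f' \<in> prod_sums" "g' \<in> prod_sums"
        and "\<forall>x. (f has_vector_derivative f' x) (at x)" "\<forall>x. (g has_vector_derivative g' x) (at x)"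
        by blast
      then show ?case
        by (intro bexI[of _ "\<lambda>x. f' x + g' x"])
          (auto intro!: has_vector_derivative_add prod_sums.add)
    qed
  qed
qed

lemma smooth_cmult: "smooth f \<Longrightarrow> smooth (\<lambda>x. c * f x)"
  by (rule smooth_mult[OF smooth_const])

lemma smooth_cnj:
  assumes "smooth f"
  shows "smooth (\<lambda>x. cnj (f x))"
proof -
  let ?S = "{\<lambda>x. cnj (f x) | f. smooth f}"
  have "(\<lambda>x. cnj (f x)) \<in> ?S" using assms by blast
  then show ?thesis
  proof (rule smooth_coinduct)
    fix h assume "h \<in> ?S"
    then obtain f where "h = (\<lambda>x. cnj (f x))" "smooth f" by blast
    then show "\<exists>k\<in>?S. \<forall>x. (h has_vector_derivative k x) (at x)"
      by (intro bexI[of _ "\<lambda>x. cnj (vderiv f x)"])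
        (auto intro!: has_vector_derivative_cnj smooth_has_vderiv smooth_vderiv)
  qed
qed

lemma smooth_affine:
  assumes "smooth f"
  shows "smooth (\<lambda>x. f (c * x + d))"
proof -
  \<comment> \<open>The factor \<open>a\<close> makes the set closed under differentiation, which
    brings out a factor \<open>c\<close> each time.\<close>
  let ?S = "{\<lambda>x. a * f (c * x + d) | f a. smooth f}"
  have "(\<lambda>x. 1 * f (c * x + d)) \<in> ?S" using assms by blast
  then have "smooth (\<lambda>x. 1 * f (c * x + d))"
  proof (rule smooth_coinduct)
    fix h assume "h \<in> ?S"
    then obtain f a where h: "h = (\<lambda>x. a * f (c * x + d))" and f: "smooth f" by blast
    have "((\<lambda>x. f (c * x + d)) has_vector_derivative c *\<^sub>R vderiv f (c * x + d)) (at x)" for x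
    proof -
      have "((\<lambda>x. c * x + d) has_vector_derivative c) (at x)"
        by (auto intro!: derivative_eq_intros simp flip: has_real_derivative_iff_has_vector_derivative)
      from vector_diff_chain_at[OF this smooth_has_vderiv[OF f]] show ?thesis by (simp add: o_def)
    qed
    then have "(h has_vector_derivative (a * c) * vderiv f (c * x + d)) (at x)" for x
      unfolding h by (rule has_vector_derivative_eq_rhs[OF has_vector_derivative_mult_right])
        (simp add: scaleR_conv_of_real)
    moreover have "(\<lambda>x. (a * c) * vderiv f (c * x + d)) \<in> ?S"
      using smooth_vderiv[OF f] by blast
    ultimately show "\<exists>k\<in>?S. \<forall>x. (h has_vector_derivative k x) (at x)" by (intro bexI) auto
  qed
  then show ?thesis by simp
qed

lemma smooth_continuous: "smooth f \<Longrightarrow> continuous_on A f"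
  by (meson smooth_has_vderiv continuous_at_imp_continuous_on has_vector_derivative_continuous)

lemma vderiv_smooth_mult:
  "smooth f \<Longrightarrow> smooth g \<Longrightarrow> vderiv (\<lambda>x. f x * g x) = (\<lambda>x. f x * vderiv g x + vderiv f x * g x)"
  by (rule vderiv_eqI) (auto intro!: has_vector_derivative_mult smooth_has_vderiv)

lemma vderiv_smooth_add:
  "smooth f \<Longrightarrow> smooth g \<Longrightarrow> vderiv (\<lambda>x. f x + g x) = (\<lambda>x. vderiv f x + vderiv g x)"
  by (rule vderiv_eqI) (auto intro!: has_vector_derivative_add smooth_has_vderiv)

lemma vderiv_smooth_cmult:
  "smooth f \<Longrightarrow> vderiv (\<lambda>x. c * f x) = (\<lambda>x. c * vderiv f x)"
  by (rule vderiv_eqI) (auto intro!: has_vector_derivative_mult_right smooth_has_vderiv)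

lemma vderiv_smooth_cnj:
  "smooth f \<Longrightarrow> vderiv (\<lambda>x. cnj (f x)) = (\<lambda>x. cnj (vderiv f x))"
  by (rule vderiv_eqI) (auto intro!: has_vector_derivative_cnj smooth_has_vderiv)

section \<open>Flat functions and smooth steps\<close>

definition flat_exp :: "real poly \<Rightarrow> real \<Rightarrow> real" where
  "flat_exp p x = (if x > 0 then poly p (1 / x) * exp (- (1 / x)) else 0)"

lemma poly_exp_tendsto_0: "((\<lambda>t. poly p t * exp (- t)) \<longlongrightarrow> (0::real)) at_top"
proof -
  have "((\<lambda>t. \<Sum>i\<le>degree p. coeff p i * (t ^ i / exp t)) \<longlongrightarrow> (\<Sum>i\<le>degree p. coeff p i * 0)) at_top"
    by (intro tendsto_intros tendsto_power_div_exp_0)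
  then show ?thesis
    by (simp add: poly_altdef exp_minus sum_distrib_right divide_inverse mult.assoc)
qed

text \<open>In the variable \<open>t = 1 / x\<close> differentiation is \<open>- t^2 d/dt\<close>,
  which turns \<open>p(t) exp(- t)\<close> into \<open>t^2 (p - p')(t) exp(- t)\<close>; with the
  polynomial as a parameter the family is closed under differentiation. At the origin exponential
  decay beats polynomial growth.\<close>

lemma flat_exp_deriv:
  "(flat_exp p has_real_derivative flat_exp ([:0, 0, 1:] * (p - pderiv p)) x) (at x)"
proof -
  consider "x > 0" | "x < 0" | "x = 0" by linarith
  then show ?thesis
  proof cases
    case 1
    have "((\<lambda>x. poly p (1 / x) * exp (- (1 / x))) has_real_derivative
        flat_exp ([:0, 0, 1:] * (p - pderiv p)) x) (at x)"
      using 1 by (auto intro!: derivative_eq_intros simp: flat_exp_def field_simps power2_eq_square)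
    then show ?thesis
      by (rule has_field_derivative_transform_within_open[OF _ open_greaterThan[of 0]])
        (use 1 in \<open>auto simp: flat_exp_def\<close>)
  next
    case 2
    have "((\<lambda>x. 0) has_real_derivative flat_exp ([:0, 0, 1:] * (p - pderiv p)) x) (at x)"
      using 2 by (simp add: flat_exp_def)
    then show ?thesis
      by (rule has_field_derivative_transform_within_open[OF _ open_lessThan[of 0]])
        (use 2 in \<open>auto simp: flat_exp_def\<close>)
  next
    case 3
    have "((\<lambda>x. flat_exp p x / x) \<longlongrightarrow> 0) (at_left 0)"
      by (rule tendsto_eventually, rule eventually_at_leftI[of "-1"]) (auto simp: flat_exp_def)
    moreover have "((\<lambda>x. flat_exp p x / x) \<longlongrightarrow> 0) (at_right 0)"
    proof -
      \<comment> \<open>\<open>pCons 0 p\<close> is \<open>t p(t)\<close>: the division by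
        \<open>x\<close> in the difference quotient is one more factor \<open>t\<close>.\<close>
      have "((\<lambda>x. poly (pCons 0 p) (inverse x) * exp (- inverse x)) \<longlongrightarrow> (0::real)) (at_right 0)"
        by (rule filterlim_compose[OF poly_exp_tendsto_0 filterlim_inverse_at_top_right])
      moreover have "\<forall>\<^sub>F x in at_right 0. poly (pCons 0 p) (inverse x) * exp (- inverse x) = flat_exp p x / x"
        by (rule eventually_at_rightI[of 0 1]) (auto simp: flat_exp_def divide_simps)
      ultimately show ?thesis by (rule Lim_transform_eventually)
    qed
    ultimately have "((\<lambda>x. flat_exp p x / x) \<longlongrightarrow> 0) (at 0)"
      by (simp add: filterlim_split_at)
    then show ?thesis
      using 3 by (simp add: has_field_derivative_iff flat_exp_def)
  qed
qed

lemma smooth_flat_exp: "smooth (\<lambda>x. of_real (flat_exp p x))"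
proof -
  have "(\<lambda>x. of_real (flat_exp p x)) \<in> range (\<lambda>p x. complex_of_real (flat_exp p x))" by blast
  then show ?thesis
  proof (rule smooth_coinduct)
    fix h assume "h \<in> range (\<lambda>p x. complex_of_real (flat_exp p x))"
    then obtain p where "h = (\<lambda>x. complex_of_real (flat_exp p x))" by blast
    then show "\<exists>k\<in>range (\<lambda>p x. complex_of_real (flat_exp p x)). \<forall>x. (h has_vector_derivative k x) (at x)"
      using flat_exp_deriv[of p]
      by (intro bexI[of _ "\<lambda>x. complex_of_real (flat_exp ([:0, 0, 1:] * (p - pderiv p)) x)"])
        (auto intro: has_vector_derivative_of_real
          simp: has_real_derivative_iff_has_vector_derivative simp del: mult_pCons_left)
  qed
qed

lemma continuous_antiderivative:
  fixes f :: "real \<Rightarrow> 'a::euclidean_space"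
  assumes "continuous_on UNIV f"
  obtains F where "\<And>x. (F has_vector_derivative f x) (at x)"
  using einterval_antiderivative[of "-\<infinity>" \<infinity> f] assms
  by (auto simp: continuous_on_eq_continuous_at)

text \<open>The step is the normalised primitive of a bump that is positive exactly on the open unit
  interval.\<close>

lemma smooth_step_exists:
  obtains h :: "real \<Rightarrow> real" where "smooth (\<lambda>x. of_real (h x))"
    "\<And>x. x \<le> 0 \<Longrightarrow> h x = 0" "\<And>x. x \<ge> 1 \<Longrightarrow> h x = 1" "\<And>x. 0 \<le> h x" "\<And>x. h x \<le> 1"
proof -
  define b where "b x = flat_exp 1 x * flat_exp 1 (1 - x)" for x
  have sb: "smooth (\<lambda>x. complex_of_real (b x))"
    unfolding b_def using smooth_mult[OF smooth_flat_exp[of 1] smooth_affine[OF smooth_flat_exp[of 1], of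
        "-1" 1]]
    by simp
  have "continuous_on UNIV b"
    using continuous_on_Re[OF smooth_continuous[OF sb]] by simp
  then obtain H where "\<And>x. (H has_vector_derivative b x) (at x)"
    using continuous_antiderivative by blast
  then have H: "(H has_real_derivative b x) (at x)" for x
    by (simp add: has_real_derivative_iff_has_vector_derivative)
  have b0: "b x \<ge> 0" for x by (simp add: b_def flat_exp_def)
  have bp: "b x > 0" if "0 < x" "x < 1" for x using that by (simp add: b_def flat_exp_def)
  have bz: "b x = 0" if "x \<le> 0 \<or> x \<ge> 1" for x using that by (auto simp: b_def flat_exp_def)
  have mono: "x \<le> y \<Longrightarrow> H x \<le> H y" for x y
    using H b0 by (meson DERIV_nonneg_imp_nondecreasing)
  have Hc: "continuous_on A H" for A
    by (meson H DERIV_isCont continuous_at_imp_continuous_on)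
  have "H 0 < H 1"
    by (rule DERIV_pos_imp_increasing_open) (use H bp Hc in auto)
  have c0: "H x = H 0" if "x \<le> 0" for x
  proof (cases "x < 0")
    case True
    then show ?thesis
      by (intro DERIV_isconst_end[symmetric] Hc) (metis H bz less_imp_le)+
  qed (use that in auto)
  have c1: "H x = H 1" if "x \<ge> 1" for x
  proof (cases "x > 1")
    case True
    then show ?thesis
      by (intro DERIV_isconst_end Hc) (metis H bz less_imp_le)+
  qed (use that in auto)
  define h where "h x = (H x - H 0) / (H 1 - H 0)" for x
  show thesis
  proof (rule that[of h])
    have "smooth (\<lambda>x. complex_of_real (H x))"
      by (rule smooth_primitive[OF sb])
        (use H in \<open>auto intro: has_vector_derivative_of_real simp:
            has_real_derivative_iff_has_vector_derivative\<close>)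
    from smooth_cmult[OF smooth_add[OF this smooth_const[of "- of_real (H 0)"]], of
        "inverse (of_real (H 1 - H 0))"]
    show "smooth (\<lambda>x. of_real (h x))" by (simp add: h_def divide_inverse mult.commute)
    show "h x = 0" if "x \<le> 0" for x using c0[OF that] by (simp add: h_def)
    show "h x = 1" if "x \<ge> 1" for x using c1[OF that] \<open>H 0 < H 1\<close> by (simp add: h_def)
    show "0 \<le> h x" for x
      using \<open>H 0 < H 1\<close> mono[of 0 x] c0[of x] by (cases "x \<ge> 0") (auto simp: h_def)
    show "h x \<le> 1" for x
      using \<open>H 0 < H 1\<close> mono[of x 1] c1[of x] by (cases "x \<ge> 1") (auto simp: h_def)
  qed
qed

section \<open>Test functions, cutoffs and primitives\<close>

lemma test_fun_iff: "\<phi> \<in> test_fun \<longleftrightarrow> smooth \<phi> \<and> (\<exists>R. \<forall>x. \<phi> x \<noteq> 0 \<longrightarrow> \<bar>x\<bar> \<le> R)"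
proof -
  have "compact (closure {x. \<phi> x \<noteq> 0}) \<longleftrightarrow> bounded {x. \<phi> x \<noteq> 0}"
    using bounded_closure bounded_subset[OF _ closure_subset] by (auto simp: compact_eq_bounded_closed)
  then show ?thesis by (auto simp: test_fun_def smooth_def bounded_iff)
qed

lemma test_fun_smooth: "\<phi> \<in> test_fun \<Longrightarrow> smooth \<phi>"
  by (simp add: test_fun_iff)

lemma test_funI: "smooth \<phi> \<Longrightarrow> (\<And>x. \<phi> x \<noteq> 0 \<Longrightarrow> a \<le> x \<and> x \<le> b) \<Longrightarrow> \<phi> \<in> test_fun"
  unfolding test_fun_iff by (intro conjI exI[of _ "\<bar>a\<bar> + \<bar>b\<bar>"]) force+

lemma test_fun_bounds:
  assumes "\<phi> \<in> test_fun"
  obtains R where "R > 0" "\<And>x. \<phi> x \<noteq> 0 \<Longrightarrow> \<bar>x\<bar> < R"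
proof -
  obtain R where R: "\<forall>x. \<phi> x \<noteq> 0 \<longrightarrow> \<bar>x\<bar> \<le> R" using assms by (auto simp: test_fun_iff)
  show thesis by (rule that[of "\<bar>R\<bar> + 1"]) (use R in force)+
qed

text \<open>The complement of a closed interval is open, so near a point outside
  \<open>\<phi>\<close> coincides with the zero function.\<close>

lemma vderiv_zero_outside:
  assumes "\<And>x. \<phi> x \<noteq> 0 \<Longrightarrow> a \<le> x \<and> x \<le> b" "vderiv \<phi> x \<noteq> 0"
  shows "a \<le> x \<and> x \<le> b"
proof (rule ccontr)
  assume *: "\<not> (a \<le> x \<and> x \<le> b)"
  have "((\<lambda>x. 0) has_vector_derivative 0) (at x)" by simp
  then have "(\<phi> has_vector_derivative 0) (at x)"
    by (rule has_vector_derivative_transform_within_open[of _ _ _ "- {a..b}"])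
      (use * assms(1) in \<open>auto simp: open_Compl\<close>)
  then show False using assms(2) by (simp add: vderiv_eq vector_derivative_at)
qed

lemma test_fun_vderiv:
  assumes \<phi>: "\<phi> \<in> test_fun"
  shows "vderiv \<phi> \<in> test_fun"
proof -
  obtain R where R: "\<And>x. \<phi> x \<noteq> 0 \<Longrightarrow> \<bar>x\<bar> < R" using test_fun_bounds[OF \<phi>] by blast
  have "-R \<le> x \<and> x \<le> R" if "vderiv \<phi> x \<noteq> 0" for x
    using that by (rule vderiv_zero_outside[rotated]) (use R in force)
  then show ?thesis
    by (rule test_funI[OF smooth_vderiv[OF test_fun_smooth[OF \<phi>]]])
qed

lemma test_fun_add:
  assumes "\<phi> \<in> test_fun" "\<psi> \<in> test_fun"
  shows "(\<lambda>x. \<phi> x + \<psi> x) \<in> test_fun"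
proof -
  obtain R S where R: "\<And>x. \<phi> x \<noteq> 0 \<Longrightarrow> \<bar>x\<bar> < R" and S: "\<And>x. \<psi> x \<noteq> 0 \<Longrightarrow> \<bar>x\<bar> < S"
    using assms by (meson test_fun_bounds)
  have "\<bar>x\<bar> \<le> max R S" if "\<phi> x + \<psi> x \<noteq> 0" for x
    using that R[of x] S[of x] by (cases "\<phi> x = 0") auto
  then show ?thesis
    using assms by (auto simp: test_fun_iff intro!: smooth_add)
qed

lemma test_fun_mult: "smooth f \<Longrightarrow> \<psi> \<in> test_fun \<Longrightarrow> (\<lambda>x. f x * \<psi> x) \<in> test_fun"
  unfolding test_fun_iff by (auto intro!: smooth_mult)

lemma test_fun_cmult: "\<psi> \<in> test_fun \<Longrightarrow> (\<lambda>x. c * \<psi> x) \<in> test_fun"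
  by (rule test_fun_mult[OF smooth_const])

lemma test_fun_diff: "\<phi> \<in> test_fun \<Longrightarrow> \<psi> \<in> test_fun \<Longrightarrow> (\<lambda>x. \<phi> x - \<psi> x) \<in> test_fun"
  using test_fun_add[OF _ test_fun_cmult[of \<psi> "-1"], of \<phi>] by simp

lemma test_fun_zero: "(\<lambda>x. 0) \<in> test_fun"
  by (simp add: test_fun_iff)

lemma test_fun_norm_square:
  assumes "\<phi> \<in> test_fun"
  shows "(\<lambda>x. complex_of_real ((norm (\<phi> x))\<^sup>2)) \<in> test_fun"
  using test_fun_mult[OF smooth_cnj[OF test_fun_smooth[OF assms]] assms]
  by (simp only: complex_norm_square mult.commute)

lemma vderiv_norm_square:
  assumes "\<phi> \<in> test_fun"
  shows "vderiv (\<lambda>x. complex_of_real ((norm (\<phi> x))\<^sup>2)) x = complex_of_real (2 * (\<phi> x \<bullet> vderiv \<phi> x))"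
proof -
  have s: "smooth \<phi>" using assms by (rule test_fun_smooth)
  have "(\<lambda>x. complex_of_real ((norm (\<phi> x))\<^sup>2)) = (\<lambda>x. \<phi> x * cnj (\<phi> x))"
    by (simp only: complex_norm_square)
  then show ?thesis
    by (simp add: vderiv_smooth_mult[OF s smooth_cnj[OF s]] vderiv_smooth_cnj[OF s] complex_eq_iff
        inner_complex_def)
qed

lemma cutoff_exists:
  fixes a b d :: real
  assumes "d > 0" "a \<le> b"
  obtains h :: "real \<Rightarrow> real" where "(\<lambda>x. of_real (h x)) \<in> test_fun"
    "\<And>x. a \<le> x \<Longrightarrow> x \<le> b \<Longrightarrow> h x = 1" "\<And>x. h x \<noteq> 0 \<Longrightarrow> a - d < x \<and> x < b + d"
    "\<And>x. 0 \<le> h x" "\<And>x. h x \<le> 1"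
proof -
  obtain s :: "real \<Rightarrow> real" where s: "smooth (\<lambda>x. of_real (s x))"
    "\<And>x. x \<le> 0 \<Longrightarrow> s x = 0" "\<And>x. x \<ge> 1 \<Longrightarrow> s x = 1" "\<And>x. 0 \<le> s x" "\<And>x. s x \<le> 1"
    using smooth_step_exists by blast
  \<comment> \<open>A rising step on \<open>[a - d, a]\<close> times a falling step on
    \<open>[b, b + d]\<close>.\<close>
  define h where "h x = s ((x - (a - d)) / d) * s ((b + d - x) / d)" for x
  have *: "a - d < x \<and> x < b + d" if "h x \<noteq> 0" for x
  proof (rule ccontr)
    assume "\<not> (a - d < x \<and> x < b + d)"
    then have "(x - (a - d)) / d \<le> 0 \<or> (b + d - x) / d \<le> 0"
      using assms(1) by (auto simp: divide_nonpos_pos)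
    then show False using s(2) that by (auto simp: h_def)
  qed
  have "smooth (\<lambda>x. of_real (h x))"
  proof -
    have "(x - (a - d)) / d = 1/d * x + (d - a) / d" "(b + d - x) / d = -1/d * x + (b + d)/d" for x
      by (simp_all add: diff_divide_distrib add_divide_distrib)
    then show ?thesis
      using smooth_mult[OF smooth_affine[OF s(1), of "1/d" "(d - a) / d"] smooth_affine[OF s(1), of "-1/d"
          "(b + d)/d"]]
      by (simp only: h_def of_real_mult)
  qed
  then have 1: "(\<lambda>x. of_real (h x)) \<in> test_fun"
    by (rule test_funI[of _ "a - d" "b + d"]) (use * in force)
  have 2: "h x = 1" if "a \<le> x" "x \<le> b" for x
    using that assms(1) s(3) by (simp add: h_def)
  have 3: "0 \<le> h x" "h x \<le> 1" for x
    using s(4,5) by (auto simp: h_def mult_le_one)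
  show thesis using that[OF 1 2 _ 3] * by simp
qed

lemma test_fun_integrable:
  assumes \<phi>: "\<phi> \<in> test_fun"
  shows "integrable lborel \<phi>"
proof -
  obtain R where R: "\<And>x. \<phi> x \<noteq> 0 \<Longrightarrow> \<bar>x\<bar> < R" using test_fun_bounds[OF \<phi>] by blast
  have "integrable lborel (\<lambda>x. indicator {-R..R} x *\<^sub>R \<phi> x)"
    using borel_integrable_atLeastAtMost'[OF smooth_continuous[OF test_fun_smooth[OF \<phi>]]]
    by (simp add: set_integrable_def)
  also have "(\<lambda>x. indicator {-R..R} x *\<^sub>R \<phi> x) = \<phi>"
    using R by (force simp: indicator_def fun_eq_iff)
  finally show "integrable lborel \<phi>" .
qed

text \<open>Vanishing mean is exactly the condition for the primitive that starts from 0 at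
  \<open>a\<close> to be 0 again to the right of \<open>b\<close>.\<close>

lemma test_fun_primitive:
  assumes \<phi>: "\<phi> \<in> test_fun" and 0: "integral\<^sup>L lborel \<phi> = 0"
    and supp: "\<And>x. \<phi> x \<noteq> 0 \<Longrightarrow> a \<le> x \<and> x \<le> b"
  obtains \<psi> where "\<psi> \<in> test_fun" "vderiv \<psi> = \<phi>" "\<And>x. \<psi> x \<noteq> 0 \<Longrightarrow> a \<le> x \<and> x \<le> b"
proof -
  have s: "smooth \<phi>" using \<phi> by (rule test_fun_smooth)
  obtain F where F: "\<And>x. (F has_vector_derivative \<phi> x) (at x)"
    using continuous_antiderivative[OF smooth_continuous[OF s]] by blast
  have FTC: "F y - F x = (LINT t|lborel. indicator {x..y} t *\<^sub>R \<phi> t)" if "x \<le> y" for x y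
    using integral_FTC_atLeastAtMost[OF that has_vector_derivative_at_within[OF F] smooth_continuous[OF s]]
    by simp
  define \<psi> where "\<psi> x = F x - F a" for x
  have d: "(\<psi> has_vector_derivative \<phi> x) (at x)" for x
    unfolding \<psi>_def using has_vector_derivative_diff[OF F has_vector_derivative_const[of "F a"]] by simp
  have z: "a \<le> x \<and> x \<le> b" if "\<psi> x \<noteq> 0" for x
  proof (rule ccontr)
    assume "\<not> (a \<le> x \<and> x \<le> b)"
    then consider "x < a" | "x > b" "x \<ge> a" by linarith
    then show False
    proof cases
      case 1
      \<comment> \<open>Only the endpoint \<open>a\<close> can contribute, and it is a null
        set.\<close>
      have "(LINT t|lborel. indicator {x..a} t *\<^sub>R \<phi> t) = (LINT t|lborel. indicator {a} t *\<^sub>R \<phi> t)"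
        using supp 1 by (intro Bochner_Integration.integral_cong) (auto simp: indicator_def of_bool_def
            not_less intro: antisym)
      also have "\<dots> = 0"
        by (rule integral_eq_zero_AE, rule AE_mp[OF AE_lborel_singleton[of a]]) auto
      finally show False using FTC[of x a] that 1 by (simp add: \<psi>_def)
    next
      case 2
      have "(LINT t|lborel. indicator {a..x} t *\<^sub>R \<phi> t) = integral\<^sup>L lborel \<phi>"
        using supp 2 by (intro Bochner_Integration.integral_cong) (force simp: indicator_def)+
      then show False using FTC[of a x] that 2 0 by (simp add: \<psi>_def)
    qed
  qed
  show thesis
  proof (rule that)
    show "\<psi> \<in> test_fun" by (rule test_funI[OF smooth_primitive[OF s d] z])
    show "vderiv \<psi> = \<phi>" by (rule vderiv_eqI[OF d])
  qed (rule z)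
qed

section \<open>Absolutely continuous functions and weak derivatives\<close>

definition loc_int :: "(real \<Rightarrow> 'a::{banach, second_countable_topology}) \<Rightarrow> bool" where
  "loc_int f \<longleftrightarrow> f \<in> borel_measurable borel \<and> (\<forall>a b. set_integrable lborel {a..b} f)"

text \<open>\<open>ac F f\<close>: the function \<open>F\<close> is locally absolutely continuous with almost everywhere derivative \<open>f\<close>.\<close>

definition ac :: "(real \<Rightarrow> 'a::{real_normed_field, euclidean_space}) \<Rightarrow> (real \<Rightarrow> 'a) \<Rightarrow> bool" where
  "ac F f \<longleftrightarrow> loc_int f \<and> (\<forall>a b. a \<le> b \<longrightarrow> F b - F a = (LINT x:{a..b}|lborel. f x))"

lemma norm_mult_le_squares: "norm x * norm y \<le> (norm x)\<^sup>2 + (norm y)\<^sup>2"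
proof -
  have "0 \<le> (norm x - norm y)\<^sup>2 + (norm x)\<^sup>2 + (norm y)\<^sup>2" by simp
  then show ?thesis by (simp add: power2_diff)
qed

lemma norm_add_squared_le: "(norm (x + y))\<^sup>2 \<le> 2 * (norm x)\<^sup>2 + 2 * (norm y)\<^sup>2"
proof -
  have "(norm (x + y))\<^sup>2 \<le> (norm x + norm y)\<^sup>2" by (intro power_mono norm_triangle_ineq) simp
  also have "\<dots> \<le> 2 * (norm x)\<^sup>2 + 2 * (norm y)\<^sup>2"
    using sum_squares_ge_zero[of "norm x - norm y" 0] by (simp add: power2_eq_square algebra_simps)
  finally show ?thesis .
qed

lemma loc_int_measurable: "loc_int f \<Longrightarrow> f \<in> borel_measurable borel"
  by (simp add: loc_int_def)

lemma loc_int_set: "loc_int f \<Longrightarrow> set_integrable lborel {a..b} f"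
  by (simp add: loc_int_def)

lemma loc_int_add: "loc_int f \<Longrightarrow> loc_int g \<Longrightarrow> loc_int (\<lambda>x. f x + g x)"
  by (auto simp: loc_int_def intro: set_integral_add(1))

lemma loc_int_diff: "loc_int f \<Longrightarrow> loc_int g \<Longrightarrow> loc_int (\<lambda>x. f x - g x)"
  by (auto simp: loc_int_def intro: set_integral_diff(1))

lemma loc_int_bounded_linear: "bounded_linear T \<Longrightarrow> loc_int f \<Longrightarrow> loc_int (\<lambda>x. T (f x))"
  unfolding loc_int_def set_integrable_def
  using integrable_bounded_linear[of T lborel "\<lambda>x. indicator {_.._} x *\<^sub>R f x"]
  by (auto simp: linear_scale[OF bounded_linear.linear] intro: borel_measurable_continuous_onI
      measurable_compose[OF _ borel_measurable_continuous_onI[OF linear_continuous_on]])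

lemma loc_int_cmult:
  fixes f :: "real \<Rightarrow> 'a::{real_normed_field, euclidean_space}"
  shows "loc_int f \<Longrightarrow> loc_int (\<lambda>x. c * f x)"
  by (rule loc_int_bounded_linear[OF bounded_linear_mult_right])

lemma loc_int_of_real: "loc_int f \<Longrightarrow> loc_int (\<lambda>x. of_real (f x) :: complex)"
  by (rule loc_int_bounded_linear[OF bounded_linear_of_real])

lemma loc_int_bound:
  assumes "loc_int f" "g \<in> borel_measurable borel" "\<And>x. norm (g x) \<le> norm (f x)"
  shows "loc_int g"
  unfolding loc_int_def set_integrable_def
proof (intro conjI allI assms)
  fix a b
  show "integrable lborel (\<lambda>x. indicat_real {a..b} x *\<^sub>R g x)"
    by (rule Bochner_Integration.integrable_bound[OF loc_int_set[OF assms(1), of a b, unfolded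
        set_integrable_def]])
      (use assms in \<open>auto simp: indicator_def\<close>)
qed

lemma loc_int_norm: "loc_int f \<Longrightarrow> loc_int (\<lambda>x. norm (f x))"
  by (rule loc_int_bound) (auto simp: loc_int_def)

lemma loc_int_continuous: "continuous_on UNIV f \<Longrightarrow> loc_int f"
  unfolding loc_int_def
  by (auto intro: borel_measurable_continuous_onI borel_integrable_atLeastAtMost' continuous_on_subset)

lemma loc_int_mult_continuous:
  fixes f :: "real \<Rightarrow> 'a::{real_normed_field, euclidean_space}"
  assumes f: "loc_int f" and g: "continuous_on UNIV g"
  shows "loc_int (\<lambda>x. g x * f x)"
  unfolding loc_int_def
proof (intro conjI allI)
  have gm [measurable]: "g \<in> borel_measurable borel" by (rule borel_measurable_continuous_onI[OF g])
  have fm [measurable]: "f \<in> borel_measurable borel" by (rule loc_int_measurable[OF f])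
  show "(\<lambda>x. g x * f x) \<in> borel_measurable borel" by simp
  fix a b :: real
  have "compact (g ` {a..b})"
    by (intro compact_continuous_image continuous_on_subset[OF g]) auto
  then obtain B where B: "\<And>x. x \<in> {a..b} \<Longrightarrow> norm (g x) \<le> B"
    by (meson bounded_iff compact_imp_bounded image_eqI)
  have "integrable lborel (\<lambda>x. B * norm (indicat_real {a..b} x *\<^sub>R f x))"
    using loc_int_set[OF f, of a b] by (intro integrable_mult_right integrable_norm)
        (simp add: set_integrable_def)
  then show "set_integrable lborel {a..b} (\<lambda>x. g x * f x)"
    unfolding set_integrable_def
  proof (rule Bochner_Integration.integrable_bound)
    show "AE x in lborel. norm (indicat_real {a..b} x *\<^sub>R (g x * f x))
        \<le> norm (B * norm (indicat_real {a..b} x *\<^sub>R f x))"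
    proof (rule AE_I2)
      fix x show "norm (indicat_real {a..b} x *\<^sub>R (g x * f x))
          \<le> norm (B * norm (indicat_real {a..b} x *\<^sub>R f x))"
        using B[of x] by (auto simp: indicator_def norm_mult abs_mult intro!: mult_right_mono)
    qed
  qed simp
qed

section \<open>Locally square integrable functions\<close>

lemma L2_loc_measurable: "f \<in> L2_loc \<Longrightarrow> f \<in> borel_measurable borel"
  by (simp add: L2_loc_def)

lemma L2_loc_iff:
  "f \<in> L2_loc \<longleftrightarrow> f \<in> borel_measurable borel \<and> loc_int (\<lambda>x. (norm (f x))\<^sup>2)"
proof
  assume "f \<in> L2_loc"
  then show "f \<in> borel_measurable borel \<and> loc_int (\<lambda>x. (norm (f x))\<^sup>2)"
    by (auto simp: L2_loc_def loc_int_def)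
next
  assume *: "f \<in> borel_measurable borel \<and> loc_int (\<lambda>x. (norm (f x))\<^sup>2)"
  have "set_integrable lborel K (\<lambda>x. (norm (f x))\<^sup>2)" if K: "compact K" for K
  proof -
    obtain R where "\<And>x. x \<in> K \<Longrightarrow> norm x \<le> R"
      using compact_imp_bounded[OF K] by (auto simp: bounded_iff)
    then have "K \<subseteq> {-R..R}" by force
    then show ?thesis
      using * K by (intro set_integrable_subset[OF loc_int_set[of _ "-R" R]]) (auto intro: borel_compact)
  qed
  then show "f \<in> L2_loc" using * by (simp add: L2_loc_def)
qed

lemma L2_loc_mult:
  fixes f g :: "real \<Rightarrow> 'a::{real_normed_field, euclidean_space}"
  assumes "f \<in> L2_loc" "g \<in> L2_loc"
  shows "loc_int (\<lambda>x. f x * g x)"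
proof (rule loc_int_bound)
  show "loc_int (\<lambda>x. (norm (f x))\<^sup>2 + (norm (g x))\<^sup>2)"
    using assms by (auto simp: L2_loc_iff intro: loc_int_add)
  show "(\<lambda>x. f x * g x) \<in> borel_measurable borel"
    using assms[THEN L2_loc_measurable] by simp
  fix x
  show "norm (f x * g x) \<le> norm ((norm (f x))\<^sup>2 + (norm (g x))\<^sup>2)"
    using norm_mult_le_squares[of "f x" "g x"] by (simp add: norm_mult)
qed

lemma L2_loc_continuous: "continuous_on UNIV f \<Longrightarrow> f \<in> L2_loc"
  by (auto simp: L2_loc_iff intro: borel_measurable_continuous_onI intro!: loc_int_continuous
      continuous_intros)

lemma L2_loc_loc_int:
  fixes f :: "real \<Rightarrow> 'a::{real_normed_field, euclidean_space}"
  shows "f \<in> L2_loc \<Longrightarrow> loc_int f"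
  using L2_loc_mult[OF L2_loc_continuous[of "\<lambda>x. 1"]] by simp

lemma L2_loc_mult_continuous:
  fixes f :: "real \<Rightarrow> 'a::{real_normed_field, euclidean_space}"
  assumes "f \<in> L2_loc" "continuous_on UNIV g"
  shows "(\<lambda>x. g x * f x) \<in> L2_loc"
  unfolding L2_loc_iff
proof
  show "(\<lambda>x. g x * f x) \<in> borel_measurable borel"
    using L2_loc_measurable[OF assms(1)] borel_measurable_continuous_onI[OF assms(2)] by simp
  have "loc_int (\<lambda>x. (norm (g x))\<^sup>2 * (norm (f x))\<^sup>2)"
    using assms by (intro loc_int_mult_continuous continuous_intros) (auto simp: L2_loc_iff)
  then show "loc_int (\<lambda>x. (norm (g x * f x))\<^sup>2)" by (simp add: norm_mult power_mult_distrib)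
qed

lemma L2_loc_bound:
  assumes "f \<in> L2_loc" "g \<in> borel_measurable borel" "\<And>x. norm (g x) \<le> norm (f x)"
  shows "g \<in> L2_loc"
  unfolding L2_loc_iff
proof
  show "loc_int (\<lambda>x. (norm (g x))\<^sup>2)"
    by (rule loc_int_bound[of "\<lambda>x. (norm (f x))\<^sup>2"]) (use assms in \<open>auto simp: L2_loc_iff intro: power_mono\<close>)
qed (rule assms)

lemma L2_loc_add:
  fixes f g :: "real \<Rightarrow> 'a::{real_normed_field, euclidean_space}"
  assumes "f \<in> L2_loc" "g \<in> L2_loc"
  shows "(\<lambda>x. f x + g x) \<in> L2_loc"
  unfolding L2_loc_iff
proof
  show m: "(\<lambda>x. f x + g x) \<in> borel_measurable borel"
    using assms[THEN L2_loc_measurable] by simp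
  have "loc_int (\<lambda>x. 2 * (norm (f x))\<^sup>2 + 2 * (norm (g x))\<^sup>2)"
    using assms by (auto simp: L2_loc_iff intro!: loc_int_cmult loc_int_add)
  then show "loc_int (\<lambda>x. (norm (f x + g x))\<^sup>2)"
    by (rule loc_int_bound) (use m norm_add_squared_le in auto)
qed

lemma L2_loc_of_real: "f \<in> L2_loc \<Longrightarrow> (\<lambda>x. complex_of_real (f x)) \<in> L2_loc"
  by (auto simp: L2_loc_iff)

lemma L2_loc_Re: "f \<in> L2_loc \<Longrightarrow> (\<lambda>x. Re (f x)) \<in> L2_loc"
  by (rule L2_loc_bound) (auto simp: L2_loc_def abs_Re_le_cmod)

section \<open>Calculus of locally absolutely continuous functions\<close>

lemma LINT_split:
  fixes f :: "real \<Rightarrow> 'a::euclidean_space"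
  assumes "loc_int f" "a \<le> c" "c \<le> b"
  shows "(LINT x:{a..c}|lborel. f x) + (LINT x:{c..b}|lborel. f x) = (LINT x:{a..b}|lborel. f x)"
  using assms loc_int_set[OF assms(1)]
  by (simp add: set_borel_integral_eq_integral Henstock_Kurzweil_Integration.integral_combine)

lemma ac_exists:
  assumes f: "loc_int f"
  obtains F where "ac F f" "F 0 = 0"
proof
  define F where "F x = (if 0 \<le> x then (LINT t:{0..x}|lborel. f t) else - (LINT t:{x..0}|lborel. f t))" for x
  have "F b - F a = (LINT x:{a..b}|lborel. f x)" if "a \<le> b" for a b
    using LINT_split[OF f, of 0 a b] LINT_split[OF f, of a b 0] LINT_split[OF f, of a 0 b] that
    by (auto simp: F_def algebra_simps)
  then show "ac F f" using f by (simp add: ac_def)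
  show "F 0 = 0"
  proof -
    have "(LINT t:{0..0}|lborel. f t) = 0"
      unfolding set_lebesgue_integral_def
      by (rule integral_eq_zero_AE, rule AE_mp[OF AE_lborel_singleton[of 0]]) auto
    then show ?thesis by (simp add: F_def)
  qed
qed

lemma ac_loc_int: "ac F f \<Longrightarrow> loc_int f"
  by (simp add: ac_def)

lemma ac_LINT: "ac F f \<Longrightarrow> a \<le> b \<Longrightarrow> (LINT x:{a..b}|lborel. f x) = F b - F a"
  by (simp add: ac_def)

lemma ac_continuous:
  assumes F: "ac F f"
  shows "continuous_on A F"
proof -
  have "isCont F x" for x
  proof -
    have "f integrable_on {x - 1..x + 1}"
      using loc_int_set[OF ac_loc_int[OF F]] by (rule set_borel_integral_eq_integral)
    from indefinite_integral_continuous_1[OF this]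
    have "continuous_on {x - 1..x + 1} (\<lambda>t. F (x - 1) + integral {x - 1..t} f)"
      by (intro continuous_intros)
    moreover have "F (x - 1) + integral {x - 1..t} f = F t" if "t \<in> {x - 1..x + 1}" for t
      using that ac_LINT[OF F, of "x - 1" t] set_borel_integral_eq_integral(2)[OF loc_int_set[OF ac_loc_int[OF
          F]], of "x - 1" t]
      by auto
    ultimately have "continuous_on {x - 1..x + 1} F" by (rule continuous_on_eq)
    then have "continuous_on {x - 1<..<x + 1} F" by (rule continuous_on_subset) auto
    then show ?thesis by (simp add: continuous_on_eq_continuous_at)
  qed
  then show ?thesis by (simp add: continuous_at_imp_continuous_on)
qed

text \<open>The second argument enters \<open>ac\<close> only through its integrals and so matters
  only up to null sets, whereas the first is a genuine continuous function. This is how identities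
  valid almost everywhere can be used for derivatives.\<close>

lemma ac_cong_AE:
  assumes "ac F f" "g \<in> borel_measurable borel" "AE x in lborel. f x = g x"
  shows "ac F g"
proof -
  have *: "AE x in lborel. indicator {a..b} x *\<^sub>R f x = indicator {a..b} x *\<^sub>R g x" for a b :: real
    using assms(3) by eventually_elim simp
  have m: "f \<in> borel_measurable borel" using assms(1) by (simp add: ac_def loc_int_def)
  have "set_integrable lborel {a..b} g" for a b
    using integrable_cong_AE[OF _ _ *[of a b]] loc_int_set[OF ac_loc_int[OF assms(1)], of a b] m assms(2)
    by (simp add: set_integrable_def)
  moreover have "(LINT x:{a..b}|lborel. f x) = (LINT x:{a..b}|lborel. g x)" for a b
    unfolding set_lebesgue_integral_def using m assms(2) by (intro integral_cong_AE * ) auto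
  ultimately show ?thesis using assms by (simp add: ac_def loc_int_def)
qed

lemma ac_const: "ac (\<lambda>x. c) (\<lambda>x. 0)"
  by (simp add: ac_def loc_int_def set_integrable_def set_lebesgue_integral_def)

lemma ac_add: "ac F f \<Longrightarrow> ac G g \<Longrightarrow> ac (\<lambda>x. F x + G x) (\<lambda>x. f x + g x)"
  by (simp add: ac_def loc_int_add loc_int_set set_integral_add(2)) (simp add: algebra_simps flip: ac_def)

lemma ac_bounded_linear:
  assumes "bounded_linear T" "ac F f"
  shows "ac (\<lambda>x. T (F x)) (\<lambda>x. T (f x))"
  unfolding ac_def
proof (intro conjI allI impI)
  show "loc_int (\<lambda>x. T (f x))" using assms loc_int_bounded_linear ac_loc_int by blast
  fix a b :: real assume "a \<le> b"
  then show "T (F b) - T (F a) = (LINT x:{a..b}|lborel. T (f x))"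
    using integral_bounded_linear[OF assms(1) loc_int_set[OF ac_loc_int[OF assms(2)], unfolded
        set_integrable_def], of a b]
      ac_LINT[OF assms(2), of a b] linear_diff[OF bounded_linear.linear[OF assms(1)]]
    by (simp add: set_lebesgue_integral_def linear_scale[OF bounded_linear.linear[OF assms(1)]])
qed

lemma ac_cmult: "ac F f \<Longrightarrow> ac (\<lambda>x. c * F x) (\<lambda>x. c * f x)"
  by (rule ac_bounded_linear[OF bounded_linear_mult_right])

lemma ac_minus: "ac F f \<Longrightarrow> ac (\<lambda>x. - F x) (\<lambda>x. - f x)"
  using ac_cmult[of F f "-1"] by simp

lemma ac_diff: "ac F f \<Longrightarrow> ac G g \<Longrightarrow> ac (\<lambda>x. F x - G x) (\<lambda>x. f x - g x)"
  using ac_add[OF _ ac_minus, of F f G g] by simp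

lemma ac_of_real: "ac F f \<Longrightarrow> ac (\<lambda>x. complex_of_real (F x)) (\<lambda>x. of_real (f x))"
  by (rule ac_bounded_linear[OF bounded_linear_of_real])

lemma ac_Re: "ac F f \<Longrightarrow> ac (\<lambda>x. Re (F x)) (\<lambda>x. Re (f x))"
  by (rule ac_bounded_linear[OF bounded_linear_Re])

lemma ac_Im: "ac F f \<Longrightarrow> ac (\<lambda>x. Im (F x)) (\<lambda>x. Im (f x))"
  by (rule ac_bounded_linear[OF bounded_linear_Im])

lemma ac_zero_const: "ac F (\<lambda>x. 0) \<Longrightarrow> F x = F y"
  using ac_LINT[of F "\<lambda>x. 0" x y] ac_LINT[of F "\<lambda>x. 0" y x]
  by (cases "x \<le> y") (auto simp: set_lebesgue_integral_def)

lemma ac_C1: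
  assumes "\<And>x. (F has_vector_derivative f x) (at x)" "continuous_on UNIV f"
  shows "ac F f"
  unfolding ac_def set_lebesgue_integral_def
  using assms
  by (auto intro!: integral_FTC_atLeastAtMost[symmetric] loc_int_continuous
      intro: continuous_on_subset has_vector_derivative_at_within)

lemma ac_smooth: "smooth f \<Longrightarrow> ac f (vderiv f)"
  by (intro ac_C1 smooth_has_vderiv smooth_continuous smooth_vderiv)

lemma integrable_tensor:
  fixes f g :: "real \<Rightarrow> 'a::{real_normed_field, banach, second_countable_topology}"
  assumes f: "integrable lborel f" and g: "integrable lborel g"
  shows "integrable (lborel \<Otimes>\<^sub>M lborel) (\<lambda>(x, y). f x * g y)"
proof (rule lborel_pair.Fubini_integrable)
  have [measurable]: "f \<in> borel_measurable borel" "g \<in> borel_measurable borel" using f g by auto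
  show "(\<lambda>(x, y). f x * g y) \<in> borel_measurable (lborel \<Otimes>\<^sub>M lborel)" by measurable
  show "integrable lborel (\<lambda>x. LINT y|lborel. norm (case (x, y) of (x, y) \<Rightarrow> f x * g y))"
    using f g by (simp add: norm_mult integrable_norm)
  show "AE x in lborel. integrable lborel (\<lambda>y. case (x, y) of (x, y) \<Rightarrow> f x * g y)"
    using g by simp
qed

text \<open>Fubini's hypothesis in the form in which it recurs: \<open>k\<close> is the indicator of
  a triangle in the product rule and a character \<open>cis\<close> in the Gaussian Parseval
  formula.\<close>

lemma integrable_tensor_bounded:
  fixes f g :: "real \<Rightarrow> 'a::{real_normed_field, banach, second_countable_topology}"
  assumes f: "integrable lborel f" and g: "integrable lborel g"
    and k: "case_prod k \<in> borel_measurable (lborel \<Otimes>\<^sub>M lborel)" "\<And>x y. norm (k x y) \<le> B"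
  shows "integrable (lborel \<Otimes>\<^sub>M lborel) (\<lambda>(x, y). k x y * (f x * g y))"
proof (rule Bochner_Integration.integrable_bound)
  have [measurable]: "f \<in> borel_measurable borel" "g \<in> borel_measurable borel" using f g by auto
  have [measurable]: "(\<lambda>z. k (fst z) (snd z)) \<in> borel_measurable (lborel \<Otimes>\<^sub>M lborel)"
    using k(1) by (simp add: case_prod_beta')
  show "integrable (lborel \<Otimes>\<^sub>M lborel) (\<lambda>z. B * norm (case z of (x, y) \<Rightarrow> f x * g y))"
    using integrable_tensor[OF f g] by (intro integrable_mult_right integrable_norm)
  show "(\<lambda>(x, y). k x y * (f x * g y)) \<in> borel_measurable (lborel \<Otimes>\<^sub>M lborel)"
    unfolding case_prod_beta' by measurable
  have "B \<ge> 0" using k(2)[of 0 0] norm_ge_zero order_trans by blast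
  then show "AE z in lborel \<Otimes>\<^sub>M lborel. norm (case z of (x, y) \<Rightarrow> k x y * (f x * g y))
      \<le> norm (B * norm (case z of (x, y) \<Rightarrow> f x * g y))"
    using k(2) by (intro AE_I2) (auto simp: norm_mult abs_mult intro!: mult_right_mono)
qed

text \<open>The boundary terms come from Fubini's theorem for \<open>f t * g x\<close> on the triangle \<open>a \<le> t \<le> x \<le> b\<close>.\<close>

lemma ac_mult:
  assumes F: "ac F f" and G: "ac G g"
  shows "ac (\<lambda>x. F x * G x) (\<lambda>x. F x * g x + f x * G x)"
proof -
  have lf: "loc_int f" and lg: "loc_int g" using F G by (auto intro: ac_loc_int)
  have li1: "loc_int (\<lambda>x. F x * g x)" by (rule loc_int_mult_continuous[OF lg ac_continuous[OF F]])
  have li2: "loc_int (\<lambda>x. f x * G x)"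
    using loc_int_mult_continuous[OF lf ac_continuous[OF G]] by (simp add: mult.commute)
  have "F b * G b - F a * G a = (LINT x:{a..b}|lborel. F x * g x + f x * G x)" if ab: "a \<le> b" for a b
  proof -
    define f1 where "f1 x = indicator {a..b} x *\<^sub>R f x" for x
    define g1 where "g1 x = indicator {a..b} x *\<^sub>R g x" for x
    define k :: "real \<Rightarrow> real \<Rightarrow> 'a" where "k t x = (if t \<le> x then 1 else 0)" for t x
    have i1: "integrable lborel f1" "integrable lborel g1"
      using loc_int_set[OF lf, of a b] loc_int_set[OF lg, of a b]
          by (auto simp: f1_def[abs_def] g1_def[abs_def] set_integrable_def)
    have [measurable]: "f1 \<in> borel_measurable borel" "g1 \<in> borel_measurable borel" using i1 by auto
    have "integrable (lborel \<Otimes>\<^sub>M lborel) (\<lambda>(t, x). k t x * (f1 t * g1 x))"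
      by (rule integrable_tensor_bounded[OF i1, where B = 1]) (auto simp: k_def)
    from lborel_pair.Fubini_integral[OF this]
    have fub: "(LINT x|lborel. LINT t|lborel. k t x * (f1 t * g1 x))
        = (LINT t|lborel. LINT x|lborel. k t x * (f1 t * g1 x))" .
    \<comment> \<open>Integrating over \<open>t\<close> first leaves \<open>F x - F a\<close>,
      integrating over \<open>x\<close> first leaves \<open>G b - G t\<close>.\<close>
    have "(LINT t|lborel. k t x * (f1 t * g1 x)) = indicator {a..b} x *\<^sub>R ((F x - F a) * g x)" for x
    proof (cases "x \<in> {a..b}")
      case True
      have "(LINT t|lborel. k t x * (f1 t * g1 x)) = (LINT t|lborel. (indicator {a..x} t *\<^sub>R f t) * g x)"
        using True by (intro Bochner_Integration.integral_cong) (auto simp: k_def f1_def g1_def indicator_def)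
      also have "\<dots> = (F x - F a) * g x"
        using ac_LINT[OF F, of a x] True unfolding set_lebesgue_integral_def
            by (subst integral_mult_left_zero) simp
      finally show ?thesis using True by simp
    qed (auto simp: g1_def)
    moreover have "(LINT x|lborel. k t x * (f1 t * g1 x)) = indicator {a..b} t *\<^sub>R (f t * (G b - G t))" for t
    proof (cases "t \<in> {a..b}")
      case True
      have "(LINT x|lborel. k t x * (f1 t * g1 x)) = (LINT x|lborel. f t * (indicator {t..b} x *\<^sub>R g x))"
        using True by (intro Bochner_Integration.integral_cong) (auto simp: k_def f1_def g1_def indicator_def)
      also have "\<dots> = f t * (G b - G t)"
        using ac_LINT[OF G, of t b] True unfolding set_lebesgue_integral_def
            by (subst integral_mult_right_zero) simp
      finally show ?thesis using True by simp
    qed (auto simp: f1_def)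
    ultimately have "(LINT x:{a..b}|lborel. (F x - F a) * g x) = (LINT t:{a..b}|lborel. f t * (G b - G t))"
      using fub by (simp add: set_lebesgue_integral_def)
    moreover have "(LINT x:{a..b}|lborel. (F x - F a) * g x)
        = (LINT x:{a..b}|lborel. F x * g x) - F a * (G b - G a)"
      using ac_LINT[OF G ab] loc_int_set[OF li1] loc_int_set[OF lg]
          by (simp add: left_diff_distrib set_integral_diff(2))
    moreover have "(LINT x:{a..b}|lborel. f x * (G b - G x))
        = (F b - F a) * G b - (LINT x:{a..b}|lborel. f x * G x)"
      using ac_LINT[OF F ab] loc_int_set[OF li2] loc_int_set[OF lf]
          by (simp add: right_diff_distrib set_integral_diff(2))
    ultimately show ?thesis
      using loc_int_set[OF li1] loc_int_set[OF li2]
          by (simp add: set_integral_add(2)) (simp add: algebra_simps)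
  qed
  then show ?thesis using loc_int_add[OF li1 li2] by (simp add: ac_def)
qed

lemma ac_power: "ac R r \<Longrightarrow> ac (\<lambda>x. R x ^ Suc n / fact (Suc n)) (\<lambda>x. r x * (R x ^ n / fact n))"
proof (induction n)
  case (Suc n)
  \<comment> \<open>\<open>c\<close> is \<open>n + 2\<close>: the two terms of the product rule are
    \<open>n + 1\<close> copies and one copy of the wanted derivative.\<close>
  define c :: 'a where "c = of_nat (Suc (Suc n))"
  have c: "c \<noteq> 0" "c - 1 \<noteq> 0" using of_nat_neq_0[of n, where 'a = 'a]
      by (simp add: c_def del: of_nat_Suc) (use of_nat_neq_0[of n, where 'a = 'a] in \<open>simp add: c_def\<close>)
  have f: "fact (Suc (Suc n)) = c * fact (Suc n)" "fact (Suc n) = (c - 1) * fact n" by (simp_all add: c_def)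
  have "ac (\<lambda>x. R x * (R x ^ Suc n / fact (Suc n))) (\<lambda>x. R x * (r x * (R x ^ n / fact n))
      + r x * (R x ^ Suc n / fact (Suc n)))"
    by (rule ac_mult[OF Suc.prems Suc.IH[OF Suc.prems]])
  from ac_cmult[OF this, of "inverse c"]
  have "ac (\<lambda>x. inverse c * (R x * (R x ^ Suc n / fact (Suc n))))
    (\<lambda>x. inverse c * (R x * (r x * (R x ^ n / fact n)) + r x * (R x ^ Suc n / fact (Suc n))))" .
  moreover have "inverse c * (R x * (R x ^ Suc n / fact (Suc n))) = R x ^ Suc (Suc n) / fact (Suc (Suc n))"
      for x
    unfolding f(1) by (simp add: divide_inverse del: fact_Suc)
  moreover have "inverse c * (R x * (r x * (R x ^ n / fact n)) + r x * (R x ^ Suc n / fact (Suc n)))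
      = r x * (R x ^ Suc n / fact (Suc n))" for x
    unfolding f(2) using c by (simp add: field_simps del: fact_Suc)
  ultimately show ?case by simp
qed simp

text \<open>The chain rule is read off from the exponential series: each partial sum is
  \<open>ac\<close>, its derivative is \<open>r\<close> times the previous partial sum, and
  dominated convergence with majorant \<open>exp (norm (R x)) * norm (r x)\<close> passes to the
  limit under the integral.\<close>

lemma ac_exp:
  assumes R: "ac R r"
  shows "ac (\<lambda>x. exp (R x)) (\<lambda>x. exp (R x) * r x)"
proof -
  have cR: "continuous_on UNIV R" using R by (rule ac_continuous)
  have li: "loc_int (\<lambda>x. exp (R x) * r x)"
    by (intro loc_int_mult_continuous ac_loc_int[OF R] continuous_intros cR)
  define S where "S n x = (\<Sum>k<n. R x ^ k / fact k)" for n x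
  have S: "ac (S (Suc n)) (\<lambda>x. r x * S n x)" for n
  proof (induction n)
    case 0
    show ?case using ac_const[of 1] by (simp add: S_def[abs_def])
  next
    case (Suc n)
    from ac_add[OF this ac_power[OF R, of n]] show ?case
      by (simp add: S_def[abs_def] distrib_left algebra_simps del: fact_Suc power_Suc)
  qed
  have lim: "(\<lambda>n. S n x) \<longlonglongrightarrow> exp (R x)" for x
    using exp_converges[of "R x"] by (simp add: S_def sums_def scaleR_conv_of_real divide_inverse
        mult.commute)
  have bound: "norm (S n x) \<le> exp (norm (R x))" for n x
  proof -
    have "norm (S n x) \<le> (\<Sum>k<n. norm (R x) ^ k / fact k)"
      unfolding S_def by (rule sum_norm_le) (simp add: norm_power norm_divide)
    also have "\<dots> \<le> exp (norm (R x))"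
      using exp_converges[of "norm (R x)"] by (intro sum_le_suminf[of
          "\<lambda>k. norm (R x) ^ k / fact k", THEN order_trans])
        (auto simp: sums_iff divide_inverse mult.commute)
    finally show ?thesis .
  qed
  have "exp (R b) - exp (R a) = (LINT x:{a..b}|lborel. exp (R x) * r x)" if "a \<le> b" for a b
  proof (rule LIMSEQ_unique)
    show "(\<lambda>n. S (Suc n) b - S (Suc n) a) \<longlonglongrightarrow> exp (R b) - exp (R a)"
      by (intro tendsto_diff LIMSEQ_Suc lim)
    have "(\<lambda>n. LINT x:{a..b}|lborel. r x * S n x) \<longlonglongrightarrow> (LINT x:{a..b}|lborel. exp (R x) * r x)"
      unfolding set_lebesgue_integral_def
    proof (rule integral_dominated_convergence)
      have "loc_int (\<lambda>x. exp (norm (R x)) * norm (r x))"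
        by (intro loc_int_mult_continuous loc_int_norm ac_loc_int[OF R] continuous_intros cR)
      then show "integrable lborel (\<lambda>x. indicator {a..b} x *\<^sub>R (exp (norm (R x)) * norm (r x)))"
        using loc_int_set[of _ a b] by (simp only: set_integrable_def)
      show "AE x in lborel. (\<lambda>n. indicat_real {a..b} x *\<^sub>R (r x * S n x))
          \<longlonglongrightarrow> indicat_real {a..b} x *\<^sub>R (exp (R x) * r x)"
        using lim by (auto intro!: AE_I2 tendsto_scaleR tendsto_mult simp: mult.commute[of "exp _"])
      show "AE x in lborel. norm (indicat_real {a..b} x *\<^sub>R (r x * S n x))
          \<le> indicator {a..b} x *\<^sub>R (exp (norm (R x)) * norm (r x))" for n
        using bound[of n] by (auto intro!: AE_I2 mult_right_mono simp: norm_mult indicator_def mult.commute[of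
            "norm (r _)"])
      show "(\<lambda>x. indicat_real {a..b} x *\<^sub>R (exp (R x) * r x)) \<in> borel_measurable lborel"
        using loc_int_measurable[OF li] by simp
      show "(\<lambda>x. indicat_real {a..b} x *\<^sub>R (r x * S n x)) \<in> borel_measurable lborel" for n
        using loc_int_measurable[OF ac_loc_int[OF S[of n]]] by simp
    qed
    then show "(\<lambda>n. S (Suc n) b - S (Suc n) a) \<longlonglongrightarrow> (LINT x:{a..b}|lborel. exp (R x) * r x)"
      using ac_LINT[OF S that] by simp
  qed
  then show ?thesis using li by (simp add: ac_def)
qed

section \<open>Compact support and integration by parts\<close>

lemma integrable_supported:
  assumes f: "loc_int f" and supp: "\<And>x. f x \<noteq> 0 \<Longrightarrow> a \<le> x \<and> x \<le> b"
  shows "integrable lborel f" "integral\<^sup>L lborel f = (LINT x:{a..b}|lborel. f x)"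
proof -
  have *: "(\<lambda>x. indicator {a..b} x *\<^sub>R f x) = f"
    using supp by (auto simp: indicator_def fun_eq_iff)
  show "integrable lborel f" "integral\<^sup>L lborel f = (LINT x:{a..b}|lborel. f x)"
    using loc_int_set[OF f, of a b] by (auto simp: set_integrable_def set_lebesgue_integral_def * )
qed

lemma integrable_mult_test:
  assumes "loc_int f" "\<phi> \<in> test_fun"
  shows "integrable lborel (\<lambda>x. f x * \<phi> x)"
proof -
  obtain R where R: "\<And>x. \<phi> x \<noteq> 0 \<Longrightarrow> \<bar>x\<bar> < R" using test_fun_bounds[OF assms(2)] by blast
  have "loc_int (\<lambda>x. \<phi> x * f x)"
    by (rule loc_int_mult_continuous[OF assms(1) smooth_continuous[OF test_fun_smooth[OF assms(2)]]])
  then have "integrable lborel (\<lambda>x. \<phi> x * f x)"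
    by (rule integrable_supported[of _ "-R" R]) (use R in force)
  then show ?thesis by (simp add: mult.commute)
qed

lemma ac_integral_zero:
  assumes F: "ac F f" and supp: "\<And>x. F x \<noteq> 0 \<Longrightarrow> \<bar>x\<bar> < R" "\<And>x. f x \<noteq> 0 \<Longrightarrow> \<bar>x\<bar> \<le> R"
  shows "integral\<^sup>L lborel f = 0"
proof -
  \<comment> \<open>For negative \<open>R\<close> both functions vanish, and the absolute value
    still keeps the interval in order. The strict bound on the support of \<open>F\<close> makes
    \<open>F\<close> vanish at both endpoints.\<close>
  have "integral\<^sup>L lborel f = (LINT x:{-\<bar>R\<bar>..\<bar>R\<bar>}|lborel. f x)"
    by (rule integrable_supported(2)[OF ac_loc_int[OF F]]) (use supp(2) in force)
  also have "\<dots> = F \<bar>R\<bar> - F (-\<bar>R\<bar>)" by (rule ac_LINT[OF F]) simp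
  also have "\<dots> = 0" using supp(1)[of "\<bar>R\<bar>"] supp(1)[of "-\<bar>R\<bar>"] by force
  finally show ?thesis .
qed

lemma ac_ibp_test:
  assumes F: "ac F f" and \<phi>: "\<phi> \<in> test_fun"
  shows "(LINT x|lborel. F x * vderiv \<phi> x) = - (LINT x|lborel. f x * \<phi> x)"
proof -
  have s: "smooth \<phi>" using \<phi> by (rule test_fun_smooth)
  obtain R where R: "\<And>x. \<phi> x \<noteq> 0 \<Longrightarrow> \<bar>x\<bar> < R" using test_fun_bounds[OF \<phi>] by blast
  have R': "\<bar>x\<bar> \<le> R" if "vderiv \<phi> x \<noteq> 0" for x
    using vderiv_zero_outside[of \<phi> "-R" R x] that R by force
  have "(LINT x|lborel. F x * vderiv \<phi> x + f x * \<phi> x) = 0"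
    by (rule ac_integral_zero[OF ac_mult[OF F ac_smooth[OF s]], of R]) (use R in fastforce, metis R R' add_0
        less_imp_le mult_zero_right)
  moreover have "integrable lborel (\<lambda>x. F x * vderiv \<phi> x)" "integrable lborel (\<lambda>x. f x * \<phi> x)"
    using integrable_mult_test[OF loc_int_continuous[OF ac_continuous[OF F]] test_fun_vderiv[OF \<phi>]]
      integrable_mult_test[OF ac_loc_int[OF F] \<phi>] by auto
  ultimately show ?thesis by (simp add: eq_neg_iff_add_eq_0)
qed

section \<open>The fundamental lemma of the calculus of variations\<close>

lemma AE_zero_of_interval_integrals:
  fixes g :: "real \<Rightarrow> 'a::{banach, second_countable_topology}"
  assumes g: "integrable lborel g" and 0: "integral\<^sup>L lborel g = 0"
    "\<And>c d. c \<le> d \<Longrightarrow> (LINT x:{c..d}|lborel. g x) = 0"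
  shows "AE x in lborel. g x = 0"
proof (rule sigma_finite_measure.density_zero[OF lborel.sigma_finite_measure_axioms g])
  have si: "set_integrable lborel A g" if "A \<in> sets borel" for A
    unfolding set_integrable_def by (rule integrable_mult_indicator[OF _ g]) (use that in simp)
  fix A assume "A \<in> sets (lborel :: real measure)"
  then have "A \<in> sets borel" by simp
  \<comment> \<open>Borel sets with vanishing integral are closed under complements, because the
    total integral is 0, and under countable disjoint unions; intervals generate the rest.\<close>
  then show "(LINT x:A|lborel. g x) = 0"
  proof (induction rule: borel_set_induct)
    case empty
    show ?case by (simp add: set_lebesgue_integral_def)
  next
    case (interval a b)
    then show ?case using 0 by simp
  next
    case (compl A)
    have "(LINT x:A|lborel. g x) + (LINT x:-A|lborel. g x) = (LINT x:A \<union> -A|lborel. g x)"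
      by (rule set_integral_Un[symmetric]) (use compl si in auto)
    also have "\<dots> = 0" using 0 by (simp add: set_lebesgue_integral_def)
    finally show ?case using compl by simp
  next
    case (union A)
    have "(LINT x:(\<Union>i. A i)|lborel. g x) = (\<Sum>i. LINT x:A i|lborel. g x)"
      by (rule lebesgue_integral_countable_add)
        (use union si in \<open>auto simp: disjoint_family_on_def\<close>)
    then show ?case using union by simp
  qed
qed

text \<open>Steps compressed by the factor \<open>n\<close> rise and fall inside the interval, so
  the supports never leave it and the limit is the indicator of the open interval.\<close>

lemma interval_cutoff_limit:
  fixes c d :: real
  obtains \<phi> :: "nat \<Rightarrow> real \<Rightarrow> real" where "\<And>n. (\<lambda>x. complex_of_real (\<phi> n x)) \<in> test_fun"
    "\<And>n x. 0 \<le> \<phi> n x" "\<And>n x. \<phi> n x \<le> 1" "\<And>n x. \<phi> n x \<noteq> 0 \<Longrightarrow> c < x \<and> x < d"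
    "\<And>x. (\<lambda>n. \<phi> n x) \<longlonglongrightarrow> indicator {c<..<d} x"
proof -
  obtain s :: "real \<Rightarrow> real" where s: "smooth (\<lambda>x. of_real (s x))"
    "\<And>x. x \<le> 0 \<Longrightarrow> s x = 0" "\<And>x. x \<ge> 1 \<Longrightarrow> s x = 1" "\<And>x. 0 \<le> s x" "\<And>x. s x \<le> 1"
    using smooth_step_exists by blast
  define \<phi> where "\<phi> n x = s (real n * (x - c)) * s (real n * (d - x))" for n x
  have supp: "c < x \<and> x < d" if "\<phi> n x \<noteq> 0" for n x
  proof (rule ccontr)
    assume "\<not> (c < x \<and> x < d)"
    then have "real n * (x - c) \<le> 0 \<or> real n * (d - x) \<le> 0"
      by (auto simp: mult_nonneg_nonpos not_less)
    then show False using s(2) that by (auto simp: \<phi>_def)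
  qed
  have "smooth (\<lambda>x. of_real (\<phi> n x))" for n
  proof -
    have "real n * (x - c) = real n * x + - (n * c)" "real n * (d - x) = (- real n) * x + n * d" for x
      by (simp_all add: algebra_simps)
    then show ?thesis
      using smooth_mult[OF smooth_affine[OF s(1), of n "- (n * c)"] smooth_affine[OF s(1), of "- real n"
          "n * d"]]
      by (simp only: \<phi>_def of_real_mult)
  qed
  then have 1: "(\<lambda>x. of_real (\<phi> n x)) \<in> test_fun" for n
    by (rule test_funI[of _ c d]) (use supp in force)
  have 2: "(\<lambda>n. \<phi> n x) \<longlonglongrightarrow> indicator {c<..<d} x" for x
  proof (cases "x \<in> {c<..<d}")
    case True
    then have p: "x - c > 0" "d - x > 0" by auto
    have "\<forall>\<^sub>F n in sequentially. 1 / (x - c) \<le> real n \<and> 1 / (d - x) \<le> real n"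
      using filterlim_real_sequentially by (auto simp: filterlim_at_top eventually_conj_iff)
    then have "\<forall>\<^sub>F n in sequentially. \<phi> n x = 1"
      by eventually_elim (use p s(3) in \<open>auto simp: \<phi>_def field_simps\<close>)
    then show ?thesis using True by (simp add: tendsto_eventually)
  next
    case False
    then have "\<phi> n x = 0" for n using supp by fastforce
    then show ?thesis using False by simp
  qed
  show thesis
    by (rule that[OF 1 _ _ _ 2]) (use s supp in \<open>auto simp: \<phi>_def mult_le_one\<close>)
qed

lemma fundamental_lemma:
  assumes f: "loc_int f"
    and 0: "\<And>\<phi>. \<phi> \<in> test_fun \<Longrightarrow> (\<And>x. \<phi> x \<noteq> 0 \<Longrightarrow> a < x \<and> x < b) \<Longrightarrow> (LINT x|lborel. f x * \<phi> x) = 0"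
  shows "AE x in lborel. x \<in> {a<..<b} \<longrightarrow> f x = 0"
proof -
  define g where "g x = indicator {a<..<b} x *\<^sub>R f x" for x
  have [measurable]: "f \<in> borel_measurable borel" using f by (rule loc_int_measurable)
  have g: "integrable lborel g"
    unfolding g_def[abs_def]
    by (rule Bochner_Integration.integrable_bound[OF loc_int_set[OF f, of a b, unfolded set_integrable_def]])
      (auto simp: indicator_def)
  have main: "(LINT x:{c..d}|lborel. g x) = 0" for c d
  proof (rule LIMSEQ_unique)
    \<comment> \<open>Test functions are admissible only inside \<open>{a<..<b}\<close>, so they
      approximate the indicator of its intersection with \<open>{c<..<d}\<close>.\<close>
    define c' where "c' = max a c" define d' where "d' = min b d"
    obtain \<phi> :: "nat \<Rightarrow> real \<Rightarrow> real" where \<phi>: "\<And>n. (\<lambda>x. complex_of_real (\<phi> n x)) \<in> test_fun"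
      "\<And>n x. 0 \<le> \<phi> n x" "\<And>n x. \<phi> n x \<le> 1" "\<And>n x. \<phi> n x \<noteq> 0 \<Longrightarrow> c' < x \<and> x < d'"
      "\<And>x. (\<lambda>n. \<phi> n x) \<longlonglongrightarrow> indicator {c'<..<d'} x"
      using interval_cutoff_limit by blast
    have [measurable]: "\<phi> n \<in> borel_measurable borel" for n
      using continuous_on_Re[OF smooth_continuous[OF test_fun_smooth[OF \<phi>(1)[of n]], of UNIV]]
      by (auto intro: borel_measurable_continuous_onI)
    have "(\<lambda>n. LINT x|lborel. f x * \<phi> n x) \<longlonglongrightarrow> (LINT x:{c..d}|lborel. g x)"
      unfolding set_lebesgue_integral_def
    proof (rule integral_dominated_convergence)
      show "integrable lborel (\<lambda>x. norm (g x))" using g by (rule integrable_norm)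
      show "AE x in lborel. norm (f x * complex_of_real (\<phi> n x)) \<le> norm (g x)" for n
      proof (rule AE_I2)
        fix x show "norm (f x * complex_of_real (\<phi> n x)) \<le> norm (g x)"
          using \<phi>(2-4)[of n x] by (cases "\<phi> n x = 0")
            (auto simp: g_def norm_mult c'_def d'_def intro: mult_left_le)
      qed
      show "AE x in lborel. (\<lambda>n. f x * complex_of_real (\<phi> n x)) \<longlonglongrightarrow> indicat_real {c..d} x *\<^sub>R g x"
        using AE_lborel_singleton[of c] AE_lborel_singleton[of d]
      proof eventually_elim
        case (elim x)
        have "(\<lambda>n. f x * complex_of_real (\<phi> n x)) \<longlonglongrightarrow> f x * of_real (indicator {c'<..<d'} x)"
          by (intro tendsto_intros \<phi>(5))
        also have "f x * of_real (indicator {c'<..<d'} x) = indicat_real {c..d} x *\<^sub>R g x"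
          using elim by (auto simp: g_def indicator_def c'_def d'_def)
        finally show ?case .
      qed
    qed (use g in auto)
    moreover have "(LINT x|lborel. f x * \<phi> n x) = 0" for n
      by (rule 0[OF \<phi>(1)]) (use \<phi>(4)[of n] in \<open>auto simp: c'_def d'_def\<close>)
    ultimately show "(\<lambda>n. 0) \<longlonglongrightarrow> (LINT x:{c..d}|lborel. g x)" by simp
  qed simp
  have "integral\<^sup>L lborel g = (LINT x:{a..b}|lborel. g x)"
    unfolding set_lebesgue_integral_def
    by (rule Bochner_Integration.integral_cong) (auto simp: g_def indicator_def)
  then have "AE x in lborel. g x = 0"
    by (intro AE_zero_of_interval_integrals[OF g] main) (simp add: main)
  then show ?thesis by eventually_elim (auto simp: g_def)
qed

lemma fundamental_lemma_UNIV:
  assumes f: "loc_int f" and 0: "\<And>\<phi>. \<phi> \<in> test_fun \<Longrightarrow> (LINT x|lborel. f x * \<phi> x) = 0"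
  shows "AE x in lborel. f x = 0"
proof -
  have "AE x in lborel. \<forall>n. x \<in> {- real n<..<real n} \<longrightarrow> f x = 0"
    unfolding AE_all_countable by (intro allI fundamental_lemma[OF f] 0)
  then show ?thesis
  proof eventually_elim
    case (elim x)
    obtain n where "\<bar>x\<bar> < real n" using reals_Archimedean2 by blast
    then show ?case using elim[rule_format, of n] by (auto simp: abs_less_iff)
  qed
qed

lemma unit_mass_test_fun:
  obtains \<eta> where "\<eta> \<in> test_fun" "integral\<^sup>L lborel \<eta> = 1" "\<And>x. \<eta> x \<noteq> 0 \<Longrightarrow> -1 < x \<and> x < (1::real)" "\<And>x. \<eta> x \<in> \<real>"
proof -
  obtain h :: "real \<Rightarrow> real" where h: "(\<lambda>x. of_real (h x)) \<in> test_fun"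
    "\<And>x. -(1/2) \<le> x \<Longrightarrow> x \<le> 1/2 \<Longrightarrow> h x = 1" "\<And>x. h x \<noteq> 0 \<Longrightarrow> - (1/2) - 1/2 < x \<and> x < 1/2 + 1/2"
    "\<And>x. 0 \<le> h x" "\<And>x. h x \<le> 1"
    using cutoff_exists[of "1/2" "-(1/2)" "1/2"] by auto
  define I where "I = integral\<^sup>L lborel h"
  have hi: "integrable lborel h" using test_fun_integrable[OF h(1)]
      by (simp add: complex_of_real_integrable_eq)
  have "(LINT x|lborel. indicator {-(1/2)..1/2::real} x) \<le> I"
    unfolding I_def
  proof (rule integral_mono[OF _ hi])
    show "integrable lborel (indicat_real {-(1/2)..1/2::real})" by simp
    show "indicator {-(1/2)..1/2} x \<le> h x" for x using h(2,4)[of x] by (auto simp: indicator_def)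
  qed
  then have I: "I > 0" by simp
  have Ic: "(LINT x|lborel. complex_of_real (h x)) = of_real I" by (simp add: I_def)
  show thesis
  proof (rule that[of "\<lambda>x. inverse (of_real I) * of_real (h x)"])
    show "(\<lambda>x. inverse (complex_of_real I) * of_real (h x)) \<in> test_fun" by (rule test_fun_cmult[OF h(1)])
    show "(LINT x|lborel. inverse (complex_of_real I) * of_real (h x)) = 1" using I Ic
        by (simp only: integral_mult_right_zero) simp
    show "-1 < x \<and> x < 1" if "inverse (complex_of_real I) * of_real (h x) \<noteq> 0" for x
      using h(3)[of x] that by auto
  qed (auto simp: Reals_mult Reals_inverse)
qed

text \<open>Subtracting \<open>I * \<eta>\<close> from \<open>\<phi>\<close> removes its mean and
  leaves the derivative of a test function, to which the hypothesis applies. The constant is the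
  pairing of \<open>f\<close> with \<open>\<eta>\<close>.\<close>

lemma du_Bois_Reymond:
  assumes f: "loc_int f" and 0: "\<And>\<phi>. \<phi> \<in> test_fun \<Longrightarrow> (LINT x|lborel. f x * vderiv \<phi> x) = 0"
  obtains c where "AE x in lborel. f x = c"
proof -
  obtain \<eta> where \<eta>: "\<eta> \<in> test_fun" "integral\<^sup>L lborel \<eta> = 1"
    by (rule unit_mass_test_fun) (rule that)
  define c where "c = (LINT x|lborel. f x * \<eta> x)"
  have "AE x in lborel. f x - c = 0"
  proof (rule fundamental_lemma_UNIV)
    show "loc_int (\<lambda>x. f x - c)" by (intro loc_int_diff f loc_int_continuous continuous_intros)
    fix \<phi> assume \<phi>: "\<phi> \<in> test_fun"
    define I where "I = integral\<^sup>L lborel \<phi>"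
    have t: "(\<lambda>x. \<phi> x - I * \<eta> x) \<in> test_fun" by (intro test_fun_diff test_fun_cmult \<phi> \<eta>)
    obtain R where R: "\<And>x. \<phi> x - I * \<eta> x \<noteq> 0 \<Longrightarrow> \<bar>x\<bar> < R" using test_fun_bounds[OF t] by blast
    have "(LINT x|lborel. \<phi> x - I * \<eta> x) = 0"
      using test_fun_integrable[OF \<phi>] test_fun_integrable[OF \<eta>(1)] \<eta>(2) by (simp add: I_def)
    then obtain \<psi> where "\<psi> \<in> test_fun" "vderiv \<psi> = (\<lambda>x. \<phi> x - I * \<eta> x)"
      by (rule test_fun_primitive[OF t _, of "-R" R]) (use R in force)
    then have "(LINT x|lborel. f x * (\<phi> x - I * \<eta> x)) = 0" using 0 by metis
    moreover have "f x * (\<phi> x - I * \<eta> x) = f x * \<phi> x - I * (f x * \<eta> x)" for x by (simp add: algebra_simps)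
    moreover note integrable_mult_test[OF f \<phi>] integrable_mult_test[OF f \<eta>(1)] test_fun_integrable[OF \<phi>]
    ultimately have "(LINT x|lborel. f x * \<phi> x) = I * c" by (simp add: c_def)
    then show "(LINT x|lborel. (f x - c) * \<phi> x) = 0"
      using integrable_mult_test[OF f \<phi>] test_fun_integrable[OF \<phi>]
      by (simp add: left_diff_distrib I_def)
  qed
  then show thesis using that[of c] by simp
qed

text \<open>The converse of \<open>ac_ibp_test\<close>: \<open>f\<close> minus a primitive of
  \<open>g\<close> has weak derivative zero and hence is constant almost everywhere.\<close>

lemma weak_derivative_ac:
  assumes f: "loc_int f" and g: "loc_int g"
    and eq: "\<And>\<phi>. \<phi> \<in> test_fun \<Longrightarrow> (LINT x|lborel. f x * vderiv \<phi> x) = - (LINT x|lborel. g x * \<phi> x)"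
  obtains F where "ac F g" "AE x in lborel. f x = F x"
proof -
  obtain G where G: "ac G g" using ac_exists[OF g] by blast
  have lG: "loc_int G" by (rule loc_int_continuous[OF ac_continuous[OF G]])
  obtain c where c: "AE x in lborel. f x - G x = c"
  proof (rule du_Bois_Reymond[of "\<lambda>x. f x - G x"])
    show "loc_int (\<lambda>x. f x - G x)" by (rule loc_int_diff[OF f lG])
    fix \<phi> assume \<phi>: "\<phi> \<in> test_fun"
    show "(LINT x|lborel. (f x - G x) * vderiv \<phi> x) = 0"
      using eq[OF \<phi>] ac_ibp_test[OF G \<phi>] integrable_mult_test[OF f test_fun_vderiv[OF \<phi>]]
        integrable_mult_test[OF lG test_fun_vderiv[OF \<phi>]]
      by (simp add: left_diff_distrib)
  qed blast
  show thesis
  proof (rule that)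
    show "ac (\<lambda>x. G x + c) g" using ac_add[OF G ac_const[of c]] by simp
    show "AE x in lborel. f x = G x + c" using c by eventually_elim (simp add: algebra_simps)
  qed
qed

section \<open>Square integrable functions and Riesz representation\<close>

definition sq_int :: "(real \<Rightarrow> 'a::{real_normed_vector, second_countable_topology}) \<Rightarrow> bool" where
  "sq_int f \<longleftrightarrow> f \<in> borel_measurable borel \<and> integrable lborel (\<lambda>x. (norm (f x))\<^sup>2)"

text \<open>The squared norm, without the root, so that quadratic expansions stay polynomial. It is
  meaningful only next to \<open>sq_int\<close>, since the integral of a nonintegrable function is
  0.\<close>

definition L2_sq :: "(real \<Rightarrow> 'a::real_normed_vector) \<Rightarrow> real" where
  "L2_sq f = (LINT x|lborel. (norm (f x))\<^sup>2)"

lemma sq_int_measurable: "sq_int f \<Longrightarrow> f \<in> borel_measurable borel"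
  by (simp add: sq_int_def)

lemma sq_int_integrable: "sq_int f \<Longrightarrow> integrable lborel (\<lambda>x. (norm (f x))\<^sup>2)"
  by (simp add: sq_int_def)

lemma L2_sq_nonneg: "0 \<le> L2_sq f"
  unfolding L2_sq_def by (rule integral_nonneg_AE) simp

lemma sq_int_bound:
  assumes "sq_int f" "g \<in> borel_measurable borel" "\<And>x. norm (g x) \<le> norm (f x)"
  shows "sq_int g"
  unfolding sq_int_def
proof
  show "integrable lborel (\<lambda>x. (norm (g x))\<^sup>2)"
    by (rule Bochner_Integration.integrable_bound[OF sq_int_integrable[OF assms(1)]])
      (use assms in \<open>auto intro: power_mono\<close>)
qed (rule assms)

lemma sq_int_norm_mult:
  assumes "sq_int f" "sq_int g"
  shows "integrable lborel (\<lambda>x. norm (f x) * norm (g x))"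
proof (rule Bochner_Integration.integrable_bound)
  show "integrable lborel (\<lambda>x. (norm (f x))\<^sup>2 + (norm (g x))\<^sup>2)"
    using assms by (intro Bochner_Integration.integrable_add sq_int_integrable)
  show "(\<lambda>x. norm (f x) * norm (g x)) \<in> borel_measurable lborel"
    using assms[THEN sq_int_measurable] by simp
  show "AE x in lborel. norm (norm (f x) * norm (g x)) \<le> norm ((norm (f x))\<^sup>2 + (norm (g x))\<^sup>2)"
    using norm_mult_le_squares by (intro AE_I2) simp
qed

lemma Cauchy_Schwarz_L2:
  assumes f: "sq_int f" and g: "sq_int g"
  shows "(LINT x|lborel. norm (f x) * norm (g x)) \<le> sqrt (L2_sq f) * sqrt (L2_sq g)"
proof -
  define a b c where "a = L2_sq f" and "b = L2_sq g" and "c = (LINT x|lborel. norm (f x) * norm (g x))"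
  have c0: "c \<ge> 0" unfolding c_def by (rule integral_nonneg_AE) simp
  have a0: "a \<ge> 0" "b \<ge> 0" by (auto simp: a_def b_def L2_sq_nonneg)
  have q: "0 \<le> a - 2 * t * c + t\<^sup>2 * b" for t
  proof -
    have "0 \<le> (LINT x|lborel. (norm (f x) - t * norm (g x))\<^sup>2)" by (rule integral_nonneg_AE) simp
    also have "\<dots> = (LINT x|lborel. (norm (f x))\<^sup>2 - 2 * t * (norm (f x) * norm (g x)) + t\<^sup>2 * (norm (g x))\<^sup>2)"
      by (simp add: power2_diff power_mult_distrib algebra_simps)
    also have "\<dots> = a - 2 * t * c + t\<^sup>2 * b"
      using sq_int_norm_mult[OF f g] sq_int_integrable[OF f] sq_int_integrable[OF g]
      by (simp add: a_def b_def c_def L2_sq_def)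
    finally show ?thesis .
  qed
  have "c\<^sup>2 \<le> a * b"
  proof (cases "b = 0")
    case True
    show ?thesis
    proof (rule ccontr)
      assume "\<not> c\<^sup>2 \<le> a * b"
      then have "c > 0" using c0 True by (cases "c = 0") auto
      \<comment> \<open>For \<open>b = 0\<close> the quadratic is linear in \<open>t\<close>, and
        this \<open>t\<close> gives it the value \<open>-1\<close>.\<close>
      then show False using q[of "(a + 1) / (2 * c)"] True a0 by simp
    qed
  next
    case False
    then have "b > 0" using a0 by simp
    \<comment> \<open>The value of \<open>t\<close> that minimises the quadratic.\<close>
    then show ?thesis using q[of "c / b"] by (simp add: power2_eq_square field_simps)
  qed
  then have "sqrt (c\<^sup>2) \<le> sqrt (a * b)" by (rule real_sqrt_le_mono)
  then show ?thesis using c0 by (simp add: real_sqrt_mult a_def b_def c_def)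
qed

lemma sq_int_add:
  assumes "sq_int f" "sq_int g"
  shows "sq_int (\<lambda>x. f x + g x)"
    and "L2_sq (\<lambda>x. f x + g x) \<le> 2 * L2_sq f + 2 * L2_sq g"
proof -
  note * = norm_add_squared_le[of "f _" "g _"]
  have i: "integrable lborel (\<lambda>x. 2 * (norm (f x))\<^sup>2 + 2 * (norm (g x))\<^sup>2)"
    using assms by (intro Bochner_Integration.integrable_add integrable_mult_right sq_int_integrable)
  have m: "(\<lambda>x. f x + g x) \<in> borel_measurable borel"
    using assms[THEN sq_int_measurable] by simp
  have j: "integrable lborel (\<lambda>x. (norm (f x + g x))\<^sup>2)"
    by (rule Bochner_Integration.integrable_bound[OF i]) (use m * in auto)
  then show "sq_int (\<lambda>x. f x + g x)" using m by (simp add: sq_int_def)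
  have "L2_sq (\<lambda>x. f x + g x) \<le> (LINT x|lborel. 2 * (norm (f x))\<^sup>2 + 2 * (norm (g x))\<^sup>2)"
    unfolding L2_sq_def by (rule integral_mono[OF j i *])
  also have "\<dots> = 2 * L2_sq f + 2 * L2_sq g"
    using assms[THEN sq_int_integrable] by (simp add: L2_sq_def)
  finally show "L2_sq (\<lambda>x. f x + g x) \<le> 2 * L2_sq f + 2 * L2_sq g" .
qed

lemma sq_int_scaleR: "sq_int f \<Longrightarrow> sq_int (\<lambda>x. c *\<^sub>R f x)"
  by (auto simp: sq_int_def power_mult_distrib)

lemma sq_int_diff: "sq_int f \<Longrightarrow> sq_int g \<Longrightarrow> sq_int (\<lambda>x. f x - g x)"
  using sq_int_add(1)[of f "\<lambda>x. (-1) *\<^sub>R g x"] sq_int_scaleR[of g "-1"] by simp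

text \<open>A general \<open>P\<close> serves both the real inner product, in which the quadratic
  form is written, and the complex product, by which distributions are paired with test
  functions.\<close>

lemma sq_int_bilinear:
  fixes P :: "'a::{real_normed_vector, second_countable_topology} \<Rightarrow> 'b::{real_normed_vector,
      second_countable_topology} \<Rightarrow> 'c::{banach, second_countable_topology}"
  assumes P: "bounded_bilinear P" "\<And>x y. norm (P x y) \<le> norm x * norm y"
    and f: "sq_int f" and g: "sq_int g"
  shows "integrable lborel (\<lambda>x. P (f x) (g x))"
    and "norm (LINT x|lborel. P (f x) (g x)) \<le> sqrt (L2_sq f) * sqrt (L2_sq g)"
proof -
  have "continuous_on UNIV (\<lambda>x. P (fst x) (snd x))"
    by (intro bounded_bilinear.continuous_on[OF P(1)] continuous_intros)
  from borel_measurable_continuous_Pair[OF sq_int_measurable[OF f] sq_int_measurable[OF g] this]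
  have m: "(\<lambda>x. P (f x) (g x)) \<in> borel_measurable borel" .
  show i: "integrable lborel (\<lambda>x. P (f x) (g x))"
    by (rule Bochner_Integration.integrable_bound[OF sq_int_norm_mult[OF f g]]) (use m P in auto)
  have "norm (LINT x|lborel. P (f x) (g x)) \<le> (LINT x|lborel. norm (P (f x) (g x)))"
    by (rule integral_norm_bound)
  also have "\<dots> \<le> (LINT x|lborel. norm (f x) * norm (g x))"
    by (rule integral_mono[OF integrable_norm[OF i] sq_int_norm_mult[OF f g] P(2)])
  also have "\<dots> \<le> sqrt (L2_sq f) * sqrt (L2_sq g)" by (rule Cauchy_Schwarz_L2[OF f g])
  finally show "norm (LINT x|lborel. P (f x) (g x)) \<le> sqrt (L2_sq f) * sqrt (L2_sq g)" .
qed

lemma tendsto_L2_bilinear: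
  fixes P :: "'a::{real_normed_vector, second_countable_topology} \<Rightarrow> 'b::{real_normed_vector,
      second_countable_topology} \<Rightarrow> 'c::{banach, second_countable_topology}"
  assumes P: "bounded_bilinear P" "\<And>x y. norm (P x y) \<le> norm x * norm y"
    and f: "sq_int f" "\<And>n. sq_int (F n)" "(\<lambda>n. L2_sq (\<lambda>x. F n x - f x)) \<longlonglongrightarrow> 0"
    and g: "sq_int g" "\<And>n. sq_int (G n)" "(\<lambda>n. L2_sq (\<lambda>x. G n x - g x)) \<longlonglongrightarrow> 0"
  shows "(\<lambda>n. LINT x|lborel. P (F n x) (G n x)) \<longlonglongrightarrow> (LINT x|lborel. P (f x) (g x))"
proof -
  interpret bounded_bilinear P by (rule P)
  note bil = sq_int_bilinear[OF P]
  let ?d = "\<lambda>n. sqrt (L2_sq (\<lambda>x. F n x - f x))" and ?e = "\<lambda>n. sqrt (L2_sq (\<lambda>x. G n x - g x))"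
  have d: "?d \<longlonglongrightarrow> 0" "?e \<longlonglongrightarrow> 0" using tendsto_real_sqrt[OF f(3)] tendsto_real_sqrt[OF g(3)] by auto
  have "(\<lambda>n. (LINT x|lborel. P (F n x) (G n x)) - (LINT x|lborel. P (f x) (g x))) \<longlonglongrightarrow> 0"
  proof (rule Lim_null_comparison)
    have "(\<lambda>n. ?d n * sqrt (L2_sq g) + sqrt (L2_sq f) * ?e n + ?d n * ?e n)
        \<longlonglongrightarrow> 0 * sqrt (L2_sq g) + sqrt (L2_sq f) * 0 + 0 * 0"
      by (intro tendsto_intros d)
    then show "(\<lambda>n. ?d n * sqrt (L2_sq g) + sqrt (L2_sq f) * ?e n + ?d n * ?e n) \<longlonglongrightarrow> 0" by simp
    show "\<forall>\<^sub>F n in sequentially. norm ((LINT x|lborel. P (F n x) (G n x)) - (LINT x|lborel. P (f x) (g x)))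
        \<le> ?d n * sqrt (L2_sq g) + sqrt (L2_sq f) * ?e n + ?d n * ?e n"
    proof (rule always_eventually, rule allI)
      fix n
      have sd: "sq_int (\<lambda>x. F n x - f x)" "sq_int (\<lambda>x. G n x - g x)" by (intro sq_int_diff f g)+
      have "(LINT x|lborel. P (F n x) (G n x)) - (LINT x|lborel. P (f x) (g x))
          = (LINT x|lborel. P (F n x) (G n x) - P (f x) (g x))"
        using bil(1)[OF f(2) g(2)] bil(1)[OF f(1) g(1)] by simp
      also have "\<dots> = (LINT x|lborel. P (F n x - f x) (g x) + P (f x) (G n x - g x)
          + P (F n x - f x) (G n x - g x))"
        by (simp add: diff_left diff_right)
      also have "\<dots> = (LINT x|lborel. P (F n x - f x) (g x)) + (LINT x|lborel. P (f x) (G n x - g x))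
          + (LINT x|lborel. P (F n x - f x) (G n x - g x))"
        using bil(1)[OF sd(1) g(1)] bil(1)[OF f(1) sd(2)] bil(1)[OF sd] by simp
      also have "norm \<dots> \<le> ?d n * sqrt (L2_sq g) + sqrt (L2_sq f) * ?e n + ?d n * ?e n"
        by (intro norm_triangle_le add_mono bil(2) sd f g order_trans[OF norm_triangle_ineq])
      finally show "norm ((LINT x|lborel. P (F n x) (G n x)) - (LINT x|lborel. P (f x) (g x)))
        \<le> ?d n * sqrt (L2_sq g) + sqrt (L2_sq f) * ?e n + ?d n * ?e n" .
    qed
  qed
  then show ?thesis by (rule LIM_zero_cancel)
qed

lemma norm_inner_le: "norm (inner x y) \<le> norm x * norm y"
  using Cauchy_Schwarz_ineq2[of x y] by simp

lemmas sq_int_inner = sq_int_bilinear[OF bounded_bilinear_inner norm_inner_le]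
  and sq_int_mult = sq_int_bilinear[OF bounded_bilinear_mult norm_mult_ineq]
  and tendsto_L2_inner = tendsto_L2_bilinear[OF bounded_bilinear_inner norm_inner_le]
  and tendsto_L2_mult = tendsto_L2_bilinear[OF bounded_bilinear_mult norm_mult_ineq]

text \<open>The common bounded interval turns Cauchy in mean square into Cauchy in mean, which
  supplies an almost everywhere Cauchy subsequence; Fatou's lemma along that subsequence leads back
  to the square norm.\<close>

lemma L2_complete:
  fixes F :: "nat \<Rightarrow> real \<Rightarrow> 'a::{real_normed_field, banach, second_countable_topology}"
  assumes F: "\<And>n. sq_int (F n)" and supp: "\<And>n x. F n x \<noteq> 0 \<Longrightarrow> a < x \<and> x < b"
    and Cauchy: "\<And>e. e > 0 \<Longrightarrow> \<exists>N. \<forall>i\<ge>N. \<forall>j\<ge>N. L2_sq (\<lambda>x. F i x - F j x) < e"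
  obtains f where "sq_int f" "\<And>x. f x \<noteq> 0 \<Longrightarrow> a < x \<and> x < b" "(\<lambda>n. L2_sq (\<lambda>x. F n x - f x)) \<longlonglongrightarrow> 0"
proof -
  have [measurable]: "F n \<in> borel_measurable borel" for n by (rule sq_int_measurable[OF F])
  define I :: "real \<Rightarrow> real" where "I x = indicator {a..b} x" for x
  have I: "sq_int I" 
  proof -
    have "(norm (I x))\<^sup>2 = I x" for x by (simp add: I_def indicator_def)
    moreover have "integrable lborel I"
      using borel_integrable_atLeastAtMost'[of a b "\<lambda>_. 1 :: real"]
          by (simp add: set_integrable_def I_def[abs_def])
    moreover have "I \<in> borel_measurable borel" by (simp add: I_def[abs_def])
    ultimately show ?thesis by (simp add: sq_int_def)
  qed
  have FI: "norm (g x) * norm (I x) = norm (g x)" if "g x \<noteq> 0 \<Longrightarrow> a < x \<and> x < b" for g :: "real \<Rightarrow> 'a" and x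
    using that by (cases "g x = 0") (auto simp: I_def indicator_def)
  have Fi: "integrable lborel (F n)" for n
  proof -
    have "integrable lborel (\<lambda>x. norm (F n x))"
      using sq_int_norm_mult[OF F I, of n] by (simp only: FI[OF supp])
    then show ?thesis by (subst (asm) integrable_norm_iff) auto
  qed
  have L1: "(LINT x|lborel. norm (F i x - F j x)) \<le> sqrt (L2_sq (\<lambda>x. F i x - F j x)) * sqrt (L2_sq I)" for i j
  proof -
    have "norm (F i x - F j x) * norm (I x) = norm (F i x - F j x)" for x
      by (rule FI[of "\<lambda>x. F i x - F j x"]) (use supp[of i x] supp[of j x] in force)
    then show ?thesis using Cauchy_Schwarz_L2[OF sq_int_diff[OF F F] I, of i j] by (simp only:)
  qed
  obtain r where r: "strict_mono r" "AE x in lborel. Cauchy (\<lambda>i. F (r i) x)"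
  proof (rule cauchy_L1_AE_cauchy_subseq[OF Fi])
    fix e :: real assume e: "e > 0"
    \<comment> \<open>Chosen so that \<open>sqrt e'\<close> times the norm of \<open>I\<close> stays
      below \<open>e\<close>; the added 1 excludes a zero denominator.\<close>
    define e' where "e' = (e / (sqrt (L2_sq I) + 1))\<^sup>2"
    have pos: "sqrt (L2_sq I) + 1 > 0" using L2_sq_nonneg[of I] by (simp add: add_nonneg_pos)
    then have "e' > 0" using e by (simp add: e'_def)
    from Cauchy[OF this] obtain N where N: "\<forall>i\<ge>N. \<forall>j\<ge>N. L2_sq (\<lambda>x. F i x - F j x) < e'" by blast
    have "(LINT x|lborel. norm (F i x - F j x)) < e" if "i \<ge> N" "j \<ge> N" for i j
    proof -
      have "sqrt (L2_sq (\<lambda>x. F i x - F j x)) < sqrt e'" using N that by simp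
      also have "sqrt e' = e / (sqrt (L2_sq I) + 1)" using e pos by (simp add: e'_def real_sqrt_abs)
      finally have "sqrt (L2_sq (\<lambda>x. F i x - F j x)) * (sqrt (L2_sq I) + 1) < e" using pos
          by (simp add: field_simps)
      moreover have "sqrt (L2_sq (\<lambda>x. F i x - F j x)) * sqrt (L2_sq I)
          \<le> sqrt (L2_sq (\<lambda>x. F i x - F j x)) * (sqrt (L2_sq I) + 1)"
        by (intro mult_left_mono) (auto simp: L2_sq_nonneg)
      ultimately show ?thesis using L1[of i j] by linarith
    qed
    then show "\<exists>N. \<forall>i\<ge>N. \<forall>j\<ge>N. (LINT x|lborel. norm (F i x - F j x)) < e" by blast
  qed blast
  define f where "f x = lim (\<lambda>i. F (r i) x)" for x
  have [measurable]: "f \<in> borel_measurable borel" unfolding f_def[abs_def] by measurable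
  have lim: "AE x in lborel. (\<lambda>i. F (r i) x) \<longlonglongrightarrow> f x"
    using r(2) by eventually_elim (simp add: f_def Cauchy_convergent_iff convergent_LIMSEQ_iff)
  \<comment> \<open>Outside the interval the sequence is constantly 0, and so is its
    \<open>lim\<close>; the support is thus controlled at every point and not just almost
    everywhere.\<close>
  have f0: "a < x \<and> x < b" if "f x \<noteq> 0" for x
  proof (rule ccontr)
    assume "\<not> (a < x \<and> x < b)"
    then have "F n x = 0" for n using supp by blast
    then show False using that by (simp add: f_def)
  qed
  have fatou: "(\<integral>\<^sup>+x. (norm (F j x - f x))\<^sup>2 \<partial>lborel) \<le> ennreal e"
    if "\<forall>i\<ge>N. \<forall>j\<ge>N. L2_sq (\<lambda>x. F i x - F j x) < e" "j \<ge> N" for e N j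
  proof -
    have "(\<integral>\<^sup>+x. (norm (F j x - f x))\<^sup>2 \<partial>lborel)
        = (\<integral>\<^sup>+x. liminf (\<lambda>i. ennreal ((norm (F j x - F (r i) x))\<^sup>2)) \<partial>lborel)"
    proof (rule nn_integral_cong_AE)
      show "AE x in lborel. ennreal ((norm (F j x - f x))\<^sup>2)
          = liminf (\<lambda>i. ennreal ((norm (F j x - F (r i) x))\<^sup>2))"
        using lim
      proof eventually_elim
        case (elim x)
        have "(\<lambda>i. ennreal ((norm (F j x - F (r i) x))\<^sup>2)) \<longlonglongrightarrow> ennreal ((norm (F j x - f x))\<^sup>2)"
          by (intro tendsto_ennrealI tendsto_intros elim)
        then show ?case by (intro lim_imp_Liminf[symmetric]) auto
      qed
    qed
    also have "\<dots> \<le> liminf (\<lambda>i. \<integral>\<^sup>+x. ennreal ((norm (F j x - F (r i) x))\<^sup>2) \<partial>lborel)"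
      by (rule nn_integral_liminf) measurable
    also have "\<dots> \<le> ennreal e"
    proof (rule Liminf_le)
      show "\<forall>\<^sub>F i in sequentially. (\<integral>\<^sup>+x. ennreal ((norm (F j x - F (r i) x))\<^sup>2) \<partial>lborel) \<le> ennreal e"
      proof (rule eventually_sequentiallyI)
        fix i assume "i \<ge> N"
        then have "r i \<ge> N" using r(1) seq_suble order_trans by blast
        then have "L2_sq (\<lambda>x. F j x - F (r i) x) \<le> e" using that by (simp add: less_imp_le)
        moreover have "(\<integral>\<^sup>+x. ennreal ((norm (F j x - F (r i) x))\<^sup>2) \<partial>lborel)
            = ennreal (L2_sq (\<lambda>x. F j x - F (r i) x))"
          unfolding L2_sq_def
          by (rule nn_integral_eq_integral[OF sq_int_integrable[OF sq_int_diff[OF F F]]]) simp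
        ultimately show "(\<integral>\<^sup>+x. ennreal ((norm (F j x - F (r i) x))\<^sup>2) \<partial>lborel) \<le> ennreal e"
          by (simp add: ennreal_leI)
      qed
    qed simp
    finally show ?thesis .
  qed
  have fin: "integrable lborel (\<lambda>x. (norm (F j x - f x))\<^sup>2)"
    if "\<forall>i\<ge>N. \<forall>j\<ge>N. L2_sq (\<lambda>x. F i x - F j x) < e" "j \<ge> N" for e N j
    using le_less_trans[OF fatou[OF that] ennreal_less_top] by (intro integrableI_bounded) auto
  have small: "L2_sq (\<lambda>x. F j x - f x) \<le> e"
    if "\<forall>i\<ge>N. \<forall>j\<ge>N. L2_sq (\<lambda>x. F i x - F j x) < e" "j \<ge> N" "e > 0" for e N j
    using fatou[OF that(1,2)] nn_integral_eq_integral[OF fin[OF that(1,2)]] that(3)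
    by (simp add: L2_sq_def ennreal_le_iff)
  obtain N1 where N1: "\<forall>i\<ge>N1. \<forall>j\<ge>N1. L2_sq (\<lambda>x. F i x - F j x) < 1" using Cauchy[of 1] by auto
  have "sq_int (\<lambda>x. F N1 x - f x)" using fin[OF N1] by (simp add: sq_int_def)
  from sq_int_diff[OF F[of N1] this] have sf: "sq_int f" by simp
  have "(\<lambda>n. L2_sq (\<lambda>x. F n x - f x)) \<longlonglongrightarrow> 0"
  proof (rule LIMSEQ_I)
    fix e :: real assume "e > 0"
    then have e2: "e / 2 > 0" by simp
    from Cauchy[OF this] obtain N where N: "\<forall>i\<ge>N. \<forall>j\<ge>N. L2_sq (\<lambda>x. F i x - F j x) < e / 2" by blast
    have "L2_sq (\<lambda>x. F n x - f x) \<le> e / 2" if "n \<ge> N" for n by (rule small[OF N that e2])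
    then show "\<exists>N. \<forall>n\<ge>N. norm (L2_sq (\<lambda>x. F n x - f x) - 0) < e"
      using \<open>e > 0\<close> by (intro exI[of _ N]) (fastforce simp: L2_sq_nonneg)
  qed
  with sf f0 show thesis by (rule that)
qed

text \<open>Near \<open>t = 0\<close> a nonzero linear term dominates and takes both signs. This is
  the first-variation argument, for minimisers in the Riesz lemma and for null vectors of the
  nonnegative form.\<close>

lemma nonneg_linear_quadratic:
  fixes B E :: real
  assumes "\<And>t. 0 \<le> 2 * t * B + t\<^sup>2 * E"
  shows "B = 0"
proof (rule ccontr)
  assume B: "B \<noteq> 0"
  \<comment> \<open>At \<open>t = - s * B\<close> the linear part is \<open>- 2 s B^2\<close>, while
    the quadratic part is less than \<open>s B^2\<close>.\<close>
  define s where "s = 1 / (\<bar>E\<bar> + 1)"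
  have s: "s > 0" "s * \<bar>E\<bar> < 1" by (auto simp: s_def field_simps)
  have "2 * (- s * B) * B + (- s * B)\<^sup>2 * E = s * B\<^sup>2 * (s * E - 2)"
      by (simp add: power2_eq_square algebra_simps)
  also have "\<dots> < 0"
  proof (rule mult_pos_neg)
    have "s * E \<le> s * \<bar>E\<bar>" using s(1) by (intro mult_left_mono) auto
    then show "s * E - 2 < 0" using s(2) by linarith
  qed (use s B in simp)
  finally show False using assms[of "- s * B"] by simp
qed

lemma test_fun_sq_int:
  assumes "\<phi> \<in> test_fun"
  shows "sq_int \<phi>"
  unfolding sq_int_def
proof
  show "\<phi> \<in> borel_measurable borel"
    by (intro borel_measurable_continuous_onI smooth_continuous test_fun_smooth assms)
  show "integrable lborel (\<lambda>x. (norm (\<phi> x))\<^sup>2)"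
    using test_fun_integrable[OF test_fun_norm_square[OF assms]]
    by (simp only: complex_of_real_integrable_eq)
qed

section \<open>Riesz representation on intervals and on the line\<close>

definition test_on :: "real \<Rightarrow> real \<Rightarrow> (real \<Rightarrow> complex) set" where
  "test_on a b = {\<phi> \<in> test_fun. \<forall>x. \<phi> x \<noteq> 0 \<longrightarrow> a < x \<and> x < b}"

lemma test_on_test_fun: "\<phi> \<in> test_on a b \<Longrightarrow> \<phi> \<in> test_fun"
  by (simp add: test_on_def)

lemma test_on_add: "\<phi> \<in> test_on a b \<Longrightarrow> \<psi> \<in> test_on a b \<Longrightarrow> (\<lambda>x. \<phi> x + \<psi> x) \<in> test_on a b"
  by (auto simp: test_on_def intro: test_fun_add) (metis add_0)+

lemma test_on_cmult: "\<phi> \<in> test_on a b \<Longrightarrow> (\<lambda>x. c * \<phi> x) \<in> test_on a b"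
  by (auto simp: test_on_def intro: test_fun_cmult)

lemma L2_sq_complex_add:
  fixes f g :: "real \<Rightarrow> complex"
  assumes "sq_int f" "sq_int g"
  shows "L2_sq (\<lambda>x. f x + of_real t * g x) = L2_sq f + 2 * t * (LINT x|lborel. f x \<bullet> g x) + t\<^sup>2 * L2_sq g"
proof -
  have "(norm (f x + of_real t * g x))\<^sup>2 = (norm (f x))\<^sup>2 + 2 * t * (f x \<bullet> g x) + t\<^sup>2 * (norm (g x))\<^sup>2" for x
    by (simp only: power2_norm_eq_inner) (simp add: scaleR_conv_of_real[symmetric] inner_add inner_commute
        power2_eq_square)
  then show ?thesis
    using assms[THEN sq_int_integrable] sq_int_inner(1)[OF assms] by (simp add: L2_sq_def)
qed

lemma sq_int_cnj:
  assumes "sq_int f"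
  shows "sq_int (\<lambda>x. cnj (f x))"
proof (rule sq_int_bound[OF assms])
  have "cnj \<in> borel_measurable borel" by (intro borel_measurable_continuous_onI continuous_intros)
  then show "(\<lambda>x. cnj (f x)) \<in> borel_measurable borel"
    by (rule measurable_compose[OF sq_int_measurable[OF assms]])
qed simp

text \<open>The representing function is the limit of a minimising sequence of \<open>L2_sq \<phi> - 2 * Re (T \<phi>)\<close>, which
  is Cauchy by the parallelogram identity. Only completeness of \<open>L\<^sup>2\<close> enters, so that density of the test
  functions can be deduced by applying the lemma to the functional induced by an \<open>L\<^sup>2\<close> function.\<close>

lemma Riesz_test_on:
  assumes add: "\<And>\<phi> \<psi>. \<phi> \<in> test_on a b \<Longrightarrow> \<psi> \<in> test_on a b \<Longrightarrow> T (\<lambda>x. \<phi> x + \<psi> x) = T \<phi> + T \<psi>"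
    and scale: "\<And>c \<phi>. \<phi> \<in> test_on a b \<Longrightarrow> T (\<lambda>x. c * \<phi> x) = c * T \<phi>"
    and bound: "\<And>\<phi>. \<phi> \<in> test_on a b \<Longrightarrow> norm (T \<phi>) \<le> C * sqrt (L2_sq \<phi>)"
  obtains f \<phi> where "sq_int f" "\<And>x. f x \<noteq> 0 \<Longrightarrow> a < x \<and> x < b"
    "\<And>n. \<phi> n \<in> test_on a b" "(\<lambda>n. L2_sq (\<lambda>x. \<phi> n x - f x)) \<longlonglongrightarrow> 0"
    "\<And>\<psi>. \<psi> \<in> test_on a b \<Longrightarrow> T \<psi> = (LINT x|lborel. cnj (f x) * \<psi> x)"
proof -
  let ?V = "test_on a b"
  have sq: "sq_int \<phi>" if "\<phi> \<in> ?V" for \<phi> using that by (intro test_fun_sq_int test_on_test_fun)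
  define J where "J \<phi> = L2_sq \<phi> - 2 * Re (T \<phi>)" for \<phi>
  have J_add: "J (\<lambda>x. \<phi> x + of_real t * \<psi> x) = J \<phi> + 2 * t * ((LINT x|lborel. \<phi> x \<bullet> \<psi> x) - Re (T \<psi>))
      + t\<^sup>2 * L2_sq \<psi>"
    if "\<phi> \<in> ?V" "\<psi> \<in> ?V" for \<phi> \<psi> t
    using that by (simp add: J_def L2_sq_complex_add sq add scale test_on_cmult algebra_simps)
  have J_lower: "- C\<^sup>2 \<le> J \<phi>" if "\<phi> \<in> ?V" for \<phi>
  proof -
    have "Re (T \<phi>) \<le> C * sqrt (L2_sq \<phi>)"
      using bound[OF that] complex_Re_le_cmod order_trans by blast
    moreover have "0 \<le> (sqrt (L2_sq \<phi>) - C)\<^sup>2" by simp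
    then have "2 * (C * sqrt (L2_sq \<phi>)) \<le> L2_sq \<phi> + C\<^sup>2"
      using L2_sq_nonneg[of \<phi>] by (simp add: power2_diff mult.commute mult.left_commute)
    ultimately show ?thesis by (simp add: J_def)
  qed
  define m where "m = Inf (J ` ?V)"
  have ne: "J ` ?V \<noteq> {}" using test_fun_zero by (auto simp: test_on_def)
  have bdd: "bdd_below (J ` ?V)" using J_lower by (intro bdd_belowI[of _ "- C\<^sup>2"]) blast
  have m_le: "m \<le> J \<phi>" if "\<phi> \<in> ?V" for \<phi> unfolding m_def using that bdd by (intro cInf_lower) auto
  have "\<exists>\<phi>\<in>?V. J \<phi> < m + 1 / real (Suc n)" for n
    using cInf_lessD[OF ne, of "m + 1 / real (Suc n)"] by (auto simp: m_def)
  then obtain \<phi> where \<phi>: "\<And>n. \<phi> n \<in> ?V" "\<And>n. J (\<phi> n) < m + 1 / real (Suc n)" by metis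
  have close: "L2_sq (\<lambda>x. \<phi> i x - \<phi> j x) \<le> 2 / real (Suc i) + 2 / real (Suc j)" for i j
  proof -
    have d: "(\<lambda>x. \<phi> j x + of_real (-1) * \<phi> i x) \<in> ?V" by (intro test_on_add test_on_cmult \<phi>)
    let ?d = "\<lambda>x. \<phi> j x + of_real (-1) * \<phi> i x"
    \<comment> \<open>Expanding \<open>J\<close> around \<open>\<phi> i\<close> at
      \<open>t = 1/2\<close> and at \<open>t = 1\<close> and eliminating the linear term shows that
      \<open>L2_sq ?d\<close> is twice the excess of \<open>J (\<phi> i) + J (\<phi> j)\<close> over
      twice the value at the midpoint, which is at least \<open>m\<close>.\<close>
    have "J (\<lambda>x. \<phi> i x + of_real (1/2) * ?d x) \<ge> m" by (intro m_le test_on_add test_on_cmult d \<phi>)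
    moreover have "J (\<lambda>x. \<phi> i x + of_real 1 * ?d x) = J (\<phi> j)" by simp
    moreover have "L2_sq (\<lambda>x. \<phi> i x - \<phi> j x) = L2_sq ?d" by (simp add: L2_sq_def norm_minus_commute)
    ultimately show ?thesis
      using J_add[OF \<phi>(1) d, of i "1/2"] J_add[OF \<phi>(1) d, of i 1] \<phi>(2)[of i] \<phi>(2)[of j]
      by (simp add: power2_eq_square del: of_nat_Suc)
  qed
  obtain f where f: "sq_int f" "\<And>x. f x \<noteq> 0 \<Longrightarrow> a < x \<and> x < b" "(\<lambda>n. L2_sq (\<lambda>x. \<phi> n x - f x)) \<longlonglongrightarrow> 0"
  proof (rule L2_complete[of \<phi> a b])
    show "sq_int (\<phi> n)" for n by (rule sq[OF \<phi>(1)])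
    show "a < x \<and> x < b" if "\<phi> n x \<noteq> 0" for n x using \<phi>(1)[of n] that by (auto simp: test_on_def)
    fix e :: real assume "e > 0"
    then obtain N where N: "4 / e < real N" using reals_Archimedean2 by blast
    have le: "2 / real (Suc i) < e / 2" if "i \<ge> N" for i
    proof -
      have "4 / e < real (Suc i)" using N that by simp
      then show ?thesis using \<open>e > 0\<close> by (simp add: field_simps)
    qed
    have "L2_sq (\<lambda>x. \<phi> i x - \<phi> j x) < e" if "i \<ge> N" "j \<ge> N" for i j
      using close[of i j] le[OF that(1)] le[OF that(2)] by linarith
    then show "\<exists>N. \<forall>i\<ge>N. \<forall>j\<ge>N. L2_sq (\<lambda>x. \<phi> i x - \<phi> j x) < e" by blast
  qed blast
  have re: "(LINT x|lborel. f x \<bullet> \<psi> x) = Re (T \<psi>)" if \<psi>: "\<psi> \<in> ?V" for \<psi>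
  proof -
    \<comment> \<open>The limit of minimality: \<open>J\<close> at
      \<open>\<phi> n + t \<psi>\<close> is at least \<open>m\<close>, and
      \<open>J (\<phi> n)\<close> exceeds \<open>m\<close> by less than
      \<open>1 / Suc n\<close>.\<close>
    have "0 \<le> 2 * t * ((LINT x|lborel. f x \<bullet> \<psi> x) - Re (T \<psi>)) + t\<^sup>2 * L2_sq \<psi>" for t
    proof (rule LIMSEQ_le)
      show "(\<lambda>n. - (1 / real (Suc n))) \<longlonglongrightarrow> 0"
        using tendsto_minus[OF LIMSEQ_Suc[OF lim_1_over_n]] by simp
      show "(\<lambda>n. 2 * t * ((LINT x|lborel. \<phi> n x \<bullet> \<psi> x) - Re (T \<psi>)) + t\<^sup>2 * L2_sq \<psi>)
          \<longlonglongrightarrow> 2 * t * ((LINT x|lborel. f x \<bullet> \<psi> x) - Re (T \<psi>)) + t\<^sup>2 * L2_sq \<psi>"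
        by (intro tendsto_intros tendsto_L2_inner f sq \<phi> \<psi>) (simp add: L2_sq_def)
      have "- (1 / real (Suc n)) \<le> 2 * t * ((LINT x|lborel. \<phi> n x \<bullet> \<psi> x) - Re (T \<psi>)) + t\<^sup>2 * L2_sq \<psi>" for n
      proof -
        have "m \<le> J (\<lambda>x. \<phi> n x + of_real t * \<psi> x)" by (intro m_le test_on_add test_on_cmult \<psi> \<phi>)
        then show ?thesis using J_add[OF \<phi>(1) \<psi>, of n t] \<phi>(2)[of n] by (simp del: of_nat_Suc)
      qed
      then show "\<exists>N. \<forall>n\<ge>N. - (1 / real (Suc n))
          \<le> 2 * t * ((LINT x|lborel. \<phi> n x \<bullet> \<psi> x) - Re (T \<psi>)) + t\<^sup>2 * L2_sq \<psi>"
        by blast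
    qed
    then have "(LINT x|lborel. f x \<bullet> \<psi> x) - Re (T \<psi>) = 0" by (rule nonneg_linear_quadratic)
    then show ?thesis by simp
  qed
  have sc: "sq_int (\<lambda>x. cnj (f x))" by (rule sq_int_cnj[OF f(1)])
  have "T \<psi> = (LINT x|lborel. cnj (f x) * \<psi> x)" if \<psi>: "\<psi> \<in> ?V" for \<psi>
  proof -
    have i: "integrable lborel (\<lambda>x. cnj (f x) * \<psi> x)" by (rule sq_int_mult(1)[OF sc sq[OF \<psi>]])
    have "Re (T \<psi>) = Re (LINT x|lborel. cnj (f x) * \<psi> x)"
      using re[OF \<psi>] integral_Re[OF i] by (simp add: inner_complex_def)
    \<comment> \<open>The identity for real parts, applied to \<open>\<i> * \<psi>\<close>.\<close>
    moreover have "- Im (T \<psi>) = - Im (LINT x|lborel. cnj (f x) * \<psi> x)"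
    proof -
      have "f x \<bullet> (\<i> * \<psi> x) = - Im (cnj (f x) * \<psi> x)" for x by (simp add: inner_complex_def)
      then have "(LINT x|lborel. f x \<bullet> (\<i> * \<psi> x)) = - (LINT x|lborel. Im (cnj (f x) * \<psi> x))"
        by (simp only: Bochner_Integration.integral_minus)
      then show ?thesis
        using re[OF test_on_cmult[OF \<psi>, of \<i>]] scale[OF \<psi>, of \<i>] unfolding integral_Im[OF i] by simp
    qed
    ultimately show ?thesis by (simp add: complex_eq_iff)
  qed
  then show thesis using that[of f \<phi>] f \<phi>(1) by blast
qed

lemma sq_int_L2_loc:
  fixes f :: "real \<Rightarrow> 'a::{real_normed_field, euclidean_space}"
  assumes "sq_int f"
  shows "f \<in> L2_loc"
  unfolding L2_loc_iff loc_int_def set_integrable_def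
proof (intro conjI allI)
  show "integrable lborel (\<lambda>x. indicat_real {a..b} x *\<^sub>R (norm (f x))\<^sup>2)" for a b
    by (rule integrable_mult_indicator[OF _ sq_int_integrable[OF assms]]) simp
qed (use sq_int_measurable[OF assms] in auto)

lemma test_fun_dense_L2:
  assumes h: "sq_int h" "\<And>x. h x \<noteq> 0 \<Longrightarrow> a < x \<and> x < b"
  obtains \<phi> where "\<And>n. \<phi> n \<in> test_on a b" "(\<lambda>n. L2_sq (\<lambda>x. \<phi> n x - h x)) \<longlonglongrightarrow> 0"
proof -
  note sc = sq_int_cnj
  have ci: "integrable lborel (\<lambda>x. cnj (f x) * \<psi> x)" if "sq_int f" "\<psi> \<in> test_on a b" for f \<psi>
    by (rule sq_int_mult(1)[OF sc[OF that(1)] test_fun_sq_int[OF test_on_test_fun[OF that(2)]]])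
  obtain f \<phi> where f: "sq_int f" "\<And>x. f x \<noteq> 0 \<Longrightarrow> a < x \<and> x < b"
      "\<And>n. \<phi> n \<in> test_on a b" "(\<lambda>n. L2_sq (\<lambda>x. \<phi> n x - f x)) \<longlonglongrightarrow> 0"
    and eq: "\<And>\<psi>. \<psi> \<in> test_on a b \<Longrightarrow> (LINT x|lborel. cnj (h x) * \<psi> x) = (LINT x|lborel. cnj (f x) * \<psi> x)"
  proof (rule Riesz_test_on[of a b "\<lambda>\<psi>. LINT x|lborel. cnj (h x) * \<psi> x" "sqrt (L2_sq (\<lambda>x. cnj (h x)))"])
    fix \<phi> assume "\<phi> \<in> test_on a b"
    then show "norm (LINT x|lborel. cnj (h x) * \<phi> x) \<le> sqrt (L2_sq (\<lambda>x. cnj (h x))) * sqrt (L2_sq \<phi>)"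
      by (intro sq_int_mult sc h test_fun_sq_int test_on_test_fun)
  next
    fix f \<phi>
    assume "sq_int f" "\<And>x. f x \<noteq> 0 \<Longrightarrow> a < x \<and> x < b" "\<And>n. \<phi> n \<in> test_on a b"
      "(\<lambda>n. L2_sq (\<lambda>x. \<phi> n x - f x)) \<longlonglongrightarrow> 0"
      "\<And>\<psi>. \<psi> \<in> test_on a b \<Longrightarrow> (LINT x|lborel. cnj (h x) * \<psi> x) = (LINT x|lborel. cnj (f x) * \<psi> x)"
    then show thesis by (rule that)
  qed (simp_all add: ci[OF h(1)] distrib_left mult.left_commute)
  \<comment> \<open>\<open>h\<close> and the limit \<open>f\<close> of test functions induce the
    same functional on \<open>test_on a b\<close>, so they agree on the interval.\<close>
  have "AE x in lborel. x \<in> {a<..<b} \<longrightarrow> cnj (h x) - cnj (f x) = 0"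
  proof (rule fundamental_lemma)
    show "loc_int (\<lambda>x. cnj (h x) - cnj (f x))"
      by (intro loc_int_diff L2_loc_loc_int sq_int_L2_loc sc h f)
    fix \<psi> assume "\<psi> \<in> test_fun" "\<And>x. \<psi> x \<noteq> 0 \<Longrightarrow> a < x \<and> x < b"
    then have "\<psi> \<in> test_on a b" by (simp add: test_on_def)
    then show "(LINT x|lborel. (cnj (h x) - cnj (f x)) * \<psi> x) = 0"
      using eq ci[OF h(1)] ci[OF f(1)] by (simp add: left_diff_distrib)
  qed
  then have ae: "AE x in lborel. f x = h x"
  proof eventually_elim
    case (elim x)
    show ?case
    proof (cases "x \<in> {a<..<b}")
      case True
      then have "cnj (h x) = cnj (f x)" using elim by simp
      then show ?thesis by simp
    next
      case False
      then have "f x = 0" "h x = 0" using f(2)[of x] h(2)[of x] by auto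
      then show ?thesis by simp
    qed
  qed
  have [measurable]: "f \<in> borel_measurable borel" "h \<in> borel_measurable borel" "\<phi> n \<in> borel_measurable borel"
      for n
    using f(1) h(1) test_fun_sq_int[OF test_on_test_fun[OF f(3)]] by (auto simp: sq_int_def)
  have "L2_sq (\<lambda>x. \<phi> n x - f x) = L2_sq (\<lambda>x. \<phi> n x - h x)" for n
    unfolding L2_sq_def by (rule integral_cong_AE) (use ae in \<open>auto elim: eventually_mono\<close>)
  then show thesis using that[of \<phi>] f by simp
qed

text \<open>Riesz' theorem applies on each bounded interval with its own constant; the functions
  obtained for growing intervals agree almost everywhere on the smaller one and can be
  glued.\<close>

lemma L2_loc_representation:
  assumes add: "\<And>\<phi> \<psi>. \<phi> \<in> test_fun \<Longrightarrow> \<psi> \<in> test_fun \<Longrightarrow> T (\<lambda>x. \<phi> x + \<psi> x) = T \<phi> + T \<psi>"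
    and scale: "\<And>c \<phi>. \<phi> \<in> test_fun \<Longrightarrow> T (\<lambda>x. c * \<phi> x) = c * T \<phi>"
    and bound: "\<And>R. R > 0 \<Longrightarrow> \<exists>C. \<forall>\<phi>\<in>test_on (-R) R. norm (T \<phi>) \<le> C * sqrt (L2_sq \<phi>)"
  obtains f where "f \<in> L2_loc" "\<And>\<phi>. \<phi> \<in> test_fun \<Longrightarrow> T \<phi> = (LINT x|lborel. f x * \<phi> x)"
proof -
  have "\<exists>g. sq_int g \<and> (\<forall>\<phi>\<in>test_on (- real (Suc n)) (real (Suc n)). T \<phi> = (LINT x|lborel. g x * \<phi> x))" for n
  proof -
    obtain C where C: "\<forall>\<phi>\<in>test_on (- real (Suc n)) (real (Suc n)). norm (T \<phi>) \<le> C * sqrt (L2_sq \<phi>)"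
      using bound[of "real (Suc n)"] by auto
    obtain f where f: "sq_int f" "\<And>\<psi>. \<psi> \<in> test_on (- real (Suc n)) (real (Suc n)) \<Longrightarrow> T \<psi>
        = (LINT x|lborel. cnj (f x) * \<psi> x)"
      by (rule Riesz_test_on[of "- real (Suc n)" "real (Suc n)" T C])
        (use C add scale test_on_test_fun in blast)+
    have "sq_int (\<lambda>x. cnj (f x))" using f(1) by (rule sq_int_cnj)
    then show ?thesis using f(2) by blast
  qed
  then obtain g where g: "\<And>n. sq_int (g n)"
    "\<And>n \<phi>. \<phi> \<in> test_on (- real (Suc n)) (real (Suc n)) \<Longrightarrow> T \<phi> = (LINT x|lborel. g n x * \<phi> x)" by metis
  have [measurable]: "g n \<in> borel_measurable borel" for n using g(1) by (rule sq_int_measurable)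
  have consistent: "AE x in lborel. x \<in> {- real (Suc n)<..<real (Suc n)} \<longrightarrow> g n x - g k x = 0" if "n \<le> k"
      for n k
  proof (rule fundamental_lemma)
    show "loc_int (\<lambda>x. g n x - g k x)" by (intro loc_int_diff L2_loc_loc_int sq_int_L2_loc g)
    fix \<phi> assume \<phi>: "\<phi> \<in> test_fun" "\<And>x. \<phi> x \<noteq> 0 \<Longrightarrow> - real (Suc n) < x \<and> x < real (Suc n)"
    have "\<phi> \<in> test_on (- real (Suc n)) (real (Suc n))" "\<phi> \<in> test_on (- real (Suc k)) (real (Suc k))"
      using \<phi> that by (force simp: test_on_def)+
    then have "(LINT x|lborel. g n x * \<phi> x) = (LINT x|lborel. g k x * \<phi> x)" using g(2) by metis
    moreover have "integrable lborel (\<lambda>x. g i x * \<phi> x)" for i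
      by (rule sq_int_mult(1)[OF g(1) test_fun_sq_int[OF \<phi>(1)]])
    ultimately show "(LINT x|lborel. (g n x - g k x) * \<phi> x) = 0" by (simp add: left_diff_distrib)
  qed
  \<comment> \<open>An index, depending measurably on \<open>x\<close>, whose interval contains
    \<open>x\<close>; the \<open>Suc\<close> in the intervals turns
    \<open>\<bar>x\<bar> \<le> k x\<close> into a strict bound.\<close>
  define k where "k x = nat \<lceil>\<bar>x\<bar>\<rceil>" for x :: real
  have k: "x \<in> {- real (Suc (k x))<..<real (Suc (k x))}" for x
  proof -
    have "\<bar>x\<bar> \<le> real (k x)" unfolding k_def by (rule real_nat_ceiling_ge)
    then show ?thesis by auto
  qed
  define f where "f x = g (k x) x" for x
  have [measurable]: "k \<in> measurable borel (count_space UNIV)" unfolding k_def[abs_def] by measurable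
  have [measurable]: "f \<in> borel_measurable borel"
    unfolding f_def[abs_def] by (rule measurable_compose_countable[where g = k]) auto
  have "AE x in lborel. \<forall>n k. n \<le> k \<longrightarrow> x \<in> {- real (Suc n)<..<real (Suc n)} \<longrightarrow> g n x - g k x = 0"
    unfolding AE_all_countable using consistent by (auto simp: AE_all_countable)
  then have ae: "AE x in lborel. \<forall>n. x \<in> {- real (Suc n)<..<real (Suc n)} \<longrightarrow> f x = g n x"
  proof eventually_elim
    case (elim x)
    show ?case
    proof (intro allI impI)
      fix n assume x: "x \<in> {- real (Suc n)<..<real (Suc n)}"
      show "f x = g n x"
      proof (cases "n \<le> k x")
        case True
        from elim[rule_format, OF this x] show ?thesis by (simp add: f_def)
      next
        case False
        then have "k x \<le> n" by simp
        from elim[rule_format, OF this k] show ?thesis by (simp add: f_def)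
      qed
    qed
  qed
  have "f \<in> L2_loc"
    unfolding L2_loc_iff loc_int_def set_integrable_def
  proof (intro conjI allI)
    fix a b :: real
    obtain n where n: "\<bar>a\<bar> + \<bar>b\<bar> < real n" using reals_Archimedean2 by blast
    have "integrable lborel (\<lambda>x. indicat_real {a..b} x *\<^sub>R (norm (g n x))\<^sup>2)"
      by (rule integrable_mult_indicator) (auto intro: sq_int_integrable g)
    moreover have "AE x in lborel. indicat_real {a..b} x *\<^sub>R (norm (g n x))\<^sup>2
        = indicat_real {a..b} x *\<^sub>R (norm (f x))\<^sup>2"
      using ae
    proof eventually_elim
      case (elim x)
      show ?case
      proof (cases "x \<in> {a..b}")
        case True
        then have "x \<in> {- real (Suc n)<..<real (Suc n)}" using n by auto
        then show ?thesis using elim by simp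
      qed simp
    qed
    ultimately show "integrable lborel (\<lambda>x. indicat_real {a..b} x *\<^sub>R (norm (f x))\<^sup>2)"
      by (subst (asm) integrable_cong_AE) auto
  qed auto
  moreover have "T \<phi> = (LINT x|lborel. f x * \<phi> x)" if \<phi>: "\<phi> \<in> test_fun" for \<phi>
  proof -
    obtain R where R: "\<And>x. \<phi> x \<noteq> 0 \<Longrightarrow> \<bar>x\<bar> < R" using test_fun_bounds[OF \<phi>] by blast
    obtain n where n: "R < real n" using reals_Archimedean2 by blast
    have supp: "x \<in> {- real (Suc n)<..<real (Suc n)}" if "\<phi> x \<noteq> 0" for x
      using R[OF that] n by auto
    have [measurable]: "\<phi> \<in> borel_measurable borel" using test_fun_sq_int[OF \<phi>] by (rule sq_int_measurable)
    have "T \<phi> = (LINT x|lborel. g n x * \<phi> x)"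
      by (rule g(2)) (use \<phi> supp in \<open>auto simp: test_on_def\<close>)
    also have "\<dots> = (LINT x|lborel. f x * \<phi> x)"
    proof (rule integral_cong_AE)
      show "AE x in lborel. g n x * \<phi> x = f x * \<phi> x"
        using ae
      proof eventually_elim
        case (elim x)
        then show ?case using supp[of x] by (cases "\<phi> x = 0") auto
      qed
    qed auto
    finally show ?thesis .
  qed
  ultimately show thesis by (rule that)
qed

section \<open>Fourier transform\<close>

text \<open>The exponent has the sign of \<open>inv_fourier\<close>, of which this is
  \<open>2 * pi\<close> times. The ordinary Fourier transform at \<open>\<xi>\<close> is therefore
  \<open>ft u (- \<xi>)\<close>.\<close>

definition ft :: "(real \<Rightarrow> complex) \<Rightarrow> real \<Rightarrow> complex" where
  "ft u \<xi> = (LINT x|lborel. cis (\<xi> * x) * u x)"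

lemma inv_fourier_ft: "inv_fourier \<phi> \<xi> = of_real (1 / (2 * pi)) * ft \<phi> \<xi>"
  by (simp add: inv_fourier_def ft_def)

lemma integrable_bounded_mult:
  fixes u :: "'a \<Rightarrow> complex"
  assumes "integrable M u" "k \<in> borel_measurable M" "\<And>x. norm (k x) \<le> B"
  shows "integrable M (\<lambda>x. k x * u x)"
proof (rule Bochner_Integration.integrable_bound)
  show "integrable M (\<lambda>x. B * norm (u x))" using assms by (intro integrable_mult_right integrable_norm)
  have "B \<ge> 0" using assms(3) norm_ge_zero order_trans by blast
  then show "AE x in M. norm (k x * u x) \<le> norm (B * norm (u x))"
    using assms(3) by (intro AE_I2) (auto simp: norm_mult abs_mult intro!: mult_right_mono)
qed (use assms in auto)

lemma cis_measurable [measurable]: "cis \<in> borel_measurable borel"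
  by (intro borel_measurable_continuous_onI continuous_intros)

lemma ft_integrable: "integrable lborel u \<Longrightarrow> integrable lborel (\<lambda>x. cis (\<xi> * x) * u x)"
  by (rule integrable_bounded_mult[where B = 1]) auto

lemma norm_ft_le: "integrable lborel u \<Longrightarrow> norm (ft u \<xi>) \<le> (LINT x|lborel. norm (u x))"
  unfolding ft_def using integral_norm_bound[of lborel "\<lambda>x. cis (\<xi> * x) * u x"] by (simp add: norm_mult)

lemma ft_measurable [measurable]:
  assumes [measurable]: "u \<in> borel_measurable borel"
  shows "ft u \<in> borel_measurable borel"
  unfolding ft_def[abs_def] by (intro lborel.borel_measurable_lebesgue_integral) measurable

lemma ft_cnj: "ft (\<lambda>x. cnj (u x)) (- \<xi>) = cnj (ft u \<xi>)"
proof -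
  have "cis (- \<xi> * x) * cnj (u x) = cnj (cis (\<xi> * x) * u x)" for x by (simp add: cis_cnj)
  then show ?thesis unfolding ft_def by (simp only: Bochner_Integration.integral_cnj)
qed

section \<open>Gaussian summation, Bessel's inequality and Parseval's formula\<close>

definition gauss :: "real \<Rightarrow> real \<Rightarrow> real" where
  "gauss s \<xi> = exp (- (s * \<xi>)\<^sup>2 / 2)"

lemma gauss_measurable [measurable]: "gauss s \<in> borel_measurable borel"
  unfolding gauss_def[abs_def] by measurable

lemma gauss_bounds: "0 \<le> gauss s \<xi>" "gauss s \<xi> \<le> 1"
  by (auto simp: gauss_def)

lemma gauss_eq: "gauss s \<xi> = sqrt (2 * pi) * std_normal_density (s * \<xi>)"
  by (simp add: gauss_def std_normal_density_def)

lemma gauss_integrable: "s > 0 \<Longrightarrow> integrable lborel (gauss s)"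
  using lborel_integrable_real_affine[OF integrable_normal_density[of 1 0], of s 0]
  by (simp add: gauss_eq[abs_def])

lemma std_normal_transform: "(LINT x|lborel. of_real (std_normal_density x) * cis (t * x))
    = of_real (exp (- t\<^sup>2 / 2))"
proof -
  have "of_real (exp (- t\<^sup>2 / 2)) = char std_normal_distribution t"
    by (simp add: char_std_normal_distribution)
  also have "\<dots> = (LINT x|lborel. std_normal_density x *\<^sub>R iexp (t * x))"
    unfolding char_def by (subst integral_density) auto
  finally show ?thesis by (simp add: cis_conv_exp scaleR_conv_of_real mult.commute)
qed

text \<open>A rescaling of the characteristic function of the standard normal distribution. The
  right-hand side is \<open>2 * pi\<close> times the centred normal density of standard deviation
  \<open>s\<close>, an approximate identity as \<open>s\<close> tends to 0.\<close>

lemma gauss_transform: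
  assumes s: "s > 0"
  shows "(LINT \<xi>|lborel. of_real (gauss s \<xi>) * cis (\<xi> * t))
      = of_real (2 * pi / s * std_normal_density (t / s))"
proof -
  have "(LINT x|lborel. of_real (std_normal_density x) * cis ((t / s) * x))
      = \<bar>s\<bar> *\<^sub>R (LINT x|lborel. of_real (std_normal_density (0 + s * x)) * cis ((t / s) * (0 + s * x)))"
    by (rule lborel_integral_real_affine) (use s in simp)
  then have "of_real (exp (- (t / s)\<^sup>2 / 2)) = of_real s * (LINT x|lborel. of_real (std_normal_density (s * x))
      * cis (x * t))"
    unfolding std_normal_transform using s by (simp add: scaleR_conv_of_real mult.commute)
  moreover have "(LINT \<xi>|lborel. of_real (gauss s \<xi>) * cis (\<xi> * t))
      = of_real (sqrt (2 * pi)) * (LINT x|lborel. of_real (std_normal_density (s * x)) * cis (x * t))"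
    by (simp only: gauss_eq of_real_mult mult.assoc integral_mult_right_zero)
  ultimately have "(LINT \<xi>|lborel. of_real (gauss s \<xi>) * cis (\<xi> * t))
      = of_real (sqrt (2 * pi) * exp (- (t / s)\<^sup>2 / 2) / s)"
    using s by (simp add: field_simps)
  also have "sqrt (2 * pi) * exp (- (t / s)\<^sup>2 / 2) / s = 2 * pi / s * std_normal_density (t / s)"
    using s by (simp add: std_normal_density_def real_sqrt_mult field_simps)
  finally show ?thesis .
qed

text \<open>The Gaussian factor makes all integrals absolutely convergent. The second factor is reflected, so that
  taking for \<open>v\<close> the conjugate of \<open>u\<close> gives the square of the modulus of \<open>ft u\<close>.\<close>

lemma gauss_parseval:
  assumes u: "integrable lborel u" and v: "integrable lborel v" and s: "s > 0"
  shows "(LINT \<xi>|lborel. of_real (gauss s \<xi>) * (ft u \<xi> * ft v (- \<xi>)))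
    = of_real (2 * pi) * (LINT x|lborel. u x * (LINT z|lborel. of_real (std_normal_density z) * v
        (x - s * z)))"
proof -
  have [measurable]: "u \<in> borel_measurable borel" "v \<in> borel_measurable borel" using u v by auto
  define W where "W \<xi> = complex_of_real (gauss s \<xi>)" for \<xi>
  have W: "integrable lborel W"
    unfolding W_def[abs_def] using gauss_integrable[OF s] by (simp add: complex_of_real_integrable_eq)
  have [measurable]: "W \<in> borel_measurable borel" using W by auto
  define g where "g \<xi> = ft v (- \<xi>) * W \<xi>" for \<xi>
  have g: "integrable lborel g"
    unfolding g_def[abs_def] by (rule integrable_bounded_mult[OF W _ norm_ft_le[OF v]]) simp
  have "integrable (lborel \<Otimes>\<^sub>M lborel) (\<lambda>(x, \<xi>). cis (\<xi> * x) * (u x * g \<xi>))"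
    by (rule integrable_tensor_bounded[OF u g, where B = 1]) auto
  from lborel_pair.Fubini_integral[OF this]
  have 1: "(LINT \<xi>|lborel. LINT x|lborel. cis (\<xi> * x) * (u x * g \<xi>))
      = (LINT x|lborel. LINT \<xi>|lborel. cis (\<xi> * x) * (u x * g \<xi>))" .
  have "(LINT \<xi>|lborel. LINT x|lborel. cis (\<xi> * x) * (u x * g \<xi>))
      = (LINT \<xi>|lborel. W \<xi> * (ft u \<xi> * ft v (- \<xi>)))"
  proof (rule Bochner_Integration.integral_cong)
    fix \<xi>
    have "(LINT x|lborel. cis (\<xi> * x) * (u x * g \<xi>)) = (LINT x|lborel. (cis (\<xi> * x) * u x) * g \<xi>)"
        by (simp add: mult.assoc)
    also have "\<dots> = ft u \<xi> * g \<xi>" by (simp add: ft_def)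
    finally show "(LINT x|lborel. cis (\<xi> * x) * (u x * g \<xi>)) = W \<xi> * (ft u \<xi> * ft v (- \<xi>))"
      by (simp add: g_def mult.assoc mult.left_commute)
  qed simp
  moreover have "(LINT \<xi>|lborel. cis (\<xi> * x) * (u x * g \<xi>))
      = of_real (2 * pi) * (u x * (LINT z|lborel. of_real (std_normal_density z) * v (x - s * z)))" for x
  proof -
    have "integrable (lborel \<Otimes>\<^sub>M lborel) (\<lambda>(y, \<xi>). cis (\<xi> * (x - y)) * (v y * W \<xi>))"
      by (rule integrable_tensor_bounded[OF v W, where B = 1]) auto
    from lborel_pair.Fubini_integral[OF this]
    have 2: "(LINT \<xi>|lborel. LINT y|lborel. cis (\<xi> * (x - y)) * (v y * W \<xi>))
        = (LINT y|lborel. LINT \<xi>|lborel. cis (\<xi> * (x - y)) * (v y * W \<xi>))" .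
    have "cis (\<xi> * x) * g \<xi> = (LINT y|lborel. cis (\<xi> * (x - y)) * (v y * W \<xi>))" for \<xi>
    proof -
      have "cis (\<xi> * (x - y)) * (v y * W \<xi>) = cis (\<xi> * x) * W \<xi> * (cis (- \<xi> * y) * v y)" for y
      proof -
        have "cis (\<xi> * x) * cis (- \<xi> * y) = cis (\<xi> * (x - y))" by (simp add: cis_mult algebra_simps)
        then show ?thesis by (simp add: mult.left_commute mult.commute)
      qed
      then show ?thesis
        unfolding g_def ft_def by (simp only: integral_mult_right_zero)
            (simp add: mult.commute mult.left_commute)
    qed
    then have "(LINT \<xi>|lborel. cis (\<xi> * x) * (u x * g \<xi>))
        = u x * (LINT \<xi>|lborel. LINT y|lborel. cis (\<xi> * (x - y)) * (v y * W \<xi>))"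
      by (simp add: mult.left_commute)
    also have "\<dots> = u x * (LINT y|lborel. v y * (LINT \<xi>|lborel. W \<xi> * cis (\<xi> * (x - y))))"
    proof -
      have "cis (\<xi> * (x - y)) * (v y * W \<xi>) = v y * (W \<xi> * cis (\<xi> * (x - y)))" for \<xi> y by simp
      then show ?thesis unfolding 2 by (simp only: integral_mult_right_zero)
    qed
    also have "\<dots> = u x * (LINT y|lborel. v y * of_real (2 * pi / s * std_normal_density ((x - y) / s)))"
      unfolding W_def gauss_transform[OF s] ..
    \<comment> \<open>The substitution \<open>y = x - s z\<close> turns the kernel of width
      \<open>s\<close> into a fixed density.\<close>
    also have "(LINT y|lborel. v y * of_real (2 * pi / s * std_normal_density ((x - y) / s)))
      = \<bar>- s\<bar> *\<^sub>R (LINT z|lborel. v (x + (- s) * z) * of_real (2 * pi / s * std_normal_density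
          ((x - (x + (- s) * z)) / s)))"
      by (rule lborel_integral_real_affine) (use s in simp)
    also have "\<dots> = of_real (2 * pi) * (LINT z|lborel. of_real (std_normal_density z) * v (x - s * z))"
    proof -
      have "v (x + (- s) * z) * of_real (2 * pi / s * std_normal_density ((x - (x + (- s) * z)) / s))
          = of_real (2 * pi / s) * (of_real (std_normal_density z) * v (x - s * z))" for z
        using s by simp
      then show ?thesis using s by (simp only: integral_mult_right_zero) (simp add: scaleR_conv_of_real)
    qed
    finally show ?thesis by (simp add: mult.left_commute)
  qed
  ultimately show ?thesis using 1 by (simp add: W_def)
qed

text \<open>With \<open>v\<close> the conjugate of \<open>u\<close>, the Gaussian formula pairs
  \<open>u\<close> with an average of translates of \<open>v\<close> over a probability density, and
  averaging does not increase the square norm. The estimate runs in nonnegative integrals, where the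
  order of integration may be changed freely.\<close>

lemma gauss_bessel:
  assumes u: "integrable lborel u" "sq_int u" and s: "s > 0"
  shows "(LINT \<xi>|lborel. gauss s \<xi> * (norm (ft u \<xi>))\<^sup>2) \<le> 2 * pi * L2_sq u"
proof -
  have [measurable]: "u \<in> borel_measurable borel" using u by auto
  define v where "v x = cnj (u x)" for x
  have v: "integrable lborel v" "sq_int v" using u sq_int_cnj by (auto simp: v_def[abs_def])
  have [measurable]: "v \<in> borel_measurable borel" using v by auto
  have nv: "norm (v x) = norm (u x)" for x by (simp add: v_def)
  define N where "N = std_normal_density"
  have [measurable]: "N \<in> borel_measurable borel" and N0: "N z \<ge> 0" for z by (simp_all add: N_def)
  have N1: "(\<integral>\<^sup>+z. ennreal (N z) \<partial>lborel) = 1"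
    by (subst nn_integral_eq_integral) (simp_all add: N_def)
  have L2: "(\<integral>\<^sup>+x. ennreal ((norm (u x))\<^sup>2) \<partial>lborel) = ennreal (L2_sq u)"
    unfolding L2_sq_def by (rule nn_integral_eq_integral[OF sq_int_integrable[OF u(2)]]) simp
  have shift: "(\<integral>\<^sup>+x. ennreal ((norm (u (x - c)))\<^sup>2) \<partial>lborel) = ennreal (L2_sq u)" for c
    using nn_integral_real_affine[of "\<lambda>x. ennreal ((norm (u x))\<^sup>2)" 1 "-c"] by (simp add: L2)
  define V where "V x = (LINT z|lborel. of_real (N z) * v (x - s * z))" for x
  have norm_le_nn: "ennreal (norm (integral\<^sup>L lborel f)) \<le> (\<integral>\<^sup>+x. ennreal (norm (f x)) \<partial>lborel)" for f ::
      "real \<Rightarrow> complex"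
    using integral_norm_bound_ennreal[of lborel f]
        by (cases "integrable lborel f") (auto simp: not_integrable_integral_eq)
  \<comment> \<open>A product is at most half the sum of the squares; by translation invariance each
    of the two terms integrates over \<open>x\<close> to half of \<open>L2_sq u\<close>.\<close>
  have young: "ennreal (norm (u x)) * ennreal (N z * norm (v (x - s * z)))
      \<le> ennreal (N z) * (ennreal ((norm (u x))\<^sup>2 / 2) + ennreal ((norm (u (x - s * z)))\<^sup>2 / 2))" for x z
  proof -
    have "0 \<le> (norm (u x) - norm (u (x - s * z)))\<^sup>2" by simp
    then have "norm (u x) * norm (u (x - s * z)) \<le> (norm (u x))\<^sup>2 / 2 + (norm (u (x - s * z)))\<^sup>2 / 2"
      by (simp add: power2_diff)
    then have "norm (u x) * (N z * norm (v (x - s * z)))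
        \<le> N z * ((norm (u x))\<^sup>2 / 2 + (norm (u (x - s * z)))\<^sup>2 / 2)"
      using N0[of z] by (simp add: nv mult_left_mono mult.left_commute)
    then show ?thesis
      using N0[of z] by (simp add: ennreal_mult[symmetric] ennreal_plus[symmetric] ennreal_leI del:
          ennreal_plus)
  qed
  have half: "(\<integral>\<^sup>+x. ennreal ((norm (u x))\<^sup>2 / 2) \<partial>lborel) = ennreal (L2_sq u / 2)"
    unfolding L2_sq_def using nn_integral_eq_integral[OF integrable_divide[OF sq_int_integrable[OF u(2)], of
        2]] by simp
  have half': "(\<integral>\<^sup>+x. ennreal ((norm (u (x - c)))\<^sup>2 / 2) \<partial>lborel) = ennreal (L2_sq u / 2)" for c
    using nn_integral_real_affine[of "\<lambda>x. ennreal ((norm (u x))\<^sup>2 / 2)" 1 "-c"] by (simp add: half)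
  have "ennreal (norm (LINT x|lborel. u x * V x)) \<le> (\<integral>\<^sup>+x. ennreal (norm (u x * V x)) \<partial>lborel)"
      by (rule norm_le_nn)
  also have "\<dots> \<le> (\<integral>\<^sup>+x. (\<integral>\<^sup>+z. ennreal (norm (u x)) * ennreal (N z * norm (v (x - s * z))) \<partial>lborel) \<partial>lborel)"
  proof (rule nn_integral_mono)
    fix x
    have "ennreal (norm (u x * V x)) = ennreal (norm (u x)) * ennreal (norm (V x))"
        by (simp add: norm_mult ennreal_mult)
    also have "\<dots> \<le> ennreal (norm (u x)) * (\<integral>\<^sup>+z. ennreal (norm (of_real (N z) * v (x - s * z))) \<partial>lborel)"
      unfolding V_def by (intro mult_left_mono norm_le_nn) simp
    also have "\<dots> = (\<integral>\<^sup>+z. ennreal (norm (u x)) * ennreal (N z * norm (v (x - s * z))) \<partial>lborel)"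
      by (subst nn_integral_cmult) (simp_all add: norm_mult N0)
    finally show "ennreal (norm (u x * V x)) \<le> (\<integral>\<^sup>+z. ennreal (norm (u x)) * ennreal (N z * norm (v (x
        - s * z))) \<partial>lborel)" .
  qed
  also have "\<dots> \<le> (\<integral>\<^sup>+x. (\<integral>\<^sup>+z. ennreal (N z) * (ennreal ((norm (u x))\<^sup>2 / 2)
      + ennreal ((norm (u (x - s * z)))\<^sup>2 / 2)) \<partial>lborel) \<partial>lborel)"
    by (intro nn_integral_mono young)
  also have "\<dots> = (\<integral>\<^sup>+z. (\<integral>\<^sup>+x. ennreal (N z) * (ennreal ((norm (u x))\<^sup>2 / 2)
      + ennreal ((norm (u (x - s * z)))\<^sup>2 / 2)) \<partial>lborel) \<partial>lborel)"
    by (rule lborel_pair.Fubini') measurable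
  also have "\<dots> = (\<integral>\<^sup>+z. ennreal (N z) * ennreal (L2_sq u) \<partial>lborel)"
  proof (rule nn_integral_cong)
    fix z
    have "(\<integral>\<^sup>+x. ennreal (N z) * (ennreal ((norm (u x))\<^sup>2 / 2) + ennreal ((norm (u (x - s * z)))\<^sup>2 / 2)) \<partial>lborel)
      = ennreal (N z) * (ennreal (L2_sq u / 2) + ennreal (L2_sq u / 2))"
      by (subst nn_integral_cmult, simp, subst nn_integral_add) (simp_all add: half half')
    also have "ennreal (L2_sq u / 2) + ennreal (L2_sq u / 2) = ennreal (L2_sq u)"
      using L2_sq_nonneg[of u] by (simp flip: ennreal_plus)
    finally show "(\<integral>\<^sup>+x. ennreal (N z) * (ennreal ((norm (u x))\<^sup>2 / 2)
        + ennreal ((norm (u (x - s * z)))\<^sup>2 / 2)) \<partial>lborel)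
      = ennreal (N z) * ennreal (L2_sq u)" .
  qed
  also have "\<dots> = ennreal (L2_sq u)" by (subst nn_integral_multc) (simp_all add: N1)
  finally have bound: "norm (LINT x|lborel. u x * V x) \<le> L2_sq u" by (simp add: ennreal_le_iff L2_sq_nonneg)
  have "complex_of_real (LINT \<xi>|lborel. gauss s \<xi> * (norm (ft u \<xi>))\<^sup>2)
      = (LINT \<xi>|lborel. of_real (gauss s \<xi>) * (ft u \<xi> * ft v (- \<xi>)))"
    unfolding integral_complex_of_real[symmetric]
    by (simp only: of_real_mult complex_norm_square v_def[abs_def] ft_cnj)
  also have "\<dots> = of_real (2 * pi) * (LINT x|lborel. u x * V x)"
    unfolding gauss_parseval[OF u(1) v(1) s] V_def N_def ..
  finally have "norm (complex_of_real (LINT \<xi>|lborel. gauss s \<xi> * (norm (ft u \<xi>))\<^sup>2))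
      = 2 * pi * norm (LINT x|lborel. u x * V x)"
    by (simp only: norm_mult) simp
  then have "\<bar>LINT \<xi>|lborel. gauss s \<xi> * (norm (ft u \<xi>))\<^sup>2\<bar> \<le> 2 * pi * L2_sq u" using bound by simp
  then show ?thesis by simp
qed

definition gscale :: "nat \<Rightarrow> real" where "gscale n = 1 / real (Suc n)"

lemma gscale_pos: "gscale n > 0" by (simp add: gscale_def)

lemma gscale_tendsto: "gscale \<longlonglongrightarrow> 0"
  unfolding gscale_def[abs_def] by (rule LIMSEQ_Suc[OF lim_1_over_n])

lemma gauss_tendsto: "(\<lambda>n. gauss (gscale n) \<xi>) \<longlonglongrightarrow> 1"
proof -
  have "(\<lambda>n. exp (- (gscale n * \<xi>)\<^sup>2 / 2)) \<longlonglongrightarrow> exp (- (0 * \<xi>)\<^sup>2 / 2)"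
    by (intro tendsto_intros gscale_tendsto) simp
  then show ?thesis by (simp add: gauss_def)
qed

text \<open>The Gaussian factors tend to 1 as their scale tends to 0, and Fatou's lemma transfers
  the bound, which is uniform in the scale.\<close>

lemma bessel:
  assumes u: "integrable lborel u" "sq_int u"
  shows "sq_int (ft u)" "L2_sq (ft u) \<le> 2 * pi * L2_sq u"
proof -
  have [measurable]: "u \<in> borel_measurable borel" using u by auto
  have "(\<integral>\<^sup>+\<xi>. ennreal ((norm (ft u \<xi>))\<^sup>2) \<partial>lborel)
      = (\<integral>\<^sup>+\<xi>. liminf (\<lambda>n. ennreal (gauss (gscale n) \<xi> * (norm (ft u \<xi>))\<^sup>2)) \<partial>lborel)"
  proof (rule nn_integral_cong)
    fix \<xi>
    have "(\<lambda>n. ennreal (gauss (gscale n) \<xi> * (norm (ft u \<xi>))\<^sup>2)) \<longlonglongrightarrow> ennreal (1 * (norm (ft u \<xi>))\<^sup>2)"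
      by (intro tendsto_ennrealI tendsto_intros gauss_tendsto)
    then show "ennreal ((norm (ft u \<xi>))\<^sup>2) = liminf (\<lambda>n. ennreal (gauss (gscale n) \<xi> * (norm (ft u \<xi>))\<^sup>2))"
      using lim_imp_Liminf[OF sequentially_bot] by fastforce
  qed
  also have "\<dots> \<le> liminf (\<lambda>n. \<integral>\<^sup>+\<xi>. ennreal (gauss (gscale n) \<xi> * (norm (ft u \<xi>))\<^sup>2) \<partial>lborel)"
    by (rule nn_integral_liminf) measurable
  also have "\<dots> \<le> ennreal (2 * pi * L2_sq u)"
  proof (rule Liminf_le)
    show "\<forall>\<^sub>F n in sequentially. (\<integral>\<^sup>+\<xi>. ennreal (gauss (gscale n) \<xi> * (norm (ft u \<xi>))\<^sup>2) \<partial>lborel)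
        \<le> ennreal (2 * pi * L2_sq u)"
    proof (rule always_eventually, rule allI)
      fix n
      have "integrable lborel (\<lambda>\<xi>. gauss (gscale n) \<xi> * (norm (ft u \<xi>))\<^sup>2)"
      proof (rule Bochner_Integration.integrable_bound)
        show "integrable lborel (\<lambda>\<xi>. (LINT x|lborel. norm (u x))\<^sup>2 * gauss (gscale n) \<xi>)"
          by (intro integrable_mult_right gauss_integrable gscale_pos)
        show "AE \<xi> in lborel. norm (gauss (gscale n) \<xi> * (norm (ft u \<xi>))\<^sup>2)
            \<le> norm ((LINT x|lborel. norm (u x))\<^sup>2 * gauss (gscale n) \<xi>)"
          using norm_ft_le[OF u(1)] by (intro AE_I2) (auto simp: gauss_bounds abs_mult mult.commute intro!:
              mult_mono power_mono)
      qed measurable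
      then have "(\<integral>\<^sup>+\<xi>. ennreal (gauss (gscale n) \<xi> * (norm (ft u \<xi>))\<^sup>2) \<partial>lborel)
          = ennreal (LINT \<xi>|lborel. gauss (gscale n) \<xi> * (norm (ft u \<xi>))\<^sup>2)"
        by (rule nn_integral_eq_integral) (simp add: gauss_bounds)
      then show "(\<integral>\<^sup>+\<xi>. ennreal (gauss (gscale n) \<xi> * (norm (ft u \<xi>))\<^sup>2) \<partial>lborel) \<le> ennreal (2 * pi * L2_sq u)"
        using gauss_bessel[OF u gscale_pos, of n] by (simp add: ennreal_leI)
    qed
  qed simp
  finally have le: "(\<integral>\<^sup>+\<xi>. ennreal ((norm (ft u \<xi>))\<^sup>2) \<partial>lborel) \<le> ennreal (2 * pi * L2_sq u)" .
  then have i: "integrable lborel (\<lambda>\<xi>. (norm (ft u \<xi>))\<^sup>2)"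
    using le_less_trans[OF le ennreal_less_top] by (intro integrableI_bounded) auto
  then show "sq_int (ft u)" by (simp add: sq_int_def)
  have "ennreal (L2_sq (ft u)) \<le> ennreal (2 * pi * L2_sq u)"
    using le nn_integral_eq_integral[OF i] by (simp add: L2_sq_def)
  then show "L2_sq (ft u) \<le> 2 * pi * L2_sq u"
    using L2_sq_nonneg[of u] by (simp add: ennreal_le_iff)
qed

text \<open>The hypotheses are asymmetric because only \<open>v\<close> is averaged: continuity
  gives pointwise convergence of the averages, boundedness a majorant. In the application
  \<open>u\<close> is a test function and \<open>v\<close> a cut off \<open>H^1\<close>
  function.\<close>

lemma parseval:
  assumes u: "integrable lborel u" "sq_int u" and v: "integrable lborel v" "sq_int v"
    and vc: "continuous_on UNIV v" and vb: "\<And>x. norm (v x) \<le> B"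
  shows "(LINT \<xi>|lborel. ft u \<xi> * ft v (- \<xi>)) = of_real (2 * pi) * (LINT x|lborel. u x * v x)"
proof (rule LIMSEQ_unique)
  have [measurable]: "u \<in> borel_measurable borel" "v \<in> borel_measurable borel" using u v by auto
  have sv: "sq_int (\<lambda>\<xi>. ft v (- \<xi>))"
  proof -
    have "integrable lborel (\<lambda>\<xi>. (norm (ft v (- \<xi>)))\<^sup>2)"
      using lborel_integrable_real_affine[OF sq_int_integrable[OF bessel(1)[OF v]], of "-1" 0] by simp
    then show ?thesis by (simp add: sq_int_def)
  qed
  show "(\<lambda>n. LINT \<xi>|lborel. of_real (gauss (gscale n) \<xi>) * (ft u \<xi> * ft v (- \<xi>)))
      \<longlonglongrightarrow> (LINT \<xi>|lborel. ft u \<xi> * ft v (- \<xi>))"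
  proof (rule integral_dominated_convergence)
    show "integrable lborel (\<lambda>\<xi>. norm (ft u \<xi>) * norm (ft v (- \<xi>)))"
      by (rule sq_int_norm_mult[OF bessel(1)[OF u] sv])
    show "AE \<xi> in lborel. (\<lambda>n. complex_of_real (gauss (gscale n) \<xi>) * (ft u \<xi> * ft v (- \<xi>)))
        \<longlonglongrightarrow> ft u \<xi> * ft v (- \<xi>)"
    proof (rule AE_I2)
      fix \<xi>
      have "(\<lambda>n. complex_of_real (gauss (gscale n) \<xi>) * (ft u \<xi> * ft v (- \<xi>)))
          \<longlonglongrightarrow> of_real 1 * (ft u \<xi> * ft v (- \<xi>))"
        by (intro tendsto_intros gauss_tendsto)
      then show "(\<lambda>n. complex_of_real (gauss (gscale n) \<xi>) * (ft u \<xi> * ft v (- \<xi>))) \<longlonglongrightarrow> ft u \<xi> * ft v (- \<xi>)"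
          by simp
    qed
    show "AE \<xi> in lborel. norm (complex_of_real (gauss (gscale n) \<xi>) * (ft u \<xi> * ft v (- \<xi>)))
        \<le> norm (ft u \<xi>) * norm (ft v (- \<xi>))" for n
      by (rule AE_I2) (simp add: norm_mult gauss_bounds mult_left_le_one_le)
  qed measurable
  have lim: "(\<lambda>n. LINT z|lborel. of_real (std_normal_density z) * v (x - gscale n * z)) \<longlonglongrightarrow> v x" for x
  proof -
    have "(\<lambda>n. LINT z|lborel. of_real (std_normal_density z) * v (x - gscale n * z))
        \<longlonglongrightarrow> (LINT z|lborel. of_real (std_normal_density z) * v x)"
    proof (rule integral_dominated_convergence)
      show "integrable lborel (\<lambda>z. std_normal_density z * B)" by (intro integrable_mult_left) simp
      show "AE z in lborel. (\<lambda>n. of_real (std_normal_density z) * v (x - gscale n * z))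
          \<longlonglongrightarrow> of_real (std_normal_density z) * v x"
      proof (rule AE_I2)
        fix z
        have "(\<lambda>n. x - gscale n * z) \<longlonglongrightarrow> x - 0 * z" by (intro tendsto_intros gscale_tendsto)
        then have "(\<lambda>n. v (x - gscale n * z)) \<longlonglongrightarrow> v x"
          using vc by (intro continuous_on_tendsto_compose[OF vc]) auto
        then show "(\<lambda>n. of_real (std_normal_density z) * v (x - gscale n * z))
            \<longlonglongrightarrow> of_real (std_normal_density z) * v x"
          by (intro tendsto_intros)
      qed
      show "AE z in lborel. norm (of_real (std_normal_density z) * v (x - gscale n * z))
          \<le> std_normal_density z * B" for n
        using vb by (intro AE_I2) (auto simp: norm_mult intro!: mult_left_mono)
    qed measurable
    also have "(LINT z|lborel. of_real (std_normal_density z) * v x) = v x"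
    proof -
      have "(LINT z|lborel. complex_of_real (std_normal_density z)) = of_real 1"
        unfolding integral_complex_of_real by simp
      then show ?thesis by simp
    qed
    finally show ?thesis .
  qed
  have "(\<lambda>n. LINT x|lborel. u x * (LINT z|lborel. of_real (std_normal_density z) * v (x - gscale n * z)))
      \<longlonglongrightarrow> (LINT x|lborel. u x * v x)"
  proof (rule integral_dominated_convergence)
    show "integrable lborel (\<lambda>x. norm (u x) * B)" using u by (intro integrable_mult_left integrable_norm)
    show "AE x in lborel. (\<lambda>n. u x * (LINT z|lborel. of_real (std_normal_density z) * v (x - gscale n * z)))
        \<longlonglongrightarrow> u x * v x"
      by (intro AE_I2 tendsto_intros lim)
    have "norm (LINT z|lborel. of_real (std_normal_density z) * v (x - gscale n * z)) \<le> B" for n x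
    proof -
      have "norm (LINT z|lborel. of_real (std_normal_density z) * v (x - gscale n * z))
          \<le> (LINT z|lborel. norm (of_real (std_normal_density z) * v (x - gscale n * z)))"
        by (rule integral_norm_bound)
      also have "\<dots> \<le> (LINT z|lborel. std_normal_density z * B)"
        using vb order_trans[OF norm_ge_zero vb]
        by (intro integral_mono') (auto simp: norm_mult intro!: mult_left_mono integrable_mult_left)
      finally show ?thesis by simp
    qed
    then show "AE x in lborel. norm (u x * (LINT z|lborel. of_real (std_normal_density z) * v (x
        - gscale n * z))) \<le> norm (u x) * B" for n
      by (intro AE_I2) (auto simp: norm_mult intro!: mult_left_mono)
    show "(\<lambda>x. u x * (LINT z|lborel. of_real (std_normal_density z) * v (x - gscale n * z))) \<in>
        borel_measurable lborel" for n
      by measurable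
  qed measurable
  then show "(\<lambda>n. LINT \<xi>|lborel. of_real (gauss (gscale n) \<xi>) * (ft u \<xi> * ft v (- \<xi>)))
      \<longlonglongrightarrow> of_real (2 * pi) * (LINT x|lborel. u x * v x)"
    unfolding gauss_parseval[OF u(1) v(1) gscale_pos] by (intro tendsto_intros)
qed

text \<open>The product of \<open>cis (\<xi> * x)\<close> and \<open>F x\<close> has compact
  support, so its derivative integrates to zero. The minus sign stems from the positive exponent in
  \<open>ft\<close>.\<close>

lemma ft_derivative:
  assumes F: "ac F f" and supp: "\<And>x. F x \<noteq> 0 \<Longrightarrow> \<bar>x\<bar> < R" "\<And>x. f x \<noteq> 0 \<Longrightarrow> \<bar>x\<bar> \<le> R"
  shows "ft f \<xi> = - \<i> * of_real \<xi> * ft F \<xi>"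
proof -
  have "((\<lambda>x. cis (\<xi> * x)) has_vector_derivative \<i> * of_real \<xi> * cis (\<xi> * x)) (at x)" for x
    unfolding cis_conv_exp
    by (auto intro!: derivative_eq_intros has_vector_derivative_real_field simp: scaleR_conv_of_real)
  then have "ac (\<lambda>x. cis (\<xi> * x)) (\<lambda>x. \<i> * of_real \<xi> * cis (\<xi> * x))"
    by (rule ac_C1) (intro continuous_intros)
  from ac_mult[OF this F]
  have "(LINT x|lborel. cis (\<xi> * x) * f x + \<i> * of_real \<xi> * cis (\<xi> * x) * F x) = 0"
  proof (rule ac_integral_zero[where R = R])
    show "\<bar>x\<bar> < R" if "cis (\<xi> * x) * F x \<noteq> 0" for x using that supp(1)[of x] by auto
    show "\<bar>x\<bar> \<le> R" if "cis (\<xi> * x) * f x + \<i> * of_real \<xi> * cis (\<xi> * x) * F x \<noteq> 0" for x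
      using that supp(1)[of x] supp(2)[of x] by (cases "F x = 0"; cases "f x = 0") auto
  qed
  moreover have "integrable lborel F" "integrable lborel f"
    by (rule integrable_supported[OF loc_int_continuous[OF ac_continuous[OF F]], of
        "-R" R], use supp in force)
       (rule integrable_supported[OF ac_loc_int[OF F], of "-R" R], use supp in force)
  then have "integrable lborel (\<lambda>x. cis (\<xi> * x) * f x)" "integrable lborel (\<lambda>x. cis (\<xi> * x) * F x)"
    by (auto intro: ft_integrable)
  ultimately have "ft f \<xi> + \<i> * of_real \<xi> * ft F \<xi> = 0"
    by (simp add: ft_def mult.assoc)
  then show ?thesis by (simp add: eq_neg_iff_add_eq_0)
qed

lemma ft_test_derivative:
  assumes "\<phi> \<in> test_fun"
  shows "ft (vderiv \<phi>) \<xi> = - \<i> * of_real \<xi> * ft \<phi> \<xi>"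
proof -
  obtain R where R: "\<And>x. \<phi> x \<noteq> 0 \<Longrightarrow> \<bar>x\<bar> < R" using test_fun_bounds[OF assms] by blast
  have "\<bar>x\<bar> \<le> R" if "vderiv \<phi> x \<noteq> 0" for x
    using vderiv_zero_outside[of \<phi> "-R" R x] that R by force
  then show ?thesis
    using ft_derivative[OF ac_smooth[OF test_fun_smooth[OF assms]], of R] R by blast
qed

section \<open>Local Sobolev spaces of order one and minus one\<close>

lemma dist_of_distribution:
  assumes f: "loc_int f"
  shows "dist_of f \<in> distributions"
  unfolding distributions_def
proof (intro CollectI conjI ballI allI impI)
  show "dist_of f \<in> extensional test_fun" by (simp add: dist_of_def)
  show "dist_of f (\<lambda>x. \<phi> x + \<psi> x) = dist_of f \<phi> + dist_of f \<psi>" if "\<phi> \<in> test_fun" "\<psi> \<in> test_fun" for \<phi> \<psi>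
    using that integrable_mult_test[OF f] by (simp add: dist_of_def test_fun_add distrib_left)
  show "dist_of f (\<lambda>x. c * \<phi> x) = c * dist_of f \<phi>" if "\<phi> \<in> test_fun" for c \<phi>
    using that by (simp add: dist_of_def test_fun_cmult mult.left_commute[of "f _"])
  fix K :: "real set" assume "compact K"
  from compact_imp_bounded[OF this] obtain R where R: "\<And>x. x \<in> K \<Longrightarrow> norm x \<le> R"
    unfolding bounded_iff by blast
  define C where "C = (LINT x:{-R..R}|lborel. norm (f x))"
  have i: "integrable lborel (\<lambda>x. indicator {-R..R} x *\<^sub>R norm (f x))"
    using loc_int_set[OF loc_int_norm[OF f], of "-R" R] by (simp add: set_integrable_def)
  have "norm (dist_of f \<phi>) \<le> C * (\<Sum>k\<le>0. SUP x. norm (nth_vderiv k \<phi> x))"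
    if \<phi>: "\<phi> \<in> test_fun" and supp: "{x. \<phi> x \<noteq> 0} \<subseteq> K" for \<phi>
  proof -
    define S where "S = (SUP x. norm (\<phi> x))"
    have "compact (\<phi> ` {-R..R})"
      by (intro compact_continuous_image smooth_continuous test_fun_smooth \<phi>) simp
    then obtain B where B: "\<And>x. x \<in> {-R..R} \<Longrightarrow> norm (\<phi> x) \<le> B"
      by (meson bounded_iff compact_imp_bounded image_eqI)
    have out: "\<phi> x = 0" if "x \<notin> {-R..R}" for x
      using that R[of x] supp by (auto simp: abs_le_iff)
    \<comment> \<open>\<open>B\<close> may be negative if the interval is empty.\<close>
    have "norm (\<phi> x) \<le> max B 0" for x
      using B[of x] out[of x] by (cases "x \<in> {-R..R}") auto
    then have S: "norm (\<phi> x) \<le> S" for x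
      unfolding S_def by (intro cSUP_upper bdd_aboveI2[where M = "max B 0"]) auto
    have "norm (dist_of f \<phi>) \<le> (LINT x|lborel. norm (f x * \<phi> x))"
      using \<phi> by (simp add: dist_of_def)
    also have "\<dots> \<le> (LINT x|lborel. (indicator {-R..R} x *\<^sub>R norm (f x)) * S)"
    proof (rule integral_mono[OF integrable_norm[OF integrable_mult_test[OF f \<phi>]] integrable_mult_left[OF i]])
      show "norm (f x * \<phi> x) \<le> (indicator {-R..R} x *\<^sub>R norm (f x)) * S" for x
        using S[of x] out[of x] by (cases "x \<in> {-R..R}") (auto simp: norm_mult intro!: mult_left_mono)
    qed
    also have "\<dots> = C * S" by (simp add: C_def set_lebesgue_integral_def)
    finally show ?thesis by (simp add: S_def)
  qed
  then show "\<exists>C N. \<forall>\<phi>\<in>test_fun. {x. \<phi> x \<noteq> 0} \<subseteq> K \<longrightarrow> norm (dist_of f \<phi>)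
      \<le> C * (\<Sum>k\<le>N. SUP x. norm (nth_vderiv k \<phi> x))"
    by blast
qed

lemma mult_dist_of:
  assumes "\<eta> \<in> test_fun"
  shows "mult_dist \<eta> (dist_of f) = dist_of (\<lambda>x. f x * \<eta> x)"
  unfolding mult_dist_def dist_of_def restrict_def
  by (rule ext) (simp add: test_fun_mult[OF test_fun_smooth[OF assms]] mult.assoc)

text \<open>After the cutoff, \<open>u\<close> and \<open>u'\<close> are both square integrable.
  Bessel's inequality for the two together yields the weight \<open>1 + \<xi>^2\<close>, and
  Parseval's formula shows that \<open>g\<close> is the transform in the sense of
  \<open>sobolev\<close>.\<close>

lemma ac_sobolev_loc:
  assumes y: "ac y y'" and y': "y' \<in> L2_loc"
  shows "dist_of y \<in> sobolev_loc 1"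
  unfolding sobolev_loc_def
proof (intro CollectI conjI ballI)
  have cy: "continuous_on UNIV y" by (rule ac_continuous[OF y])
  show "dist_of y \<in> distributions" by (rule dist_of_distribution[OF loc_int_continuous[OF cy]])
  fix \<eta> assume \<eta>: "\<eta> \<in> test_fun"
  have s: "smooth \<eta>" by (rule test_fun_smooth[OF \<eta>])
  obtain R where R: "\<And>x. \<eta> x \<noteq> 0 \<Longrightarrow> \<bar>x\<bar> < R" using test_fun_bounds[OF \<eta>] by blast
  have R': "\<bar>x\<bar> \<le> R" if "vderiv \<eta> x \<noteq> 0" for x
    using vderiv_zero_outside[of \<eta> "-R" R x] that R by force
  define u where "u x = y x * \<eta> x" for x
  define u' where "u' x = y x * vderiv \<eta> x + y' x * \<eta> x" for x
  have u: "ac u u'" unfolding u_def[abs_def] u'_def[abs_def] by (rule ac_mult[OF y ac_smooth[OF s]])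
  have usupp: "\<bar>x\<bar> < R" if "u x \<noteq> 0" for x using that R[of x] by (auto simp: u_def)
  have u'supp: "\<bar>x\<bar> \<le> R" if "u' x \<noteq> 0" for x
    using that R[of x] R'[of x] by (cases "\<eta> x = 0"; cases "vderiv \<eta> x = 0") (auto simp: u'_def)
  have cu: "continuous_on UNIV u" by (rule ac_continuous[OF u])
  have L2_supp: "sq_int f \<and> integrable lborel f" if "f \<in> L2_loc" "\<And>x. f x \<noteq> 0 \<Longrightarrow> \<bar>x\<bar> \<le> R" for f ::
      "real \<Rightarrow> complex"
  proof
    have "integrable lborel (\<lambda>x. (norm (f x))\<^sup>2)"
      by (rule integrable_supported[of _ "-R" R]) (use that in \<open>auto simp: L2_loc_iff abs_le_iff\<close>, force+)
    then show "sq_int f" using L2_loc_measurable[OF that(1)] by (simp add: sq_int_def)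
    show "integrable lborel f"
      by (rule integrable_supported[OF L2_loc_loc_int[OF that(1)], of "-R" R]) (use that(2) in force)
  qed
  have u2: "sq_int u" "integrable lborel u"
    using L2_supp[OF L2_loc_continuous[OF cu]] usupp by (auto simp: less_imp_le)
  have "u' \<in> L2_loc"
    unfolding u'_def[abs_def]
  proof (rule L2_loc_add)
    show "(\<lambda>x. y x * vderiv \<eta> x) \<in> L2_loc"
      by (intro L2_loc_continuous continuous_intros cy smooth_continuous smooth_vderiv s)
    show "(\<lambda>x. y' x * \<eta> x) \<in> L2_loc"
      using L2_loc_mult_continuous[OF y' smooth_continuous[OF s]] by (simp add: mult.commute)
  qed
  then have u'2: "sq_int u'" "integrable lborel u'" using L2_supp u'supp by auto
  \<comment> \<open>The reflection accounts for the opposite signs in the exponents of the Fourier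
    transform and of \<open>ft\<close>.\<close>
  define g where "g \<xi> = ft u (- \<xi>)" for \<xi>
  have [measurable]: "u \<in> borel_measurable borel" using u2 by auto
  have "mult_dist \<eta> (dist_of y) = dist_of u"
    unfolding mult_dist_of[OF \<eta>] u_def[abs_def] ..
  moreover have "dist_of u \<in> sobolev 1"
    unfolding sobolev_def
  proof (intro CollectI conjI bexI[of _ g] ballI)
    show "dist_of u \<in> distributions" by (rule dist_of_distribution[OF loc_int_continuous[OF cu]])
    show "g \<in> borel_measurable borel" unfolding g_def[abs_def] by measurable
    have "ft u' \<xi> = - \<i> * of_real \<xi> * ft u \<xi>" for \<xi>
      by (rule ft_derivative[OF u usupp u'supp])
    then have eq: "(norm (ft u' \<xi>))\<^sup>2 = \<xi>\<^sup>2 * (norm (ft u \<xi>))\<^sup>2" for \<xi>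
      by (simp add: norm_mult power_mult_distrib)
    have "integrable lborel (\<lambda>\<xi>. (norm (ft u \<xi>))\<^sup>2 + (norm (ft u' \<xi>))\<^sup>2)"
      by (intro Bochner_Integration.integrable_add sq_int_integrable bessel u2 u'2)
    from lborel_integrable_real_affine[OF this, of "-1" 0]
    show "integrable lborel (\<lambda>\<xi>. (1 + \<xi>\<^sup>2) powr 1 * (norm (g \<xi>))\<^sup>2)"
      by (simp add: eq g_def distrib_right add_nonneg_nonneg)
    fix \<phi> assume \<phi>: "\<phi> \<in> test_fun"
    have "compact (u ` {-R..R})"
      by (intro compact_continuous_image continuous_on_subset[OF cu]) auto
    then obtain B where B: "\<And>x. x \<in> {-R..R} \<Longrightarrow> norm (u x) \<le> B"
      by (meson bounded_iff compact_imp_bounded image_eqI)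
    have ub: "norm (u x) \<le> max B 0" for x
    proof (cases "u x = 0")
      case False
      then have "x \<in> {-R..R}" using usupp[of x] by auto
      then show ?thesis using B[of x] by simp
    qed simp
    have "(LINT \<xi>|lborel. g \<xi> * inv_fourier \<phi> \<xi>)
        = (LINT \<xi>|lborel. of_real (1 / (2 * pi)) * (ft \<phi> \<xi> * ft u (- \<xi>)))"
      by (simp add: g_def inv_fourier_ft mult_ac)
    also have "\<dots> = of_real (1 / (2 * pi)) * (of_real (2 * pi) * (LINT x|lborel. \<phi> x * u x))"
      unfolding integral_mult_right_zero
      by (subst parseval[OF test_fun_integrable[OF \<phi>] test_fun_sq_int[OF \<phi>] u2(2) u2(1) cu ub]) simp
    also have "\<dots> = (LINT x|lborel. u x * \<phi> x)" by (simp add: mult.commute[of "\<phi> _"])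
    finally show "dist_of u \<phi> = (LINT \<xi>|lborel. g \<xi> * inv_fourier \<phi> \<xi>)"
      using \<phi> by (simp add: dist_of_def)
  qed
  ultimately show "mult_dist \<eta> (dist_of y) \<in> sobolev 1" by simp
qed

section \<open>From the Fourier definition to estimates and functions\<close>

lemma L2_sq_cmult: "L2_sq (\<lambda>x. c * f x) = (norm c)\<^sup>2 * L2_sq f" for f :: "real \<Rightarrow> complex"
  by (simp add: L2_sq_def norm_mult power_mult_distrib)

lemma sq_int_cmult: "sq_int f \<Longrightarrow> sq_int (\<lambda>x. c * f x)" for f :: "real \<Rightarrow> complex"
  by (auto simp: sq_int_def norm_mult power_mult_distrib)

lemma inv_fourier_bessel:
  assumes "\<phi> \<in> test_fun"
  shows "sq_int (inv_fourier \<phi>)" "L2_sq (inv_fourier \<phi>) \<le> L2_sq \<phi>"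
proof -
  note b = bessel[OF test_fun_integrable[OF assms] test_fun_sq_int[OF assms]]
  have eq: "inv_fourier \<phi> = (\<lambda>\<xi>. of_real (1 / (2 * pi)) * ft \<phi> \<xi>)" by (rule ext) (rule inv_fourier_ft)
  show "sq_int (inv_fourier \<phi>)" unfolding eq by (rule sq_int_cmult[OF b(1)])
  have "L2_sq (inv_fourier \<phi>) = (1 / (2 * pi))\<^sup>2 * L2_sq (ft \<phi>)"
    unfolding eq L2_sq_cmult by (simp add: norm_divide norm_mult)
  also have "\<dots> \<le> (1 / (2 * pi))\<^sup>2 * (2 * pi * L2_sq \<phi>)" by (intro mult_left_mono b) simp
  also have "\<dots> = (1 / (2 * pi)) * L2_sq \<phi>" by (simp add: power2_eq_square field_simps)
  also have "\<dots> \<le> 1 * L2_sq \<phi>" using pi_gt3 by (intro mult_right_mono L2_sq_nonneg) simp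
  finally show "L2_sq (inv_fourier \<phi>) \<le> L2_sq \<phi>" by simp
qed

lemma inv_fourier_vderiv:
  "\<phi> \<in> test_fun \<Longrightarrow> inv_fourier (vderiv \<phi>) \<xi> = - \<i> * of_real \<xi> * inv_fourier \<phi> \<xi>"
  by (simp add: inv_fourier_ft ft_test_derivative)

text \<open>The factor \<open>\<xi>\<close> produced by the derivative is moved from the test
  function to \<open>g\<close>, where the weight \<open>1 + \<xi>^2\<close> absorbs it;
  Cauchy-Schwarz bounds the remaining pairing.\<close>

lemma sobolev_1_bound:
  assumes "u \<in> sobolev 1"
  obtains C where "\<And>\<phi>. \<phi> \<in> test_fun \<Longrightarrow> norm (u (vderiv \<phi>)) \<le> C * sqrt (L2_sq \<phi>)"
proof -
  obtain g where [measurable]: "g \<in> borel_measurable borel"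
    and g: "integrable lborel (\<lambda>\<xi>. (1 + \<xi>\<^sup>2) powr 1 * (norm (g \<xi>))\<^sup>2)"
    and eq: "\<And>\<phi>. \<phi> \<in> test_fun \<Longrightarrow> u \<phi> = (LINT \<xi>|lborel. g \<xi> * inv_fourier \<phi> \<xi>)"
    using assms by (auto simp: sobolev_def)
  define h where "h \<xi> = - \<i> * of_real \<xi> * g \<xi>" for \<xi>
  have h: "sq_int h"
    unfolding sq_int_def
  proof
    show "integrable lborel (\<lambda>\<xi>. (norm (h \<xi>))\<^sup>2)"
    proof (rule Bochner_Integration.integrable_bound[OF g])
      show "AE \<xi> in lborel. norm ((norm (h \<xi>))\<^sup>2) \<le> norm ((1 + \<xi>\<^sup>2) powr 1 * (norm (g \<xi>))\<^sup>2)"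
        by (intro AE_I2) (simp add: h_def norm_mult power_mult_distrib mult_right_mono add_nonneg_nonneg
            abs_mult)
    qed (simp add: h_def[abs_def])
  qed (simp add: h_def[abs_def])
  have "norm (u (vderiv \<phi>)) \<le> sqrt (L2_sq h) * sqrt (L2_sq \<phi>)" if \<phi>: "\<phi> \<in> test_fun" for \<phi>
  proof -
    have "u (vderiv \<phi>) = (LINT \<xi>|lborel. h \<xi> * inv_fourier \<phi> \<xi>)"
      unfolding eq[OF test_fun_vderiv[OF \<phi>]] inv_fourier_vderiv[OF \<phi>] h_def by (simp add: mult_ac)
    also have "norm \<dots> \<le> sqrt (L2_sq h) * sqrt (L2_sq (inv_fourier \<phi>))"
      by (rule sq_int_mult(2)[OF h inv_fourier_bessel(1)[OF \<phi>]])
    also have "\<dots> \<le> sqrt (L2_sq h) * sqrt (L2_sq \<phi>)"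
      by (intro mult_left_mono real_sqrt_le_mono inv_fourier_bessel \<phi>) (simp add: L2_sq_nonneg)
    finally show ?thesis .
  qed
  then show thesis by (rule that)
qed

text \<open>Here the weight moves the other way: \<open>g\<close> divided by
  \<open>sqrt (1 + \<xi>^2)\<close> is square integrable, and the factor put on the test function
  costs one derivative.\<close>

lemma sobolev_minus1_bound:
  assumes "u \<in> sobolev (-1)"
  obtains C where "\<And>\<phi>. \<phi> \<in> test_fun \<Longrightarrow> norm (u \<phi>) \<le> C * sqrt (L2_sq \<phi> + L2_sq (vderiv \<phi>))"
proof -
  obtain g where [measurable]: "g \<in> borel_measurable borel"
    and g: "integrable lborel (\<lambda>\<xi>. (1 + \<xi>\<^sup>2) powr (-1) * (norm (g \<xi>))\<^sup>2)"
    and eq: "\<And>\<phi>. \<phi> \<in> test_fun \<Longrightarrow> u \<phi> = (LINT \<xi>|lborel. g \<xi> * inv_fourier \<phi> \<xi>)"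
    using assms by (auto simp: sobolev_def)
  define r where "r \<xi> = sqrt (1 + \<xi>\<^sup>2)" for \<xi> :: real
  have r: "r \<xi> > 0" "(r \<xi>)\<^sup>2 = 1 + \<xi>\<^sup>2" for \<xi> by (auto simp: r_def add_pos_nonneg)
  have [measurable]: "r \<in> borel_measurable borel" by (simp add: r_def[abs_def])
  define h where "h \<xi> = g \<xi> / of_real (r \<xi>)" for \<xi>
  have h: "sq_int h"
    unfolding sq_int_def
  proof
    have "(1 + \<xi>\<^sup>2) powr (-1) * (norm (g \<xi>))\<^sup>2 = (norm (h \<xi>))\<^sup>2" for \<xi>
      using r(1)[of \<xi>] by (simp add: h_def norm_divide power_divide r(2) powr_minus add_nonneg_nonneg)
          (simp add: divide_inverse mult.commute)
    then show "integrable lborel (\<lambda>\<xi>. (norm (h \<xi>))\<^sup>2)" using g by simp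
  qed (simp add: h_def[abs_def])
  have "norm (u \<phi>) \<le> sqrt (L2_sq h) * sqrt (L2_sq \<phi> + L2_sq (vderiv \<phi>))" if \<phi>: "\<phi> \<in> test_fun" for \<phi>
  proof -
    define k where "k \<xi> = of_real (r \<xi>) * inv_fourier \<phi> \<xi>" for \<xi>
    note b = inv_fourier_bessel[OF \<phi>] inv_fourier_bessel[OF test_fun_vderiv[OF \<phi>]]
    have [measurable]: "inv_fourier \<phi> \<in> borel_measurable borel" by (rule sq_int_measurable[OF b(1)])
    have nk: "(norm (k \<xi>))\<^sup>2 = (norm (inv_fourier \<phi> \<xi>))\<^sup>2 + (norm (inv_fourier (vderiv \<phi>) \<xi>))\<^sup>2" for \<xi>
      by (simp add: k_def inv_fourier_vderiv[OF \<phi>] norm_mult power_mult_distrib r(2) algebra_simps)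
    have k: "sq_int k"
      unfolding sq_int_def nk
      using b by (auto intro!: Bochner_Integration.integrable_add sq_int_integrable simp: k_def[abs_def])
    have "L2_sq k = L2_sq (inv_fourier \<phi>) + L2_sq (inv_fourier (vderiv \<phi>))"
      unfolding L2_sq_def nk by (intro Bochner_Integration.integral_add sq_int_integrable b)
    also have "\<dots> \<le> L2_sq \<phi> + L2_sq (vderiv \<phi>)" by (intro add_mono b)
    finally have Lk: "L2_sq k \<le> L2_sq \<phi> + L2_sq (vderiv \<phi>)" .
    have "g \<xi> * inv_fourier \<phi> \<xi> = h \<xi> * k \<xi>" for \<xi>
      using r(1)[of \<xi>] by (simp add: h_def k_def)
    then have "u \<phi> = (LINT \<xi>|lborel. h \<xi> * k \<xi>)" using eq[OF \<phi>] by simp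
    also have "norm \<dots> \<le> sqrt (L2_sq h) * sqrt (L2_sq k)" by (rule sq_int_mult(2)[OF h k])
    also have "\<dots> \<le> sqrt (L2_sq h) * sqrt (L2_sq \<phi> + L2_sq (vderiv \<phi>))"
      by (intro mult_left_mono real_sqrt_le_mono Lk) (simp add: L2_sq_nonneg)
    finally show ?thesis .
  qed
  then show thesis by (rule that)
qed

lemma continuous_AE_eq:
  fixes f g :: "real \<Rightarrow> 'a::real_normed_vector"
  assumes "continuous_on UNIV f" "continuous_on UNIV g" "AE x in lborel. f x = g x"
  shows "f = g"
proof (rule ext, rule ccontr)
  fix x assume x: "f x \<noteq> g x"
  define U where "U = {x. f x \<noteq> g x}"
  have "open U" unfolding U_def using assms by (intro open_Collect_neq)
  moreover have "x \<in> U" using x by (simp add: U_def)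
  ultimately obtain e where e: "e > 0" "ball x e \<subseteq> U" using openE by blast
  have "AE t in lborel. t \<notin> ball x e"
    using assms(3) by eventually_elim (use e(2) in \<open>auto simp: U_def\<close>)
  then have "ball x e \<in> null_sets lborel" using AE_iff_null_sets[of "ball x e" lborel] by simp
  then have "emeasure lborel {x - e<..<x + e} = 0" by (simp add: ball_eq_greaterThanLessThan null_sets_def)
  then show False using e(1) by simp
qed

text \<open>Multiplying a distribution by \<open>\<eta>\<close> does not change its values on these
  test functions and their derivatives, so bounds for \<open>sobolev\<close> carry over to
  \<open>sobolev_loc\<close> on every interval.\<close>

lemma test_on_cutoff:
  assumes "R > 0"
  obtains \<eta> where "\<eta> \<in> test_fun" "\<And>\<phi>. \<phi> \<in> test_on (-R) R \<Longrightarrow> (\<lambda>x. \<eta> x * \<phi> x) = \<phi>"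
    "\<And>\<phi>. \<phi> \<in> test_on (-R) R \<Longrightarrow> (\<lambda>x. \<eta> x * vderiv \<phi> x) = vderiv \<phi>"
proof -
  obtain h :: "real \<Rightarrow> real" where h: "(\<lambda>x. of_real (h x)) \<in> test_fun" "\<And>x. -R \<le> x \<Longrightarrow> x \<le> R \<Longrightarrow> h x = 1"
    by (rule cutoff_exists[of 1 "-R" R]) (use assms in auto)
  show thesis
  proof (rule that[OF h(1)])
    fix \<phi> assume \<phi>: "\<phi> \<in> test_on (-R) R"
    then have supp: "-R \<le> x \<and> x \<le> R" if "\<phi> x \<noteq> 0" for x using that by (force simp: test_on_def)
    show "(\<lambda>x. of_real (h x) * \<phi> x) = \<phi>" using h(2) supp by fastforce
    have "of_real (h x) * vderiv \<phi> x = vderiv \<phi> x" for x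
      using h(2)[of x] vderiv_zero_outside[of \<phi> "-R" R x] supp by (cases "vderiv \<phi> x = 0") auto
    then show "(\<lambda>x. of_real (h x) * vderiv \<phi> x) = vderiv \<phi>" by auto
  qed
qed

text \<open>By \<open>sobolev_1_bound\<close> the distributional derivative of \<open>y\<close> is
  bounded in the \<open>L^2\<close> norm on each interval, hence given by a function
  \<open>g\<close>. Continuity of \<open>y\<close> upgrades its almost everywhere equality with a
  primitive of \<open>g\<close> to equality.\<close>

lemma sobolev_loc_1_ac:
  assumes cy: "continuous_on UNIV y" and y: "dist_of y \<in> sobolev_loc 1"
  obtains y' where "y' \<in> L2_loc" "ac y y'"
proof -
  have ly: "loc_int y" by (rule loc_int_continuous[OF cy])
  obtain g where g: "g \<in> L2_loc" "\<And>\<phi>. \<phi> \<in> test_fun \<Longrightarrow> - (LINT x|lborel. y x * vderiv \<phi> x)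
      = (LINT x|lborel. g x * \<phi> x)"
  proof (rule L2_loc_representation[of "\<lambda>\<phi>. - (LINT x|lborel. y x * vderiv \<phi> x)"])
    fix \<phi> \<psi> c assume \<phi>: "\<phi> \<in> test_fun"
    show "- (LINT x|lborel. y x * vderiv (\<lambda>x. c * \<phi> x) x) = c * - (LINT x|lborel. y x * vderiv \<phi> x)"
      using \<phi> by (simp add: vderiv_smooth_cmult test_fun_smooth mult.left_commute[of "y _"])
    assume \<psi>: "\<psi> \<in> test_fun"
    show "- (LINT x|lborel. y x * vderiv (\<lambda>x. \<phi> x + \<psi> x) x)
        = - (LINT x|lborel. y x * vderiv \<phi> x) + - (LINT x|lborel. y x * vderiv \<psi> x)"
      using \<phi> \<psi> integrable_mult_test[OF ly] by (simp add: vderiv_smooth_add test_fun_smooth test_fun_vderiv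
          distrib_left)
  next
    fix R :: real assume "R > 0"
    then obtain \<eta> where \<eta>: "\<eta> \<in> test_fun" "\<And>\<phi>. \<phi> \<in> test_on (-R) R \<Longrightarrow> (\<lambda>x. \<eta> x * vderiv \<phi> x) = vderiv \<phi>"
      using test_on_cutoff by metis
    have "mult_dist \<eta> (dist_of y) \<in> sobolev 1" using y \<eta>(1) by (simp add: sobolev_loc_def)
    then obtain C where C: "\<And>\<phi>. \<phi> \<in> test_fun \<Longrightarrow> norm (mult_dist \<eta> (dist_of y) (vderiv \<phi>)) \<le> C * sqrt (L2_sq \<phi>)"
      using sobolev_1_bound by blast
    have "norm (- (LINT x|lborel. y x * vderiv \<phi> x)) \<le> C * sqrt (L2_sq \<phi>)" if \<phi>: "\<phi> \<in> test_on (-R) R" for \<phi>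
    proof -
      have v: "vderiv \<phi> \<in> test_fun" by (rule test_fun_vderiv[OF test_on_test_fun[OF \<phi>]])
      then have "mult_dist \<eta> (dist_of y) (vderiv \<phi>) = dist_of y (vderiv \<phi>)"
        by (simp only: mult_dist_def restrict_apply' \<eta>(2)[OF \<phi>])
      then show ?thesis using C[OF test_on_test_fun[OF \<phi>]] v by (simp add: dist_of_def)
    qed
    then show "\<exists>C. \<forall>\<phi>\<in>test_on (-R) R. norm (- (LINT x|lborel. y x * vderiv \<phi> x)) \<le> C * sqrt (L2_sq \<phi>)"
        by blast
  qed blast
  obtain F where F: "ac F g" "AE x in lborel. y x = F x"
  proof (rule weak_derivative_ac[OF ly L2_loc_loc_int[OF g(1)]])
    fix \<phi> assume "\<phi> \<in> test_fun"
    then show "(LINT x|lborel. y x * vderiv \<phi> x) = - (LINT x|lborel. g x * \<phi> x)" using g(2)[of \<phi>]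
        by (metis minus_minus)
  qed blast
  have "y = F" by (rule continuous_AE_eq[OF cy ac_continuous[OF F(1)] F(2)])
  then show thesis using that g(1) F(1) by blast
qed

text \<open>Cauchy-Schwarz against the indicator of \<open>{a..x}\<close>. The estimate is the
  source of Poincare's inequality, and it makes functions converge uniformly on an interval when
  their derivatives converge in mean square.\<close>

lemma ac_sup_bound:
  assumes F: "ac F f" and f: "sq_int f" and a: "F a = 0" and x: "a \<le> x" "x \<le> b"
  shows "(norm (F x))\<^sup>2 \<le> (b - a) * L2_sq f"
proof -
  define I :: "real \<Rightarrow> real" where "I t = indicator {a..x} t" for t
  have nI: "(norm (I t))\<^sup>2 = I t" for t by (simp add: I_def indicator_def)
  have "integrable lborel I"
    using borel_integrable_atLeastAtMost'[of a x "\<lambda>_. 1 :: real"]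
        by (simp add: set_integrable_def I_def[abs_def])
  then have I: "sq_int I" by (auto simp: sq_int_def nI simp del: real_norm_def)
  have LI: "L2_sq I = x - a" unfolding L2_sq_def nI using x by (simp add: I_def)
  have "F x = (LINT t|lborel. indicator {a..x} t *\<^sub>R f t)"
    using ac_LINT[OF F x(1)] a by (simp add: set_lebesgue_integral_def)
  also have "norm \<dots> \<le> (LINT t|lborel. norm (indicator {a..x} t *\<^sub>R f t))" by (rule integral_norm_bound)
  also have "\<dots> = (LINT t|lborel. norm (I t) * norm (f t))" by (simp add: I_def)
  also have "\<dots> \<le> sqrt (L2_sq I) * sqrt (L2_sq f)" by (rule Cauchy_Schwarz_L2[OF I f])
  finally have "(norm (F x))\<^sup>2 \<le> (sqrt (L2_sq I) * sqrt (L2_sq f))\<^sup>2" by (intro power_mono) auto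
  also have "\<dots> = (x - a) * L2_sq f" using x by (simp add: power_mult_distrib LI L2_sq_nonneg)
  also have "\<dots> \<le> (b - a) * L2_sq f" using x by (intro mult_right_mono L2_sq_nonneg) simp
  finally show ?thesis .
qed

lemma L2_sq_le_sup:
  fixes f :: "real \<Rightarrow> 'a::{real_normed_vector, second_countable_topology}"
  assumes f: "sq_int f" and supp: "\<And>x. f x \<noteq> 0 \<Longrightarrow> a \<le> x \<and> x \<le> b"
    and B: "\<And>x. a \<le> x \<Longrightarrow> x \<le> b \<Longrightarrow> (norm (f x))\<^sup>2 \<le> B" and ab: "a \<le> b"
  shows "L2_sq f \<le> (b - a) * B"
proof -
  have "integrable lborel (\<lambda>x. indicator {a..b} x *\<^sub>R B)"
    using borel_integrable_atLeastAtMost'[of a b "\<lambda>_. B"] by (simp add: set_integrable_def)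
  then have "L2_sq f \<le> (LINT x|lborel. indicator {a..b} x *\<^sub>R B)"
    unfolding L2_sq_def
  proof (rule integral_mono[OF sq_int_integrable[OF f]])
    show "(norm (f x))\<^sup>2 \<le> indicator {a..b} x *\<^sub>R B" for x
      using B[of x] supp[of x] by (cases "f x = 0"; cases "x \<in> {a..b}") auto
  qed
  also have "\<dots> = (b - a) * B" using ab by simp
  finally show ?thesis .
qed

lemma test_fun_vderiv_inj:
  assumes \<phi>: "\<phi> \<in> test_fun" and \<psi>: "\<psi> \<in> test_fun" and eq: "vderiv \<phi> = vderiv \<psi>"
  shows "\<phi> = \<psi>"
proof
  fix x
  define \<rho> where "\<rho> x = \<phi> x - \<psi> x" for x
  have \<rho>: "\<rho> \<in> test_fun" unfolding \<rho>_def[abs_def] by (rule test_fun_diff[OF \<phi> \<psi>])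
  obtain R where R: "\<And>x. \<rho> x \<noteq> 0 \<Longrightarrow> \<bar>x\<bar> < R" using test_fun_bounds[OF \<rho>] by blast
  have "ac \<rho> (\<lambda>x. vderiv \<phi> x - vderiv \<psi> x)"
    unfolding \<rho>_def[abs_def] by (intro ac_diff ac_smooth test_fun_smooth \<phi> \<psi>)
  then have "ac \<rho> (\<lambda>x. 0)" by (simp add: eq)
  then have "\<rho> x = \<rho> \<bar>R\<bar>" by (rule ac_zero_const)
  also have "\<rho> \<bar>R\<bar> = 0" using R[of "\<bar>R\<bar>"] by force
  finally show "\<phi> x = \<psi> x" by (simp add: \<rho>_def)
qed

lemma distributionsD:
  assumes "T \<in> distributions"
  shows "T \<in> extensional test_fun"
    "\<phi> \<in> test_fun \<Longrightarrow> \<psi> \<in> test_fun \<Longrightarrow> T (\<lambda>x. \<phi> x + \<psi> x) = T \<phi> + T \<psi>"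
    "\<phi> \<in> test_fun \<Longrightarrow> T (\<lambda>x. c * \<phi> x) = c * T \<phi>"
  using assms by (auto simp: distributions_def)

lemma test_fun_Poincare:
  assumes \<phi>: "\<phi> \<in> test_fun" and supp: "\<And>x. \<phi> x \<noteq> 0 \<Longrightarrow> -R < x \<and> x < R" and R: "R > 0"
  shows "L2_sq \<phi> \<le> (2 * R)\<^sup>2 * L2_sq (vderiv \<phi>)"
proof -
  have "L2_sq \<phi> \<le> (R - -R) * ((R - -R) * L2_sq (vderiv \<phi>))"
  proof (rule L2_sq_le_sup[OF test_fun_sq_int[OF \<phi>]])
    show "-R \<le> x \<and> x \<le> R" if "\<phi> x \<noteq> 0" for x using supp[OF that] by simp
    show "(norm (\<phi> x))\<^sup>2 \<le> (R - -R) * L2_sq (vderiv \<phi>)" if "-R \<le> x" "x \<le> R" for x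
    proof (rule ac_sup_bound[OF ac_smooth[OF test_fun_smooth[OF \<phi>]] test_fun_sq_int[OF test_fun_vderiv[OF \<phi>]]
        _ that])
      show "\<phi> (-R) = 0" using supp[of "-R"] by auto
    qed
  qed (use R in simp)
  then show ?thesis by (simp add: power2_eq_square)
qed

text \<open>A functional controlled by the \<open>L\<^sup>2\<close> norm of the derivative factors through differentiation,
  and the resulting functional on derivatives is represented by an \<open>L\<^sup>2\<close> function; subtracting a
  multiple of a fixed test function of mass one makes every test function a derivative.\<close>

lemma sobolev_loc_minus1_primitive:
  assumes q: "q \<in> sobolev_loc (-1)"
  obtains Q where "Q \<in> L2_loc" "\<And>\<phi>. \<phi> \<in> test_fun \<Longrightarrow> q \<phi> = - (LINT x|lborel. Q x * vderiv \<phi> x)"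
proof -
  have qd: "q \<in> distributions" using q by (simp add: sobolev_loc_def)
  note lin = distributionsD(2,3)[OF qd]
  obtain \<eta> where \<eta>: "\<eta> \<in> test_fun" "integral\<^sup>L lborel \<eta> = 1" "\<And>x. \<eta> x \<noteq> 0 \<Longrightarrow> -1 < x \<and> x < (1::real)"
    "\<And>x. \<eta> x \<in> \<real>"
    by (rule unit_mass_test_fun) blast
  \<comment> \<open>The compactly supported primitive of the mean-free part of
    \<open>\<phi>\<close>. Compact support makes it unique, so that the choice is linear in
    \<open>\<phi>\<close>.\<close>
  define P where "P \<phi> = (SOME \<psi>. \<psi> \<in> test_fun \<and> vderiv \<psi> = (\<lambda>x. \<phi> x - integral\<^sup>L lborel \<phi> * \<eta> x))" for \<phi>
  have t: "(\<lambda>x. \<phi> x - integral\<^sup>L lborel \<phi> * \<eta> x) \<in> test_fun" if "\<phi> \<in> test_fun" for \<phi>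
    by (intro test_fun_diff test_fun_cmult that \<eta>)
  \<comment> \<open>\<open>R \<ge> 1\<close> lets the interval contain the support of
    \<open>\<eta>\<close>.\<close>
  have ex: "\<exists>\<psi>. \<psi> \<in> test_fun \<and> vderiv \<psi> = (\<lambda>x. \<phi> x - integral\<^sup>L lborel \<phi> * \<eta> x) \<and> (\<forall>x. \<psi> x \<noteq> 0 \<longrightarrow> -R \<le> x \<and> x
      \<le> R)"
    if \<phi>: "\<phi> \<in> test_fun" and R: "R \<ge> 1" "\<And>x. \<phi> x \<noteq> 0 \<Longrightarrow> \<bar>x\<bar> \<le> R" for \<phi> R
  proof -
    have 0: "(LINT x|lborel. \<phi> x - integral\<^sup>L lborel \<phi> * \<eta> x) = 0"
      using test_fun_integrable[OF \<phi>] test_fun_integrable[OF \<eta>(1)] \<eta>(2) by simp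
    have supp: "-R \<le> x \<and> x \<le> R" if "\<phi> x - integral\<^sup>L lborel \<phi> * \<eta> x \<noteq> 0" for x
      using that R(2)[of x] \<eta>(3)[of x] R(1) by (cases "\<phi> x = 0"; cases "\<eta> x = 0") auto
    obtain \<psi> where "\<psi> \<in> test_fun" "vderiv \<psi> = (\<lambda>x. \<phi> x - integral\<^sup>L lborel \<phi> * \<eta> x)"
        "\<And>x. \<psi> x \<noteq> 0 \<Longrightarrow> -R \<le> x \<and> x \<le> R"
      by (rule test_fun_primitive[OF t[OF \<phi>] 0, of "-R" R]) (use supp in blast)+
    then show ?thesis by blast
  qed
  have P: "P \<phi> \<in> test_fun" "vderiv (P \<phi>) = (\<lambda>x. \<phi> x - integral\<^sup>L lborel \<phi> * \<eta> x)" if \<phi>: "\<phi> \<in> test_fun" for \<phi>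
  proof -
    obtain R where R: "\<And>x. \<phi> x \<noteq> 0 \<Longrightarrow> \<bar>x\<bar> < R" using test_fun_bounds[OF \<phi>] by blast
    have "\<exists>\<psi>. \<psi> \<in> test_fun \<and> vderiv \<psi> = (\<lambda>x. \<phi> x - integral\<^sup>L lborel \<phi> * \<eta> x)"
    proof -
      have "\<bar>x\<bar> \<le> max R 1" if "\<phi> x \<noteq> 0" for x using R[OF that] by simp
      then show ?thesis using ex[OF \<phi>, of "max R 1"] by auto
    qed
    from someI_ex[OF this] show "P \<phi> \<in> test_fun" "vderiv (P \<phi>) = (\<lambda>x. \<phi> x - integral\<^sup>L lborel \<phi> * \<eta> x)"
      unfolding P_def by blast+
  qed
  have P_unique: "P \<phi> = \<psi>" if "\<phi> \<in> test_fun" "\<psi> \<in> test_fun" "vderiv \<psi> = (\<lambda>x. \<phi> x - integral\<^sup>L lborel \<phi> * \<eta> x)"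
      for \<phi> \<psi>
    by (rule test_fun_vderiv_inj) (use that P in auto)
  have P_add: "P (\<lambda>x. \<phi> x + \<psi> x) = (\<lambda>x. P \<phi> x + P \<psi> x)" if "\<phi> \<in> test_fun" "\<psi> \<in> test_fun" for \<phi> \<psi>
  proof (rule P_unique)
    show "vderiv (\<lambda>x. P \<phi> x + P \<psi> x) = (\<lambda>x. \<phi> x + \<psi> x - (LINT x|lborel. \<phi> x + \<psi> x) * \<eta> x)"
      using that P by (simp add: vderiv_smooth_add test_fun_smooth test_fun_integrable algebra_simps)
  qed (use that P in \<open>auto intro: test_fun_add\<close>)
  have P_cmult: "P (\<lambda>x. c * \<phi> x) = (\<lambda>x. c * P \<phi> x)" if "\<phi> \<in> test_fun" for \<phi> c
  proof (rule P_unique)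
    show "vderiv (\<lambda>x. c * P \<phi> x) = (\<lambda>x. c * \<phi> x - (LINT x|lborel. c * \<phi> x) * \<eta> x)"
      using that P by (simp add: vderiv_smooth_cmult test_fun_smooth algebra_simps)
  qed (use that P in \<open>auto intro: test_fun_cmult\<close>)
  obtain S where S: "S \<in> L2_loc" "\<And>\<phi>. \<phi> \<in> test_fun \<Longrightarrow> q (P \<phi>) = (LINT x|lborel. S x * \<phi> x)"
  proof (rule L2_loc_representation[of "\<lambda>\<phi>. q (P \<phi>)"])
    show "q (P (\<lambda>x. \<phi> x + \<psi> x)) = q (P \<phi>) + q (P \<psi>)" if "\<phi> \<in> test_fun" "\<psi> \<in> test_fun" for \<phi> \<psi>
      using that by (simp add: P_add lin P)
    show "q (P (\<lambda>x. c * \<phi> x)) = c * q (P \<phi>)" if "\<phi> \<in> test_fun" for \<phi> c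
      using that by (simp add: P_cmult lin P)
    fix R :: real assume R: "R > 0"
    \<comment> \<open>\<open>max R 1\<close> bounds the supports of \<open>\<phi>\<close> and
      \<open>\<eta>\<close>, hence that of \<open>P \<phi>\<close>; the additional 1 leads from a
      closed interval to an open one.\<close>
    define R' where "R' = max R 1 + 1"
    have R': "R' > 0" "R' \<ge> 1" "R < R'" by (auto simp: R'_def)
    obtain \<kappa> where \<kappa>: "\<kappa> \<in> test_fun" "\<And>\<phi>. \<phi> \<in> test_on (-R') R' \<Longrightarrow> (\<lambda>x. \<kappa> x * \<phi> x) = \<phi>"
      using test_on_cutoff[OF R'(1)] by metis
    have "mult_dist \<kappa> q \<in> sobolev (-1)" using q \<kappa>(1) by (simp add: sobolev_loc_def)
    then obtain C where C: "\<And>\<phi>. \<phi> \<in> test_fun \<Longrightarrow> norm (mult_dist \<kappa> q \<phi>) \<le> C * sqrt (L2_sq \<phi> + L2_sq (vderiv \<phi>))"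
      by (rule sobolev_minus1_bound) fast
    \<comment> \<open>The first factor comes from Poincare's inequality. The second bounds the
      mean-free part of \<open>\<phi>\<close>, the squared mean being at most
      \<open>2 * R * L2_sq \<phi>\<close>.\<close>
    define D where "D = ((2 * R')\<^sup>2 + 1) * (2 + 2 * (2 * R * L2_sq \<eta>))"
    have "norm (q (P \<phi>)) \<le> (\<bar>C\<bar> * sqrt D) * sqrt (L2_sq \<phi>)" if \<phi>: "\<phi> \<in> test_on (-R) R" for \<phi>
    proof -
      have \<phi>t: "\<phi> \<in> test_fun" by (rule test_on_test_fun[OF \<phi>])
      have \<phi>s: "\<bar>x\<bar> < R" if "\<phi> x \<noteq> 0" for x using \<phi> that by (force simp: test_on_def)
      define m where "m = integral\<^sup>L lborel \<phi>"
      obtain \<psi> where "\<psi> \<in> test_fun" "vderiv \<psi> = (\<lambda>x. \<phi> x - m * \<eta> x)" and \<psi>s: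
          "\<And>x. \<psi> x \<noteq> 0 \<Longrightarrow> - max R 1 \<le> x \<and> x \<le> max R 1"
      proof -
        have "\<bar>x\<bar> \<le> max R 1" if "\<phi> x \<noteq> 0" for x using \<phi>s[OF that] by simp
        then show thesis using that ex[OF \<phi>t, of "max R 1"] unfolding m_def by auto
      qed
      then have "P \<phi> = \<psi>" using P_unique[OF \<phi>t] by (simp add: m_def)
      have Ps: "-R' < x \<and> x < R'" if "P \<phi> x \<noteq> 0" for x
        using that \<psi>s[of x] unfolding \<open>P \<phi> = \<psi>\<close> R'_def by auto
      have Pon: "P \<phi> \<in> test_on (-R') R'" using P(1)[OF \<phi>t] Ps by (simp add: test_on_def)
      have "q (P \<phi>) = mult_dist \<kappa> q (P \<phi>)"
        using P(1)[OF \<phi>t] by (simp only: mult_dist_def restrict_apply' \<kappa>(2)[OF Pon])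
      then have 1: "norm (q (P \<phi>)) \<le> C * sqrt (L2_sq (P \<phi>) + L2_sq (vderiv (P \<phi>)))"
        using C[OF P(1)[OF \<phi>t]] by simp
      \<comment> \<open>The mean of \<open>\<phi>\<close> is the value at \<open>R\<close> of the
        primitive that vanishes at \<open>- R\<close>, which \<open>ac_sup_bound\<close>
        controls.\<close>
      obtain F where F: "ac F \<phi>" "F (-R) = 0"
      proof -
        obtain F where "ac F \<phi>" using ac_exists[OF loc_int_continuous[OF smooth_continuous[OF
            test_fun_smooth[OF \<phi>t]]]] by blast
        then show thesis using that[of "\<lambda>x. F x + (- F (-R))"] ac_add[OF _ ac_const[of "- F (-R)"], of F \<phi>]
            by simp
      qed
      have "m = (LINT x:{-R..R}|lborel. \<phi> x)"
        unfolding m_def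
        by (rule integrable_supported(2)[OF loc_int_continuous[OF smooth_continuous[OF test_fun_smooth[OF
            \<phi>t]]]])
          (use \<phi>s in force)
      then have "m = F R" using ac_LINT[OF F(1), of "-R" R] F(2) R by simp
      then have m: "(norm m)\<^sup>2 \<le> 2 * R * L2_sq \<phi>"
        using ac_sup_bound[OF F(1) test_fun_sq_int[OF \<phi>t] F(2), of R R] R by simp
      have "L2_sq (vderiv (P \<phi>)) = L2_sq (\<lambda>x. \<phi> x + (- m) * \<eta> x)" by (simp add: P(2)[OF \<phi>t] m_def)
      also have "\<dots> \<le> 2 * L2_sq \<phi> + 2 * L2_sq (\<lambda>x. (- m) * \<eta> x)"
        by (intro sq_int_add(2) sq_int_cmult test_fun_sq_int \<phi>t \<eta>)
      also have "L2_sq (\<lambda>x. (- m) * \<eta> x) \<le> 2 * R * L2_sq \<phi> * L2_sq \<eta>"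
        unfolding L2_sq_cmult using m by (intro mult_right_mono L2_sq_nonneg) simp
      finally have V: "L2_sq (vderiv (P \<phi>)) \<le> (2 + 2 * (2 * R * L2_sq \<eta>)) * L2_sq \<phi>"
          by (simp add: algebra_simps)
      have "L2_sq (P \<phi>) + L2_sq (vderiv (P \<phi>)) \<le> ((2 * R')\<^sup>2 + 1) * L2_sq (vderiv (P \<phi>))"
        using test_fun_Poincare[OF P(1)[OF \<phi>t] Ps R'(1)] by (simp add: algebra_simps)
      also have "\<dots> \<le> ((2 * R')\<^sup>2 + 1) * ((2 + 2 * (2 * R * L2_sq \<eta>)) * L2_sq \<phi>)"
        by (intro mult_left_mono V) simp
      also have "\<dots> = D * L2_sq \<phi>" by (simp add: D_def)
      finally have "sqrt (L2_sq (P \<phi>) + L2_sq (vderiv (P \<phi>))) \<le> sqrt (D * L2_sq \<phi>)"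
        by (rule real_sqrt_le_mono)
      then have "sqrt (L2_sq (P \<phi>) + L2_sq (vderiv (P \<phi>))) \<le> sqrt D * sqrt (L2_sq \<phi>)"
        by (simp only: real_sqrt_mult)
      then have "\<bar>C\<bar> * sqrt (L2_sq (P \<phi>) + L2_sq (vderiv (P \<phi>))) \<le> \<bar>C\<bar> * (sqrt D * sqrt (L2_sq \<phi>))"
        by (rule mult_left_mono) simp
      moreover have "C * sqrt (L2_sq (P \<phi>) + L2_sq (vderiv (P \<phi>)))
          \<le> \<bar>C\<bar> * sqrt (L2_sq (P \<phi>) + L2_sq (vderiv (P \<phi>)))"
        by (rule mult_right_mono) (auto simp: L2_sq_nonneg)
      ultimately show ?thesis using 1 by simp
    qed
    then show "\<exists>C. \<forall>\<phi>\<in>test_on (-R) R. norm (q (P \<phi>)) \<le> C * sqrt (L2_sq \<phi>)" by blast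
  qed blast
  show thesis
  proof (rule that)
    show "(\<lambda>x. (-1) * S x) \<in> L2_loc" by (rule L2_loc_mult_continuous[OF S(1)]) simp
    fix \<phi> assume \<phi>: "\<phi> \<in> test_fun"
    have "integral\<^sup>L lborel (vderiv \<phi>) = 0"
      using ac_ibp_test[OF ac_const[of 1] \<phi>] by simp
    \<comment> \<open>On derivatives \<open>P\<close> inverts differentiation; the sign in
      \<open>Q = - S\<close> is that of the distributional derivative.\<close>
    then have "P (vderiv \<phi>) = \<phi>" by (intro P_unique test_fun_vderiv \<phi>) simp
    then show "q \<phi> = - (LINT x|lborel. ((-1) * S x) * vderiv \<phi> x)"
      using S(2)[OF test_fun_vderiv[OF \<phi>]] by simp
  qed
qed

lemma integral_real_test:
  assumes "\<And>x. g x \<in> \<real>" "integrable lborel (\<lambda>x. f x * g x)"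
  shows "Re (LINT x|lborel. f x * g x) = Re (LINT x|lborel. of_real (Re (f x)) * g x)"
    and "(LINT x|lborel. of_real (Re (f x)) * g x) \<in> \<real>"
proof -
  have eq: "of_real (Re (f x)) * g x = complex_of_real (Re (f x * g x))" for x
    using assms(1)[of x] by (auto elim!: Reals_cases simp: complex_eq_iff)
  show "(LINT x|lborel. of_real (Re (f x)) * g x) \<in> \<real>"
    unfolding eq integral_complex_of_real by simp
  show "Re (LINT x|lborel. f x * g x) = Re (LINT x|lborel. of_real (Re (f x)) * g x)"
    unfolding eq integral_complex_of_real integral_Re[OF assms(2), symmetric] by simp
qed

lemma vderiv_real:
  assumes "\<phi> \<in> test_fun" "\<And>x. \<phi> x \<in> \<real>"
  shows "vderiv \<phi> x \<in> \<real>"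
proof -
  have "(\<lambda>x. cnj (\<phi> x)) = \<phi>" using assms(2) by (auto simp: Reals_cnj_iff)
  then have "cnj (vderiv \<phi> x) = vderiv \<phi> x"
    using vderiv_smooth_cnj[OF test_fun_smooth[OF assms(1)]] by (metis (no_types))
  then show ?thesis by (simp add: Reals_cnj_iff)
qed

text \<open>Passing to the real part of a complex primitive does not change the values on real test
  functions, since \<open>q\<close> is real there; complex linearity does the rest.\<close>

lemma real_valued_primitive:
  assumes q: "q \<in> sobolev_loc (-1)" "real_valued_dist q"
  obtains Q :: "real \<Rightarrow> real" where "Q \<in> L2_loc"
    "\<And>\<phi>. \<phi> \<in> test_fun \<Longrightarrow> q \<phi> = - (LINT x|lborel. of_real (Q x) * vderiv \<phi> x)"
proof -
  obtain Q where Q: "Q \<in> L2_loc" "\<And>\<phi>. \<phi> \<in> test_fun \<Longrightarrow> q \<phi> = - (LINT x|lborel. Q x * vderiv \<phi> x)"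
    using sobolev_loc_minus1_primitive[OF q(1)] by blast
  have lin: "q (\<lambda>x. \<phi> x + c * \<psi> x) = q \<phi> + c * q \<psi>" if "\<phi> \<in> test_fun" "\<psi> \<in> test_fun" for \<phi> \<psi> c
    using distributionsD(2,3)[of q] q(1) that test_fun_cmult by (simp add: sobolev_loc_def)
  have RQ: "(\<lambda>x. Re (Q x)) \<in> L2_loc" by (rule L2_loc_Re[OF Q(1)])
  define T where "T \<phi> = - (LINT x|lborel. of_real (Re (Q x)) * vderiv \<phi> x)" for \<phi>
  have liR: "loc_int (\<lambda>x. complex_of_real (Re (Q x)))"
    by (intro loc_int_of_real L2_loc_loc_int RQ)
  have T_lin: "T (\<lambda>x. \<phi> x + c * \<psi> x) = T \<phi> + c * T \<psi>" if "\<phi> \<in> test_fun" "\<psi> \<in> test_fun" for \<phi> \<psi> c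
  proof -
    have "vderiv (\<lambda>x. \<phi> x + c * \<psi> x) = (\<lambda>x. vderiv \<phi> x + c * vderiv \<psi> x)"
      using that by (simp add: vderiv_smooth_add vderiv_smooth_cmult test_fun_smooth smooth_cmult)
    moreover have "(LINT x|lborel. of_real (Re (Q x)) * (vderiv \<phi> x + c * vderiv \<psi> x))
        = (LINT x|lborel. of_real (Re (Q x)) * vderiv \<phi> x + c * (of_real (Re (Q x)) * vderiv \<psi> x))"
      by (simp add: distrib_left mult.left_commute)
    ultimately show ?thesis
      using integrable_mult_test[OF liR test_fun_vderiv] that by (simp add: T_def)
  qed
  have real: "q \<phi> = T \<phi>" if \<phi>: "\<phi> \<in> test_fun" "\<And>x. \<phi> x \<in> \<real>" for \<phi>
  proof -
    note r = integral_real_test[OF vderiv_real[OF \<phi>] integrable_mult_test[OF L2_loc_loc_int[OF Q(1)]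
        test_fun_vderiv[OF \<phi>(1)]]]
    have "Re (q \<phi>) = Re (T \<phi>)" using r(1) Q(2)[OF \<phi>(1)] by (simp add: T_def)
    moreover have "q \<phi> \<in> \<real>" using q(2) \<phi> by (simp add: real_valued_dist_def)
    moreover have "T \<phi> \<in> \<real>" using r(2) by (simp add: T_def)
    ultimately show ?thesis by (auto simp: complex_is_Real_iff complex_eq_iff)
  qed
  have "q \<phi> = T \<phi>" if \<phi>: "\<phi> \<in> test_fun" for \<phi>
  proof -
    have c: "(\<lambda>x. cnj (\<phi> x)) \<in> test_fun" using \<phi> by (auto simp: test_fun_iff smooth_cnj)
    \<comment> \<open>\<open>a\<close> and \<open>b\<close> are the real and imaginary part of
      \<open>\<phi>\<close>, written with the conjugate so that the closure properties of test
      functions apply.\<close>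
    define a where "a x = (1/2) * (\<phi> x + cnj (\<phi> x))" for x
    define b where "b x = (- \<i> / 2) * (\<phi> x - cnj (\<phi> x))" for x
    have a: "a \<in> test_fun" unfolding a_def[abs_def] by (intro test_fun_cmult test_fun_add \<phi> c)
    have b: "b \<in> test_fun" unfolding b_def[abs_def] by (intro test_fun_cmult test_fun_diff \<phi> c)
    have "a x \<in> \<real>" "b x \<in> \<real>" for x by (auto simp: a_def b_def complex_is_Real_iff)
    then have "q a = T a" "q b = T b" using real a b by auto
    moreover have "\<phi> = (\<lambda>x. a x + \<i> * b x)" by (auto simp: a_def b_def complex_eq_iff)
    ultimately show ?thesis using lin[OF a b] T_lin[OF a b] by metis
  qed
  then show thesis using that[OF RQ] by (simp add: T_def)
qed

section \<open>The Schroedinger equation as a first-order system\<close>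

lemma ac_continuous_derivative:
  assumes F: "ac F f" and f: "continuous_on UNIV f"
  shows "(F has_vector_derivative f x) (at x)"
proof -
  obtain H where H: "\<And>x. (H has_vector_derivative f x) (at x)"
    using continuous_antiderivative[OF f] by blast
  have "ac (\<lambda>x. F x - H x) (\<lambda>x. f x - f x)" by (rule ac_diff[OF F ac_C1[OF H f]])
  then have "F x - H x = F 0 - H 0" for x by (intro ac_zero_const) simp
  then have "F = (\<lambda>x. H x + (F 0 - H 0))" by (auto simp: algebra_simps)
  then show ?thesis using has_vector_derivative_add[OF H has_vector_derivative_const[of "F 0 - H 0"]] by simp
qed

lemma ac_norm_bound:
  fixes f :: "real \<Rightarrow> 'a::{real_normed_field, euclidean_space}" and G :: "real \<Rightarrow> real"
  assumes F: "ac F f" and G: "ac G g" and ab: "a \<le> b"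
    and le: "\<And>x. a \<le> x \<Longrightarrow> x \<le> b \<Longrightarrow> norm (f x) \<le> g x"
  shows "norm (F b - F a) \<le> G b - G a"
proof -
  have "norm (F b - F a) = norm (LINT x|lborel. indicat_real {a..b} x *\<^sub>R f x)"
    using ac_LINT[OF F ab] by (simp add: set_lebesgue_integral_def)
  also have "\<dots> \<le> (LINT x|lborel. norm (indicat_real {a..b} x *\<^sub>R f x))" by (rule integral_norm_bound)
  also have "\<dots> \<le> (LINT x|lborel. indicat_real {a..b} x *\<^sub>R g x)"
  proof (rule integral_mono)
    show "integrable lborel (\<lambda>x. norm (indicat_real {a..b} x *\<^sub>R f x))"
      using loc_int_set[OF ac_loc_int[OF F], of a b] by (intro integrable_norm) (simp add: set_integrable_def)
    show "integrable lborel (\<lambda>x. indicat_real {a..b} x *\<^sub>R g x)"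
      using loc_int_set[OF ac_loc_int[OF G], of a b] by (simp add: set_integrable_def)
    show "norm (indicat_real {a..b} x *\<^sub>R f x) \<le> indicat_real {a..b} x *\<^sub>R g x" for x
      using le[of x] by (cases "x \<in> {a..b}") auto
  qed
  also have "\<dots> = G b - G a" using ac_LINT[OF G ab] by (simp add: set_lebesgue_integral_def)
  finally show ?thesis .
qed

text \<open>\<open>K\<close> is nondecreasing and vanishes at 0, so \<open>\<bar>K x\<bar>\<close>
  is \<open>K x\<close> or \<open>- K x\<close> on either half-line, and \<open>k\<close> times the
  exponential integrates to half of the exponential. The factor 2 in the exponent is the origin of
  the contraction constant one half.\<close>

lemma weighted_primitive_bound:
  fixes f :: "real \<Rightarrow> 'a::{real_normed_field, euclidean_space}"
  assumes K: "ac K k" "K 0 = 0" and k: "\<And>x. k x \<ge> 0" and F: "ac F f" "F 0 = 0"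
    and le: "\<And>x. norm (f x) \<le> M * (k x * exp (2 * \<bar>K x\<bar>))"
  shows "norm (F x) \<le> M * ((exp (2 * \<bar>K x\<bar>) - 1) / 2)"
proof -
  have mono: "K x \<le> K y" if "x \<le> y" for x y
    using ac_norm_bound[OF ac_const[of "0::real"] K(1) that] k by simp
  show ?thesis
  proof (cases "0 \<le> x")
    case True
    have G: "ac (\<lambda>x. M / 2 * exp (2 * K x)) (\<lambda>x. M / 2 * (exp (2 * K x) * (2 * k x)))"
      by (rule ac_cmult[OF ac_exp[OF ac_cmult[OF K(1)]]])
    have "norm (F x - F 0) \<le> M / 2 * exp (2 * K x) - M / 2 * exp (2 * K 0)"
    proof (rule ac_norm_bound[OF F(1) G True])
      fix t :: real assume "0 \<le> t"
      then have "\<bar>K t\<bar> = K t" using mono[of 0 t] K(2) by simp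
      then show "norm (f t) \<le> M / 2 * (exp (2 * K t) * (2 * k t))" using le[of t] by (simp add: mult_ac)
    qed
    moreover have "\<bar>K x\<bar> = K x" using mono[OF True] K(2) by simp
    ultimately show ?thesis using K(2) F(2) by (simp add: algebra_simps)
  next
    case False
    then have x: "x \<le> 0" by simp
    have G: "ac (\<lambda>x. - M / 2 * exp (- 2 * K x)) (\<lambda>x. - M / 2 * (exp (- 2 * K x) * (- 2 * k x)))"
      by (rule ac_cmult[OF ac_exp[OF ac_cmult[OF K(1)]]])
    have "norm (F 0 - F x) \<le> - M / 2 * exp (- 2 * K 0) - - M / 2 * exp (- 2 * K x)"
    proof (rule ac_norm_bound[OF F(1) G x])
      fix t :: real assume "t \<le> 0"
      then have "\<bar>K t\<bar> = - K t" using mono[of t 0] K(2) by simp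
      then show "norm (f t) \<le> - M / 2 * (exp (- 2 * K t) * (- 2 * k t))" using le[of t] by (simp add: mult_ac)
    qed
    moreover have "\<bar>K x\<bar> = - K x" using mono[OF x] K(2) by simp
    ultimately show ?thesis using K(2) F(2) by (simp add: algebra_simps)
  qed
qed

text \<open>The weight \<open>exp (2 |K|)\<close> makes the integral operator a contraction with factor one half on all of the
  real line at once; \<open>v\<close> and \<open>w\<close> are the real and imaginary part of the fixed point.\<close>

lemma linear_ode_exists:
  fixes \<alpha> \<beta> :: "real \<Rightarrow> real"
  assumes \<alpha>: "loc_int \<alpha>" and \<beta>: "loc_int \<beta>"
  obtains v w where "ac v (\<lambda>x. \<alpha> x * w x)" "ac w (\<lambda>x. \<beta> x * v x)" "v 0 = v0" "w 0 = w0"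
proof -
  define k where "k x = \<bar>\<alpha> x\<bar> + \<bar>\<beta> x\<bar>" for x
  have k0: "k x \<ge> 0" for x by (simp add: k_def)
  have lk: "loc_int k"
    using loc_int_add[OF loc_int_norm[OF \<alpha>] loc_int_norm[OF \<beta>]] by (simp add: k_def[abs_def])
  obtain K where K: "ac K k" "K 0 = 0" using ac_exists[OF lk] by blast
  define E where "E x = exp (2 * \<bar>K x\<bar>)" for x
  have E: "E x \<ge> 1" "E 0 = 1" for x by (auto simp: E_def K)
  have cE: "continuous_on A E" for A
    unfolding E_def[abs_def] by (intro continuous_intros ac_continuous[OF K(1)])
  \<comment> \<open>The pair of unknowns is coded as one complex function, on whose values the
    system acts real linearly.\<close>
  define G where "G Y x = Complex (\<alpha> x * Im (Y x)) (\<beta> x * Re (Y x))" for Y :: "real \<Rightarrow> complex" and x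
  have G: "loc_int (G Y)" if "continuous_on UNIV Y" for Y
  proof -
    have "loc_int (\<lambda>x. of_real (Im (Y x) * \<alpha> x) + \<i> * of_real (Re (Y x) * \<beta> x))"
      using that by (intro loc_int_add loc_int_cmult loc_int_of_real loc_int_mult_continuous \<alpha> \<beta>
          continuous_intros)
    moreover have "G Y = (\<lambda>x. of_real (Im (Y x) * \<alpha> x) + \<i> * of_real (Re (Y x) * \<beta> x))"
      by (auto simp: G_def complex_eq_iff)
    ultimately show ?thesis by simp
  qed
  have G_bound: "norm (G Y1 x - G Y2 x) \<le> k x * norm (Y1 x - Y2 x)" for Y1 Y2 x
  proof -
    have "norm (G Y1 x - G Y2 x) \<le> \<bar>\<alpha> x * (Im (Y1 x - Y2 x))\<bar> + \<bar>\<beta> x * Re (Y1 x - Y2 x)\<bar>"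
      using cmod_le[of "G Y1 x - G Y2 x"] by (simp add: G_def right_diff_distrib)
    also have "\<dots> \<le> \<bar>\<alpha> x\<bar> * norm (Y1 x - Y2 x) + \<bar>\<beta> x\<bar> * norm (Y1 x - Y2 x)"
      unfolding abs_mult by (intro add_mono mult_left_mono abs_Im_le_cmod abs_Re_le_cmod) auto
    finally show ?thesis by (simp add: k_def distrib_right)
  qed
  define Pr where "Pr f = (SOME F. ac F f \<and> F 0 = 0)" for f :: "real \<Rightarrow> complex"
  have Pr: "ac (Pr f) f" "Pr f 0 = 0" if f: "loc_int f" for f
  proof -
    have "\<exists>F. ac F f \<and> F 0 = 0" using ac_exists[OF f] by blast
    from someI_ex[OF this] show "ac (Pr f) f" "Pr f 0 = 0" unfolding Pr_def by blast+
  qed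
  \<comment> \<open>\<open>Z\<close> is the unknown divided by the weight: for \<open>Z\<close> the
    weighted norm becomes the supremum norm, in which bounded continuous functions are
    complete.\<close>
  define Y where "Y Z x = of_real (E x) * apply_bcontfun Z x" for Z :: "real \<Rightarrow>\<^sub>C complex" and x
  have cY: "continuous_on UNIV (Y Z)" for Z
    unfolding Y_def[abs_def] by (intro continuous_intros cE continuous_on_apply_bcontfun)
  define Y0 where "Y0 = Complex v0 w0"
  define \<Phi> where "\<Phi> Z x = (Y0 + Pr (G (Y Z)) x) / of_real (E x)" for Z x
  have c\<Phi>: "continuous_on UNIV (\<Phi> Z)" for Z
  proof -
    have "E x \<noteq> 0" for x using E(1)[of x] by linarith
    then show ?thesis
      unfolding \<Phi>_def[abs_def] by (intro continuous_intros cE ac_continuous[OF Pr(1)[OF G[OF cY]]]) simp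
  qed
  have diff: "norm (\<Phi> Z1 x - \<Phi> Z2 x) \<le> dist Z1 Z2 / 2" for Z1 Z2 x
  proof -
    define f where "f x = G (Y Z1) x - G (Y Z2) x" for x
    define F where "F x = Pr (G (Y Z1)) x - Pr (G (Y Z2)) x" for x
    have F: "ac F f" "F 0 = 0"
      unfolding F_def[abs_def] f_def[abs_def] using Pr[OF G[OF cY]] by (auto intro: ac_diff)
    have "norm (f x) \<le> dist Z1 Z2 * (k x * exp (2 * \<bar>K x\<bar>))" for x
    proof -
      have "norm (f x) \<le> k x * norm (Y Z1 x - Y Z2 x)" unfolding f_def by (rule G_bound)
      also have "norm (Y Z1 x - Y Z2 x) = E x * dist (apply_bcontfun Z1 x) (apply_bcontfun Z2 x)"
        using E(1)[of x] by (simp add: Y_def dist_norm norm_mult flip: right_diff_distrib)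
      also have "k x * \<dots> \<le> k x * (E x * dist Z1 Z2)"
        using E(1)[of x] by (intro mult_left_mono dist_bounded k0) simp
      finally show ?thesis by (simp add: E_def mult_ac)
    qed
    from weighted_primitive_bound[OF K k0 F this]
    have "norm (F x) \<le> dist Z1 Z2 * ((E x - 1) / 2)" by (simp add: E_def)
    also have "\<dots> \<le> dist Z1 Z2 * (E x / 2)" by (intro mult_left_mono) auto
    finally have "norm (F x) / E x \<le> dist Z1 Z2 / 2" using E(1)[of x] by (simp add: field_simps)
    moreover have "\<Phi> Z1 x - \<Phi> Z2 x = F x / of_real (E x)"
        by (simp add: \<Phi>_def F_def diff_divide_distrib add_divide_distrib)
    ultimately show ?thesis using E(1)[of x] by (simp add: norm_divide)
  qed
  have zero: "\<Phi> 0 x = Y0 / of_real (E x)" for x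
  proof -
    have "Y 0 = (\<lambda>x. 0)" by (simp add: Y_def[abs_def])
    then have "G (Y 0) = (\<lambda>x. 0)" by (simp add: G_def[abs_def] complex_eq_iff fun_eq_iff)
    then have "ac (Pr (G (Y 0))) (\<lambda>x. 0)" "Pr (G (Y 0)) 0 = 0" using Pr[OF G[OF cY[of 0]]] by simp_all
    then have "Pr (G (Y 0)) x = 0" using ac_zero_const[of _ x 0] by metis
    then show ?thesis by (simp add: \<Phi>_def)
  qed
  \<comment> \<open>\<open>\<Phi> 0\<close> is bounded by its explicit form, and the contraction
    estimate extends boundedness to every \<open>Z\<close>.\<close>
  have bounded: "\<Phi> Z \<in> bcontfun" for Z
  proof (rule bcontfun_normI[OF c\<Phi>])
    fix x
    have "norm (\<Phi> Z x) \<le> norm (\<Phi> 0 x) + norm (\<Phi> Z x - \<Phi> 0 x)" using norm_triangle_ineq[of "\<Phi> 0 x"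
        "\<Phi> Z x - \<Phi> 0 x"] by simp
    also have "norm (\<Phi> 0 x) \<le> norm Y0"
      using E(1)[of x] by (simp add: zero norm_divide divide_le_eq mult_left_le order_trans[OF _
          mult_left_mono[of 1]])
    finally show "norm (\<Phi> Z x) \<le> norm Y0 + dist Z 0 / 2" using diff[of Z x 0] by simp
  qed
  have "\<exists>!Z. Bcontfun (\<Phi> Z) = Z"
  proof (rule banach_fix_type[of "1/2"])
    show "\<forall>Z1 Z2. dist (Bcontfun (\<Phi> Z1)) (Bcontfun (\<Phi> Z2)) \<le> 1 / 2 * dist Z1 Z2"
      using diff by (intro allI dist_bound) (simp add: Bcontfun_inverse[OF bounded] dist_norm)
  qed auto
  then obtain Z where "Bcontfun (\<Phi> Z) = Z" by blast
  then have Z: "apply_bcontfun Z = \<Phi> Z" using Bcontfun_inverse[OF bounded, of Z] by simp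
  define S where "S x = Y0 + Pr (G (Y Z)) x" for x
  have "Y Z = S"
  proof
    fix x
    have "Y Z x = of_real (E x) * \<Phi> Z x" by (simp add: Y_def Z)
    also have "\<dots> = S x" using E(1)[of x] unfolding \<Phi>_def S_def by simp
    finally show "Y Z x = S x" .
  qed
  have "ac (\<lambda>x. Y0 + Pr (G (Y Z)) x) (\<lambda>x. 0 + G (Y Z) x)" by (rule ac_add[OF ac_const Pr(1)[OF G[OF cY]]])
  then have "ac S (G (Y Z))" by (simp add: S_def[abs_def])
  then have S: "ac S (G S)" by (simp only: \<open>Y Z = S\<close>)
  have S0: "S 0 = Y0" using Pr(2)[OF G[OF cY]] by (simp add: S_def)
  show thesis
  proof (rule that[of "\<lambda>x. Re (S x)" "\<lambda>x. Im (S x)"])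
    show "ac (\<lambda>x. Re (S x)) (\<lambda>x. \<alpha> x * Im (S x))" using ac_Re[OF S] by (simp add: G_def)
    show "ac (\<lambda>x. Im (S x)) (\<lambda>x. \<beta> x * Re (S x))" using ac_Im[OF S] by (simp add: G_def)
  qed (simp_all add: S0 Y0_def)
qed

text \<open>Here \<open>u\<close> stands for the quasi-derivative \<open>y' - Q y\<close>, which is absolutely continuous although \<open>y'\<close> is
  not: for \<open>q = Q'\<close> the equation \<open>L\<^sub>q y = 0\<close> reads \<open>u' = - Q y'\<close>. The substitution \<open>y = e\<^sup>P v\<close>,
  \<open>u = e\<^sup>-\<^sup>P w\<close> with \<open>P' = Q\<close> removes the diagonal terms of the system.\<close>

definition sol :: "(real \<Rightarrow> real) \<Rightarrow> (real \<Rightarrow> real) \<Rightarrow> (real \<Rightarrow> real) \<Rightarrow> bool" where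
  "sol Q y u \<longleftrightarrow> ac y (\<lambda>x. Q x * y x + u x) \<and> ac u (\<lambda>x. - Q x * (Q x * y x + u x))"

lemma sol_exists:
  assumes Q: "Q \<in> L2_loc"
  obtains y u where "sol Q y u" "y 0 = y0" "u 0 = u0"
proof -
  obtain P where P: "ac P Q" "P 0 = 0" using ac_exists[OF L2_loc_loc_int[OF Q]] by blast
  have cP: "continuous_on A P" for A by (rule ac_continuous[OF P(1)])
  \<comment> \<open>The system after the substitution is \<open>v' = exp (- 2 P) w\<close>,
    \<open>w' = - exp (2 P) Q^2 v\<close>; its coefficients are locally integrable because
    \<open>Q\<close> is locally square integrable.\<close>
  have l1: "loc_int (\<lambda>x. exp (- 2 * P x))" by (intro loc_int_continuous continuous_intros cP)
  have l2: "loc_int (\<lambda>x. - exp (2 * P x) * (Q x * Q x))"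
    by (intro loc_int_mult_continuous L2_loc_mult Q continuous_intros cP)
  obtain v w where v: "ac v (\<lambda>x. exp (- 2 * P x) * w x)" "v 0 = y0"
    and w: "ac w (\<lambda>x. - exp (2 * P x) * (Q x * Q x) * v x)" "w 0 = u0"
    using linear_ode_exists[OF l1 l2, of y0 u0] by blast
  have e1: "exp (- 2 * P x) = exp (- P x) * exp (- P x)" and e2: "exp (2 * P x) = exp (P x) * exp (P x)"
      and e3: "exp (P x) * exp (- P x) = 1" for x
    by (simp_all flip: exp_add)
  define y where "y x = exp (P x) * v x" for x
  define u where "u x = exp (- P x) * w x" for x
  have "ac y (\<lambda>x. exp (P x) * (exp (- 2 * P x) * w x) + (exp (P x) * Q x) * v x)"
    unfolding y_def[abs_def] by (rule ac_mult[OF ac_exp[OF P(1)] v(1)])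
  moreover have "exp (P x) * (exp (- 2 * P x) * w x) + (exp (P x) * Q x) * v x = Q x * y x + u x" for x
  proof -
    have "exp (P x) * (exp (- 2 * P x) * w x) = (exp (P x) * exp (- P x)) * (exp (- P x) * w x)" unfolding e1
        by simp
    then show ?thesis unfolding e3 by (simp add: y_def u_def)
  qed
  ultimately have y: "ac y (\<lambda>x. Q x * y x + u x)" by simp
  have "ac u (\<lambda>x. exp (- P x) * (- exp (2 * P x) * (Q x * Q x) * v x) + (exp (- P x) * (- Q x)) * w x)"
    unfolding u_def[abs_def] by (rule ac_mult[OF ac_exp[OF ac_minus[OF P(1)]] w(1)])
  moreover have "exp (- P x) * (- exp (2 * P x) * (Q x * Q x) * v x) + (exp (- P x) * (- Q x)) * w x
      = - Q x * (Q x * y x + u x)" for x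
  proof -
    have "exp (- P x) * (- exp (2 * P x) * (Q x * Q x) * v x)
        = - (exp (P x) * exp (- P x)) * (Q x * (Q x * (exp (P x) * v x)))"
      unfolding e2 by simp
    then show ?thesis unfolding e3 y_def u_def by (simp only:) (simp add: algebra_simps)
  qed
  ultimately have u: "ac u (\<lambda>x. - Q x * (Q x * y x + u x))" by simp
  show thesis
    by (rule that[of y u]) (use y u v w P in \<open>auto simp: sol_def y_def u_def\<close>)
qed

section \<open>Wronskian, uniqueness and zeros of solutions\<close>

lemma sol_combine:
  assumes "sol Q y1 u1" "sol Q y2 u2"
  shows "sol Q (\<lambda>x. y1 x + b * y2 x) (\<lambda>x. u1 x + b * u2 x)"
proof -
  have "ac (\<lambda>x. y1 x + b * y2 x) (\<lambda>x. (Q x * y1 x + u1 x) + b * (Q x * y2 x + u2 x))"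
    and "ac (\<lambda>x. u1 x + b * u2 x) (\<lambda>x. - Q x * (Q x * y1 x + u1 x) + b * (- Q x * (Q x * y2 x + u2 x)))"
    using assms ac_add ac_cmult unfolding sol_def by blast+
  moreover have "(Q x * y1 x + u1 x) + b * (Q x * y2 x + u2 x) = Q x * (y1 x + b * y2 x) + (u1 x + b * u2 x)"
    "- Q x * (Q x * y1 x + u1 x) + b * (- Q x * (Q x * y2 x + u2 x))
        = - Q x * (Q x * (y1 x + b * y2 x) + (u1 x + b * u2 x))" for x
    by (simp_all add: algebra_simps)
  ultimately show ?thesis unfolding sol_def by simp
qed

text \<open>The terms with \<open>Q\<close> cancel, so \<open>y1 * u2 - y2 * u1\<close> is the usual
  Wronskian. Unlike the derivatives, the quasi-derivatives are \<open>ac\<close>, and the product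
  rule gives derivative zero.\<close>

lemma sol_wronskian:
  assumes "sol Q y1 u1" "sol Q y2 u2"
  shows "y1 x * u2 x - y2 x * u1 x = y1 z * u2 z - y2 z * u1 z"
proof -
  have 1: "ac (\<lambda>x. y1 x * u2 x) (\<lambda>x. y1 x * (- Q x * (Q x * y2 x + u2 x)) + (Q x * y1 x + u1 x) * u2 x)"
    and 2: "ac (\<lambda>x. y2 x * u1 x) (\<lambda>x. y2 x * (- Q x * (Q x * y1 x + u1 x)) + (Q x * y2 x + u2 x) * u1 x)"
    using assms ac_mult unfolding sol_def by blast+
  have "ac (\<lambda>x. y1 x * u2 x - y2 x * u1 x) (\<lambda>x. 0)"
    using ac_diff[OF 1 2] by (simp add: algebra_simps)
  then show ?thesis by (rule ac_zero_const)
qed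

text \<open>Instead of a growth estimate: the Wronskians of \<open>y\<close> with the fundamental
  solutions at 0 vanish at \<open>b\<close>, hence everywhere, and the fundamental solutions have
  Wronskian 1.\<close>

lemma sol_unique:
  assumes Q: "Q \<in> L2_loc" and y: "sol Q y u" and 0: "y b = 0" "u b = 0"
  shows "y x = 0" "u x = 0"
proof -
  obtain c uc where c: "sol Q c uc" "c 0 = 1" "uc 0 = 0" using sol_exists[OF Q] by blast
  obtain s us where s: "sol Q s us" "s 0 = 0" "us 0 = 1" using sol_exists[OF Q] by blast
  have W: "c x * us x - s x * uc x = 1" using sol_wronskian[OF c(1) s(1), of x 0] c s by simp
  have 1: "y x * uc x = c x * u x" using sol_wronskian[OF y c(1), of x b] 0 by simp
  have 2: "y x * us x = s x * u x" using sol_wronskian[OF y s(1), of x b] 0 by simp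
  have "y x = y x * (c x * us x - s x * uc x)" using W by simp
  also have "\<dots> = c x * (y x * us x) - s x * (y x * uc x)" by (simp add: algebra_simps)
  also have "\<dots> = 0" unfolding 1 2 by simp
  finally show "y x = 0" .
  then have "c x * u x = 0" "s x * u x = 0" using 1 2 by simp_all
  then show "u x = 0" using W by auto
qed

text \<open>\<open>y\<close> need not be differentiable at \<open>b\<close>, since its derivative
  contains \<open>Q\<close>. Division by \<open>exp (P x)\<close> removes that term: the quotient
  \<open>v\<close> has the continuous derivative \<open>exp (- P x) * u x\<close> and the sign of
  \<open>y\<close>.\<close>

lemma sol_sign_change:
  assumes Q: "Q \<in> L2_loc" and y: "sol Q y u" and 0: "y b = 0" "u b > 0"
  obtains d where "d > 0" "\<And>x. b < x \<Longrightarrow> x < b + d \<Longrightarrow> y x > 0" "\<And>x. b - d < x \<Longrightarrow> x < b \<Longrightarrow> y x < 0"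
proof -
  obtain P where P: "ac P Q" "P 0 = 0" using ac_exists[OF L2_loc_loc_int[OF Q]] by blast
  define v where "v x = exp (- P x) * y x" for x
  have "ac v (\<lambda>x. exp (- P x) * (Q x * y x + u x) + (exp (- P x) * (- Q x)) * y x)"
    unfolding v_def[abs_def] using y by (intro ac_mult ac_exp ac_minus P) (simp add: sol_def)
  then have v: "ac v (\<lambda>x. exp (- P x) * u x)" by (simp add: algebra_simps)
  have "continuous_on UNIV (\<lambda>x. exp (- P x) * u x)"
    using y by (intro continuous_intros ac_continuous[OF P(1)] ac_continuous[of u]) (auto simp: sol_def)
  from ac_continuous_derivative[OF v this, of b]
  have D: "DERIV v b :> exp (- P b) * u b" by (simp add: has_real_derivative_iff_has_vector_derivative)
  have vb: "v b = 0" using 0 by (simp add: v_def)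
  obtain d1 where d1: "d1 > 0" "\<And>h. h > 0 \<Longrightarrow> h < d1 \<Longrightarrow> v b < v (b + h)"
    using DERIV_pos_inc_right[OF D] 0 by auto
  obtain d2 where d2: "d2 > 0" "\<And>h. h > 0 \<Longrightarrow> h < d2 \<Longrightarrow> v (b - h) < v b"
    using DERIV_pos_inc_left[OF D] 0 by auto
  show thesis
  proof (rule that[of "min d1 d2"])
    show "y x > 0" if "b < x" "x < b + min d1 d2" for x
      using d1(2)[of "x - b"] that vb by (simp add: v_def zero_less_mult_iff)
    show "y x < 0" if "b - min d1 d2 < x" "x < b" for x
      using d2(2)[of "b - x"] that vb by (simp add: v_def mult_less_0_iff)
  qed (use d1 d2 in simp)
qed

lemma ac_truncate:
  assumes y: "ac y f" and 0: "y a = 0" "y b = 0" and ab: "a \<le> b"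
  shows "ac (\<lambda>x. if x \<in> {a..b} then y x else 0) (\<lambda>x. indicat_real {a..b} x *\<^sub>R f x)"
  unfolding ac_def
proof (intro conjI allI impI)
  let ?y = "\<lambda>x. if x \<in> {a..b} then y x else 0"
  have [measurable]: "f \<in> borel_measurable borel" by (rule loc_int_measurable[OF ac_loc_int[OF y]])
  show "loc_int (\<lambda>x. indicat_real {a..b} x *\<^sub>R f x)"
    by (rule loc_int_bound[OF ac_loc_int[OF y]]) (auto simp: indicator_def)
  fix c d :: real assume cd: "c \<le> d"
  \<comment> \<open>The projection onto \<open>{a..b}\<close>; because \<open>y\<close> vanishes at
    both ends, the truncation is \<open>y\<close> composed with it.\<close>
  define k where "k x = max a (min b x)" for x
  have k: "k c \<le> k d" using cd by (auto simp: k_def)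
  have yk: "?y x = y (k x)" for x using 0 ab by (auto simp: k_def max_def min_def)
  have "AE x in lborel. indicat_real {k c..k d} x *\<^sub>R f x
      = indicat_real {c..d} x *\<^sub>R (indicat_real {a..b} x *\<^sub>R f x)"
    using AE_lborel_singleton[of a] AE_lborel_singleton[of b]
    by eventually_elim (use ab in \<open>auto simp: indicator_def k_def\<close>)
  then have "(LINT x|lborel. indicat_real {k c..k d} x *\<^sub>R f x)
      = (LINT x|lborel. indicat_real {c..d} x *\<^sub>R (indicat_real {a..b} x *\<^sub>R f x))"
    by (intro integral_cong_AE) auto
  then show "?y d - ?y c = (LINT x:{c..d}|lborel. indicat_real {a..b} x *\<^sub>R f x)"
    unfolding yk using ac_LINT[OF y k] by (simp add: set_lebesgue_integral_def)
qed

lemma L2_loc_indicator: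
  assumes "f \<in> L2_loc"
  shows "sq_int (\<lambda>x. indicat_real {a..b} x *\<^sub>R f x)"
proof -
  have "(norm (indicat_real {a..b} x *\<^sub>R f x))\<^sup>2 = indicat_real {a..b} x *\<^sub>R (norm (f x))\<^sup>2" for x
    by (simp add: indicator_def)
  then show ?thesis
    using assms loc_int_set[of "\<lambda>x. (norm (f x))\<^sup>2" a b] L2_loc_measurable[OF assms]
    by (simp add: L2_loc_iff sq_int_def set_integrable_def)
qed

section \<open>Nonnegative forms and positive solutions\<close>

text \<open>The form in real terms: for \<open>q = Q'\<close> the pairing of \<open>q\<close> with
  the squared modulus of \<open>\<phi>\<close> is minus the integral of \<open>Q\<close> times the
  derivative \<open>2 * (\<phi> x \<bullet> vderiv \<phi> x)\<close>.\<close>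

definition form_nonneg :: "(real \<Rightarrow> real) \<Rightarrow> bool" where
  "form_nonneg Q \<longleftrightarrow> (\<forall>\<phi>\<in>test_fun. 0 \<le> L2_sq (vderiv \<phi>) - 2 * (LINT x|lborel. Q x * (\<phi> x \<bullet> vderiv \<phi> x)))"

text \<open>Density of test functions among compactly supported \<open>H^1\<close> functions:
  \<open>f\<close> is approximated in \<open>L^2\<close>, the approximations are corrected to mean
  zero and integrated. The primitives converge uniformly, hence also after multiplication by
  \<open>Q\<close> in \<open>L^2\<close> of a bounded interval.\<close>

lemma form_nonneg_H1:
  fixes F f :: "real \<Rightarrow> complex"
  assumes Q: "Q \<in> L2_loc" and form: "form_nonneg Q"
    and F: "ac F f" and f: "sq_int f" and R: "R \<ge> 1"
    and fs: "\<And>x. f x \<noteq> 0 \<Longrightarrow> -R < x \<and> x < R" and Fs: "\<And>x. F x \<noteq> 0 \<Longrightarrow> -R < x \<and> x < R"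
  shows "0 \<le> L2_sq f - 2 * (LINT x|lborel. Q x * (F x \<bullet> f x))"
proof -
  obtain g where g: "\<And>n. g n \<in> test_on (-R) R" "(\<lambda>n. L2_sq (\<lambda>x. g n x - f x)) \<longlonglongrightarrow> 0"
  proof (rule test_fun_dense_L2[OF f])
    show "-R < x \<and> x < R" if "f x \<noteq> 0" for x by (rule fs[OF that])
  qed (rule that)
  have gt: "g n \<in> test_fun" and gsq: "sq_int (g n)" and gs: "g n x \<noteq> 0 \<Longrightarrow> -R < x \<and> x < R" for n x
    using g(1)[of n] by (auto simp: test_on_def intro: test_fun_sq_int)
  obtain \<eta> where \<eta>: "\<eta> \<in> test_fun" "integral\<^sup>L lborel \<eta> = 1" "\<And>x. \<eta> x \<noteq> 0 \<Longrightarrow> -1 < x \<and> x < (1::real)"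
      "\<And>x. \<eta> x \<in> \<real>"
    by (rule unit_mass_test_fun) blast
  define m where "m n = integral\<^sup>L lborel (g n)" for n
  \<comment> \<open>The means tend to the integral of \<open>f\<close>, which is 0 because
    \<open>F\<close> has compact support.\<close>
  have m: "m \<longlonglongrightarrow> 0"
  proof -
    define I where "I x = indicat_real {-R..R} x *\<^sub>R (1::complex)" for x
    have I: "sq_int I" unfolding I_def[abs_def] by (rule L2_loc_indicator[OF L2_loc_continuous]) simp
    have "(\<lambda>n. LINT x|lborel. g n x * I x) \<longlonglongrightarrow> (LINT x|lborel. f x * I x)"
      by (rule tendsto_L2_mult[OF f gsq g(2) I I]) (simp add: L2_sq_def)
    moreover have "g n x * I x = g n x" for n x using gs[of n x] by (cases "g n x = 0") (auto simp: I_def)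
    moreover have "f x * I x = f x" for x using fs[of x] by (cases "f x = 0") (auto simp: I_def)
    moreover have "integral\<^sup>L lborel f = 0"
      by (rule ac_integral_zero[OF F, of R]) (use fs Fs in \<open>force simp: abs_less_iff\<close>)+
    ultimately show ?thesis by (simp add: m_def[abs_def])
  qed
  define h where "h n x = g n x + (- m n) * \<eta> x" for n x
  have ht: "h n \<in> test_fun" for n unfolding h_def[abs_def] by (intro test_fun_add test_fun_cmult gt \<eta>)
  have hsq: "sq_int (h n)" for n by (rule test_fun_sq_int[OF ht])
  have hs: "-R \<le> x \<and> x \<le> R" if "h n x \<noteq> 0" for n x
    using that gs[of n x] \<eta>(3)[of x] R by (cases "g n x = 0"; cases "\<eta> x = 0") (auto simp: h_def)
  have h0: "integral\<^sup>L lborel (h n) = 0" for n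
    using test_fun_integrable[OF gt] test_fun_integrable[OF \<eta>(1)] \<eta>(2) by (simp add: h_def[abs_def] m_def)
  have "\<exists>\<psi>. \<psi> \<in> test_fun \<and> vderiv \<psi> = h n \<and> (\<forall>x. \<psi> x \<noteq> 0 \<longrightarrow> -R \<le> x \<and> x \<le> R)" for n
    by (rule test_fun_primitive[OF ht h0 hs]) blast+
  then obtain \<psi> where \<psi>: "\<And>n. \<psi> n \<in> test_fun" "\<And>n. vderiv (\<psi> n) = h n" "\<And>n x. \<psi> n x \<noteq> 0 \<Longrightarrow> -R \<le> x \<and> x \<le> R"
    by metis
  have hf: "(\<lambda>n. L2_sq (\<lambda>x. h n x - f x)) \<longlonglongrightarrow> 0"
  proof (rule tendsto_sandwich[where f = "\<lambda>_. 0"])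
    have "(\<lambda>n. 2 * L2_sq (\<lambda>x. g n x - f x) + 2 * ((norm (m n))\<^sup>2 * L2_sq \<eta>))
        \<longlonglongrightarrow> 2 * 0 + 2 * ((norm (0::complex))\<^sup>2 * L2_sq \<eta>)"
      by (intro tendsto_intros g(2) m)
    then show "(\<lambda>n. 2 * L2_sq (\<lambda>x. g n x - f x) + 2 * ((norm (m n))\<^sup>2 * L2_sq \<eta>)) \<longlonglongrightarrow> 0" by simp
    have "L2_sq (\<lambda>x. h n x - f x) \<le> 2 * L2_sq (\<lambda>x. g n x - f x) + 2 * ((norm (m n))\<^sup>2 * L2_sq \<eta>)" for n
    proof -
      have "(\<lambda>x. h n x - f x) = (\<lambda>x. (g n x - f x) + (- m n) * \<eta> x)" by (auto simp: h_def)
      then show ?thesis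
        using sq_int_add(2)[OF sq_int_diff[OF gsq f] sq_int_cmult[OF test_fun_sq_int[OF \<eta>(1)]], of n "- m n"]
        unfolding L2_sq_cmult by simp
    qed
    then show "\<forall>\<^sub>F n in sequentially. L2_sq (\<lambda>x. h n x - f x)
        \<le> 2 * L2_sq (\<lambda>x. g n x - f x) + 2 * ((norm (m n))\<^sup>2 * L2_sq \<eta>)"
      by simp
  qed (auto simp: L2_sq_nonneg)
  \<comment> \<open>One unit larger on each side, so that all primitives vanish at its left end, as
    \<open>ac_sup_bound\<close> requires.\<close>
  define J where "J = {-R - 1..R + 1}"
  \<comment> \<open>\<open>Q\<close> is attached to the undifferentiated factor, which makes the
    second term of the form an \<open>L^2\<close> inner product of two convergent sequences.\<close>
  define G where "G n x = indicat_real J x *\<^sub>R (\<psi> n x * of_real (Q x))" for n x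
  define G0 where "G0 x = indicat_real J x *\<^sub>R (F x * of_real (Q x))" for x
  have sG: "sq_int (G n)" for n
    unfolding G_def[abs_def] J_def
    by (intro L2_loc_indicator L2_loc_mult_continuous L2_loc_of_real Q smooth_continuous test_fun_smooth \<psi>)
  have sG0: "sq_int G0"
    unfolding G0_def[abs_def] J_def
    by (intro L2_loc_indicator L2_loc_mult_continuous L2_loc_of_real Q ac_continuous[OF F])
  have sq1: "sq_int (\<lambda>x. indicat_real J x *\<^sub>R Q x)" unfolding J_def by (rule L2_loc_indicator[OF Q])
  have GG0: "(\<lambda>n. L2_sq (\<lambda>x. G n x - G0 x)) \<longlonglongrightarrow> 0"
  proof (rule tendsto_sandwich[where f = "\<lambda>_. 0"])
    let ?B = "\<lambda>n. ((R + 1) - (- R - 1)) * L2_sq (\<lambda>x. h n x - f x)"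
    have "(\<lambda>n. ?B n * L2_sq (\<lambda>x. indicat_real J x *\<^sub>R Q x))
        \<longlonglongrightarrow> ((R + 1) - (- R - 1)) * 0 * L2_sq (\<lambda>x. indicat_real J x *\<^sub>R Q x)"
      by (intro tendsto_intros hf)
    then show "(\<lambda>n. ?B n * L2_sq (\<lambda>x. indicat_real J x *\<^sub>R Q x)) \<longlonglongrightarrow> 0" by simp
    have "L2_sq (\<lambda>x. G n x - G0 x) \<le> ?B n * L2_sq (\<lambda>x. indicat_real J x *\<^sub>R Q x)" for n
    proof -
      have D: "ac (\<lambda>x. \<psi> n x - F x) (\<lambda>x. h n x - f x)"
        using ac_diff[OF ac_smooth[OF test_fun_smooth[OF \<psi>(1)]] F, of n] by (simp add: \<psi>(2))
      have z: "\<psi> n (- R - 1) - F (- R - 1) = 0" using \<psi>(3)[of n "- R - 1"] Fs[of "- R - 1"] by force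
      have le: "(norm (\<psi> n x - F x))\<^sup>2 \<le> ?B n" if "x \<in> J" for x
        by (rule ac_sup_bound[OF D sq_int_diff[OF hsq f] z]) (use that in \<open>auto simp: J_def\<close>)
      have "L2_sq (\<lambda>x. G n x - G0 x) \<le> (LINT x|lborel. ?B n * (norm (indicat_real J x *\<^sub>R Q x))\<^sup>2)"
        unfolding L2_sq_def[of "\<lambda>x. G n x - G0 x"]
      proof (rule integral_mono)
        show "integrable lborel (\<lambda>x. (norm (G n x - G0 x))\<^sup>2)"
          by (rule sq_int_integrable[OF sq_int_diff[OF sG sG0]])
        show "integrable lborel (\<lambda>x. ?B n * (norm (indicat_real J x *\<^sub>R Q x))\<^sup>2)"
          by (rule integrable_mult_right[OF sq_int_integrable[OF sq1]])
        show "(norm (G n x - G0 x))\<^sup>2 \<le> ?B n * (norm (indicat_real J x *\<^sub>R Q x))\<^sup>2" for x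
        proof (cases "x \<in> J")
          case True
          have "norm (G n x - G0 x) = norm (\<psi> n x - F x) * \<bar>Q x\<bar>"
            using True by (simp add: G_def G0_def norm_mult flip: left_diff_distrib)
          then show ?thesis using le[OF True] True by (simp add: power_mult_distrib mult_right_mono)
        qed (simp add: G_def G0_def)
      qed
      then show ?thesis by (simp add: L2_sq_def)
    qed
    then show "\<forall>\<^sub>F n in sequentially. L2_sq (\<lambda>x. G n x - G0 x) \<le> ?B n * L2_sq (\<lambda>x. indicat_real J x *\<^sub>R Q x)"
        by simp
  qed (auto simp: L2_sq_nonneg)
  have L2_inner: "L2_sq k = (LINT x|lborel. k x \<bullet> k x)" for k :: "real \<Rightarrow> complex"
    by (simp add: L2_sq_def power2_norm_eq_inner)
  have lim: "(\<lambda>n. L2_sq (h n) - 2 * (LINT x|lborel. G n x \<bullet> h n x))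
      \<longlonglongrightarrow> L2_sq f - 2 * (LINT x|lborel. G0 x \<bullet> f x)"
    unfolding L2_inner by (intro tendsto_intros tendsto_L2_inner f hsq hf sG0 sG GG0)
  have eq: "(\<psi> n x * of_real (Q x)) \<bullet> h n x = Q x * (\<psi> n x \<bullet> h n x)"
      "(F x * of_real (Q x)) \<bullet> f x = Q x * (F x \<bullet> f x)" for n x
    by (simp_all add: inner_complex_def algebra_simps)
  have "G n x \<bullet> h n x = Q x * (\<psi> n x \<bullet> h n x)" for n x
    using hs[of n x] by (cases "h n x = 0") (auto simp: G_def J_def eq)
  then have "0 \<le> L2_sq (h n) - 2 * (LINT x|lborel. G n x \<bullet> h n x)" for n
    using form \<psi>(1)[of n] \<psi>(2)[of n] by (auto simp: form_nonneg_def)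
  then have "0 \<le> L2_sq f - 2 * (LINT x|lborel. G0 x \<bullet> f x)"
    by (intro LIMSEQ_le_const[OF lim]) auto
  moreover have "G0 x \<bullet> f x = Q x * (F x \<bullet> f x)" for x
    using fs[of x] by (cases "f x = 0") (auto simp: G0_def J_def eq)
  ultimately show ?thesis by simp
qed

text \<open>Jacobi's argument: a solution with two zeros, truncated to the interval between them, is a null
  vector of a nonnegative form, so the linear term of the form in every direction vanishes.\<close>

lemma form_nonneg_disconjugate:
  assumes Q: "Q \<in> L2_loc" and form: "form_nonneg Q" and y: "sol Q y u"
    and 0: "y a = 0" "y b = 0" and ab: "a < b"
  shows "u b = 0"
proof -
  define p where "p x = Q x * y x + u x" for x
  have acy: "ac y p" and acu: "ac u (\<lambda>x. - Q x * p x)" using y by (simp_all add: sol_def p_def[abs_def])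
  define Y where "Y x = (if x \<in> {a..b} then y x else 0)" for x
  define Y' where "Y' x = indicat_real {a..b} x *\<^sub>R p x" for x
  have Y: "ac Y Y'" unfolding Y_def[abs_def] Y'_def[abs_def] by (rule ac_truncate[OF acy 0]) (use ab in simp)
  have pL: "p \<in> L2_loc"
    unfolding p_def[abs_def]
    using L2_loc_add[OF L2_loc_mult_continuous[OF Q ac_continuous[OF acy]] L2_loc_continuous[OF
        ac_continuous[OF acu]]]
    by (simp add: mult.commute)
  have sY': "sq_int Y'" unfolding Y'_def[abs_def] by (rule L2_loc_indicator[OF pL])
  \<comment> \<open>A direction of variation with \<open>\<theta> a = 0\<close> and
    \<open>\<theta> b = 1\<close>, which singles out the boundary term at \<open>b\<close>.\<close>
  obtain \<theta> :: "real \<Rightarrow> real" where \<theta>: "(\<lambda>x. of_real (\<theta> x)) \<in> test_fun"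
      "\<And>x. b \<le> x \<Longrightarrow> x \<le> b \<Longrightarrow> \<theta> x = 1" "\<And>x. \<theta> x \<noteq> 0 \<Longrightarrow> b - (b - a) < x \<and> x < b + (b - a)"
      "\<And>x. 0 \<le> \<theta> x" "\<And>x. \<theta> x \<le> 1"
    by (rule cutoff_exists[of "b - a" b b]) (use ab in auto)
  have \<theta>b: "\<theta> b = 1" and \<theta>a: "\<theta> a = 0" using \<theta>(2)[of b] \<theta>(3)[of a] by auto
  define \<theta>' where "\<theta>' x = Re (vderiv (\<lambda>x. of_real (\<theta> x)) x)" for x
  have ac\<theta>: "ac \<theta> \<theta>'" using ac_Re[OF ac_smooth[OF test_fun_smooth[OF \<theta>(1)]]] by (simp add: \<theta>'_def[abs_def])
  have s\<theta>': "sq_int \<theta>'"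
    unfolding \<theta>'_def[abs_def]
    by (rule sq_int_bound[OF test_fun_sq_int[OF test_fun_vderiv[OF \<theta>(1)]]])
      (use sq_int_measurable[OF test_fun_sq_int[OF test_fun_vderiv[OF \<theta>(1)]]] in \<open>auto simp: abs_Re_le_cmod\<close>)
  \<comment> \<open>Large enough for \<open>{a..b}\<close> and for the support of
    \<open>\<theta>\<close>, which may reach up to \<open>2 * b - a\<close>.\<close>
  define R where "R = 2 * \<bar>a\<bar> + 2 * \<bar>b\<bar> + 1"
  have R1: "R \<ge> 1" by (simp add: R_def)
  have Ys: "-R < x \<and> x < R" if "Y x \<noteq> 0 \<or> Y' x \<noteq> 0" for x
  proof -
    have "x \<in> {a..b}" using that by (auto simp: Y_def Y'_def split: if_splits)
    then show ?thesis by (auto simp: R_def)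
  qed
  have \<theta>s: "-R < x \<and> x < R" if "\<theta> x \<noteq> 0 \<or> \<theta>' x \<noteq> 0" for x
  proof -
    have "a \<le> x \<and> x \<le> b + (b - a)"
    proof (cases "\<theta> x = 0")
      case True
      then have "vderiv (\<lambda>x. of_real (\<theta> x)) x \<noteq> 0" using that by (auto simp: \<theta>'_def)
      then show ?thesis by (rule vderiv_zero_outside[rotated]) (use \<theta>(3) in force)
    qed (use \<theta>(3)[of x] in auto)
    then show ?thesis by (auto simp: R_def)
  qed
  \<comment> \<open>The integrand of the bilinear form that belongs to the quadratic form by
    polarisation.\<close>
  define B where "B F f G g x = f x * g x - Q x * (F x * g x + G x * f x)" for F f G g :: "real \<Rightarrow> real" and x
  have iB: "integrable lborel (B F f G g)"
    if "ac F f" "ac G g" "sq_int f" "sq_int g" "\<And>x. F x \<noteq> 0 \<or> f x \<noteq> 0 \<Longrightarrow> -R < x \<and> x < R"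
        "\<And>x. G x \<noteq> 0 \<or> g x \<noteq> 0 \<Longrightarrow> -R < x \<and> x < R"
    for F f G g
  proof (rule integrable_supported[of _ "-R" R])
    note L = sq_int_L2_loc[OF that(3)] sq_int_L2_loc[OF that(4)]
    show "loc_int (B F f G g)"
      unfolding B_def[abs_def]
      by (intro loc_int_diff L2_loc_mult L Q L2_loc_add L2_loc_mult_continuous ac_continuous[OF that(1)]
          ac_continuous[OF that(2)])
    show "-R \<le> x \<and> x \<le> R" if "B F f G g x \<noteq> 0" for x
    proof -
      have "f x \<noteq> 0 \<or> g x \<noteq> 0" using that by (auto simp: B_def)
      then show ?thesis using \<open>\<And>x. F x \<noteq> 0 \<or> f x \<noteq> 0 \<Longrightarrow> -R < x \<and> x < R\<close>[of x] \<open>\<And>x. G x \<noteq> 0 \<or> g x \<noteq> 0 \<Longrightarrow> -R < x \<and>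
          x < R\<close>[of x] by auto
    qed
  qed
  note i11 = iB[OF Y Y sY' sY' Ys Ys] and i12 = iB[OF Y ac\<theta> sY' s\<theta>' Ys \<theta>s]
      and i22 = iB[OF ac\<theta> ac\<theta> s\<theta>' s\<theta>' \<theta>s \<theta>s]
  \<comment> \<open>On \<open>{a..b}\<close> the integrand is the derivative of
    \<open>y * u\<close>, so the integral is a difference of boundary values, both 0.\<close>
  have "integral\<^sup>L lborel (B Y Y' Y Y') = (LINT x:{a..b}|lborel. y x * (- Q x * p x) + p x * u x)"
    unfolding set_lebesgue_integral_def
  proof (rule Bochner_Integration.integral_cong)
    fix x
    have u: "u x = p x - Q x * y x" by (simp add: p_def)
    show "B Y Y' Y Y' x = indicat_real {a..b} x *\<^sub>R (y x * (- Q x * p x) + p x * u x)"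
      unfolding u by (cases "x \<in> {a..b}") (auto simp: B_def Y_def Y'_def algebra_simps)
  qed simp
  then have I11: "integral\<^sup>L lborel (B Y Y' Y Y') = 0"
    using ac_LINT[OF ac_mult[OF acy acu], of a b] ab 0 by simp
  \<comment> \<open>For the mixed term the integrand is the derivative of
    \<open>u * \<theta>\<close>, and only the value at \<open>b\<close> survives.\<close>
  have "integral\<^sup>L lborel (B Y Y' \<theta> \<theta>') = (LINT x:{a..b}|lborel. u x * \<theta>' x + (- Q x * p x) * \<theta> x)"
    unfolding set_lebesgue_integral_def
  proof (rule Bochner_Integration.integral_cong)
    fix x
    have u: "u x = p x - Q x * y x" by (simp add: p_def)
    show "B Y Y' \<theta> \<theta>' x = indicat_real {a..b} x *\<^sub>R (u x * \<theta>' x + (- Q x * p x) * \<theta> x)"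
      unfolding u by (cases "x \<in> {a..b}") (auto simp: B_def Y_def Y'_def algebra_simps)
  qed simp
  then have I12: "integral\<^sup>L lborel (B Y Y' \<theta> \<theta>') = u b"
    using ac_LINT[OF ac_mult[OF acu ac\<theta>], of a b] ab \<theta>a \<theta>b by simp
  have "0 \<le> 2 * t * u b + t\<^sup>2 * integral\<^sup>L lborel (B \<theta> \<theta>' \<theta> \<theta>')" for t
  proof -
    define F where "F x = Y x + t * \<theta> x" for x
    define f where "f x = Y' x + t * \<theta>' x" for x
    have F: "ac F f" unfolding F_def[abs_def] f_def[abs_def] by (intro ac_add ac_cmult Y ac\<theta>)
    have f: "sq_int f" unfolding f_def[abs_def] using sq_int_add(1)[OF sY' sq_int_scaleR[OF s\<theta>', of t]]
        by simp
    have Fs: "-R < x \<and> x < R" if "F x \<noteq> 0 \<or> f x \<noteq> 0" for x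
    proof -
      have "(Y x \<noteq> 0 \<or> Y' x \<noteq> 0) \<or> (\<theta> x \<noteq> 0 \<or> \<theta>' x \<noteq> 0)" using that by (auto simp: F_def f_def)
      then show ?thesis using Ys \<theta>s by blast
    qed
    have sc: "sq_int (\<lambda>x. complex_of_real (f x))" using f by (auto simp: sq_int_def)
    have "0 \<le> L2_sq (\<lambda>x. complex_of_real (f x))
        - 2 * (LINT x|lborel. Q x * (complex_of_real (F x) \<bullet> complex_of_real (f x)))"
      by (rule form_nonneg_H1[OF Q form ac_of_real[OF F] sc R1]) (use Fs in auto)
    also have "\<dots> = (LINT x|lborel. f x * f x) - 2 * (LINT x|lborel. Q x * (F x * f x))"
      by (simp add: L2_sq_def inner_complex_def power2_eq_square)
    also have "\<dots> = (LINT x|lborel. f x * f x - 2 * (Q x * (F x * f x)))"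
    proof -
      have "integrable lborel (\<lambda>x. f x * f x)" using sq_int_mult(1)[OF f f] .
      moreover have "integrable lborel (\<lambda>x. Q x * (F x * f x))"
      proof (rule integrable_supported[of _ "-R" R])
        show "loc_int (\<lambda>x. Q x * (F x * f x))"
          by (rule L2_loc_mult[OF Q L2_loc_mult_continuous[OF sq_int_L2_loc[OF f] ac_continuous[OF F]]])
        show "-R \<le> x \<and> x \<le> R" if "Q x * (F x * f x) \<noteq> 0" for x using Fs[of x] that by auto
      qed
      ultimately show ?thesis by simp
    qed
    also have "\<dots> = (LINT x|lborel. B Y Y' Y Y' x + 2 * t * B Y Y' \<theta> \<theta>' x + t\<^sup>2 * B \<theta> \<theta>' \<theta> \<theta>' x)"
      by (rule Bochner_Integration.integral_cong) (auto simp: B_def F_def f_def algebra_simps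
          power2_eq_square)
    also have "\<dots> = 2 * t * u b + t\<^sup>2 * integral\<^sup>L lborel (B \<theta> \<theta>' \<theta> \<theta>')"
      using i11 i12 i22 by (simp add: I11 I12)
    finally show ?thesis .
  qed
  then show ?thesis by (rule nonneg_linear_quadratic)
qed

lemma sol_continuous:
  assumes "sol Q y u"
  shows "continuous_on A y" "continuous_on A u"
  using assms by (auto simp: sol_def intro: ac_continuous)

text \<open>With \<open>c\<close> and \<open>s\<close> the fundamental solutions at \<open>0\<close>, the solution \<open>c + \<beta> s\<close> vanishes at
  \<open>x > 0\<close> for \<open>\<beta> = - c x / s x\<close>; the supremum of these slopes gives a solution without zeros.\<close>

lemma disconjugate_positive_solution:
  assumes Q: "Q \<in> L2_loc"
    and dis: "\<And>y u a b. sol Q y u \<Longrightarrow> y a = 0 \<Longrightarrow> y b = 0 \<Longrightarrow> a < b \<Longrightarrow> u b = 0"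
  obtains y u where "sol Q y u" "\<And>x. y x > 0"
proof -
  have triv: "y x = 0 \<and> u x = 0" if "sol Q y u" "y a = 0" "y b = 0" "a < b" for y u a b x
    using sol_unique[OF Q that(1,3) dis[OF that]] by blast
  obtain c uc where c: "sol Q c uc" "c 0 = 1" "uc 0 = 0" using sol_exists[OF Q] by blast
  obtain s us where s: "sol Q s us" "s 0 = 0" "us 0 = 1" using sol_exists[OF Q] by blast
  have s_nz: "s x \<noteq> 0" if "x \<noteq> 0" for x
  proof
    assume "s x = 0"
    then have "us 0 = 0" using triv[OF s(1), of 0 x 0] triv[OF s(1), of x 0 0] s(2) that
        by (cases "x < 0") auto
    then show False using s(3) by simp
  qed
  obtain d where d: "d > 0" "\<And>x. 0 < x \<Longrightarrow> x < 0 + d \<Longrightarrow> s x > 0" "\<And>x. 0 - d < x \<Longrightarrow> x < 0 \<Longrightarrow> s x < 0"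
    by (rule sol_sign_change[OF Q s(1,2)]) (use s(3) in auto)
  have s_pos: "s x > 0" if "x > 0" for x
  proof (rule ccontr)
    assume *: "\<not> s x > 0"
    \<comment> \<open>A point between 0 and \<open>x\<close> at which the sign is known from the
      behaviour near 0; halving keeps it strictly inside the neighbourhood.\<close>
    define t where "t = min x d / 2"
    have t: "0 < t" "t \<le> x" "s t > 0" using that d(1) d(2)[of t] by (auto simp: t_def)
    obtain z where "t \<le> z" "z \<le> x" "s z = 0"
      using IVT2'[of s x 0 t] * t sol_continuous(1)[OF s(1)] by force
    then show False using s_nz[of z] t by auto
  qed
  have s_neg: "s x < 0" if "x < 0" for x
  proof (rule ccontr)
    assume *: "\<not> s x < 0"
    define t where "t = max x (- d) / 2"
    have t: "t < 0" "x \<le> t" "s t < 0" using that d(1) d(3)[of t] by (auto simp: t_def)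
    obtain z where "x \<le> z" "z \<le> t" "s z = 0"
      using IVT2'[of s t 0 x] * t sol_continuous(1)[OF s(1)] by force
    then show False using s_nz[of z] t by auto
  qed
  \<comment> \<open>The solution vanishing at \<open>x\<close> equals 1 at the origin and has no
    second zero, so it is positive at \<open>x'\<close>; dividing by the negative
    \<open>s x'\<close> gives the order. Slopes at negative points thus bound the supremum, which
    then yields nonnegativity on both sides.\<close>
  have order: "- c x / s x \<le> - c x' / s x'" if x: "x > 0" "x' < 0" for x x'
  proof -
    define \<beta> where "\<beta> = - c x / s x"
    define z where "z t = c t + \<beta> * s t" for t
    have z: "sol Q z (\<lambda>t. uc t + \<beta> * us t)" unfolding z_def[abs_def] by (rule sol_combine[OF c(1) s(1)])
    have zx: "z x = 0" using s_pos[OF x(1)] by (simp add: z_def \<beta>_def)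
    have z0: "z 0 = 1" by (simp add: z_def c s)
    have "z x' > 0"
    proof (rule ccontr)
      assume "\<not> z x' > 0"
      then obtain t where "x' \<le> t" "t \<le> 0" "z t = 0"
        using IVT'[of z x' 0 0] z0 x(2) sol_continuous(1)[OF z] by force
      then have "z 0 = 0" using triv[OF z _ zx, of t 0] x by auto
      then show False using z0 by simp
    qed
    then have "\<beta> * s x' > - c x'" by (simp add: z_def)
    then have "\<beta> < - c x' / s x'" using s_neg[OF x(2)] by (simp only: neg_less_divide_eq)
    then show ?thesis by (simp add: \<beta>_def)
  qed
  define \<beta> where "\<beta> = (SUP x\<in>{0<..}. - c x / s x)"
  have up: "- c x / s x \<le> \<beta>" if "x > 0" for x
    unfolding \<beta>_def
  proof (rule cSUP_upper)
    show "bdd_above ((\<lambda>x. - c x / s x) ` {0<..})"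
      by (rule bdd_aboveI2[where M = "- c (- 1) / s (- 1)"]) (use order[of _ "-1"] in auto)
  qed (use that in simp)
  have low: "\<beta> \<le> - c x / s x" if "x < 0" for x
    unfolding \<beta>_def by (rule cSUP_least) (use order[OF _ that] in auto)
  define y where "y x = c x + \<beta> * s x" for x
  define u where "u x = uc x + \<beta> * us x" for x
  have y: "sol Q y u" unfolding y_def[abs_def] u_def[abs_def] by (rule sol_combine[OF c(1) s(1)])
  have y0: "y 0 = 1" by (simp add: y_def c s)
  have nonneg: "y x \<ge> 0" for x
  proof -
    consider "x > 0" | "x = 0" | "x < 0" by linarith
    then show ?thesis
    proof cases
      case 1
      then show ?thesis using up[OF 1] s_pos[OF 1] by (simp add: y_def field_simps)
    next
      case 3
      then show ?thesis using low[OF 3] s_neg[OF 3] by (simp add: y_def field_simps)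
    qed (use y0 in simp)
  qed
  have "y x \<noteq> 0" for x
  proof
    assume yx: "y x = 0"
    \<comment> \<open>By uniqueness a nontrivial solution has nonzero quasi-derivative at a zero,
      hence changes sign there, against nonnegativity.\<close>
    have "u x \<noteq> 0" using sol_unique(1)[OF Q y yx, of 0] y0 by auto
    then consider "u x > 0" | "u x < 0" by linarith
    then show False
    proof cases
      case 1
      obtain d where "d > 0" "\<And>t. x - d < t \<Longrightarrow> t < x \<Longrightarrow> y t < 0"
        by (rule sol_sign_change[OF Q y yx 1]) blast
      then have "y (x - d / 2) < 0" by simp
      then show False using nonneg[of "x - d / 2"] by simp
    next
      case 2
      \<comment> \<open>The combination with coefficient \<open>-2\<close> is the negated
        solution.\<close>
      have n: "sol Q (\<lambda>t. y t + (-2) * y t) (\<lambda>t. u t + (-2) * u t)" by (rule sol_combine[OF y y])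
      obtain d where "d > 0" "\<And>t. x < t \<Longrightarrow> t < x + d \<Longrightarrow> y t + (-2) * y t > 0"
        by (rule sol_sign_change[OF Q n, of x]) (use yx 2 in auto)
      then have "y (x + d / 2) + (-2) * y (x + d / 2) > 0" by simp
      then show False using nonneg[of "x + d / 2"] by simp
    qed
  qed
  then show thesis using that[OF y] nonneg by (metis less_eq_real_def)
qed

text \<open>The product of \<open>y\<close> and \<open>exp (- R)\<close> with \<open>R' = y' / y\<close> has derivative zero.\<close>

lemma ac_inverse:
  fixes y :: "real \<Rightarrow> real"
  assumes y: "ac y y'" and pos: "\<And>x. y x > 0"
  shows "ac (\<lambda>x. 1 / y x) (\<lambda>x. - (y' x / y x) * (1 / y x))"
proof -
  have nz: "y x \<noteq> 0" for x using pos[of x] by simp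
  have "loc_int (\<lambda>x. (1 / y x) * y' x)"
    by (intro loc_int_mult_continuous ac_loc_int[OF y] continuous_intros ac_continuous[OF y]) (use nz in simp)
  then obtain R where R: "ac R (\<lambda>x. (1 / y x) * y' x)" using ac_exists by blast
  have E: "ac (\<lambda>x. exp (- R x)) (\<lambda>x. exp (- R x) * - ((1 / y x) * y' x))" by (rule ac_exp[OF ac_minus[OF R]])
  have "ac (\<lambda>x. y x * exp (- R x)) (\<lambda>x. 0)"
    using ac_mult[OF y E] nz by simp
  then have "y x * exp (- R x) = y 0 * exp (- R 0)" for x by (rule ac_zero_const)
  define C where "C = 1 / (y 0 * exp (- R 0))"
  have inv: "1 / y x = C * exp (- R x)" for x
    using \<open>y x * exp (- R x) = y 0 * exp (- R 0)\<close> nz[of x] nz[of 0] by (simp add: C_def field_simps)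
  have "ac (\<lambda>x. C * exp (- R x)) (\<lambda>x. C * (exp (- R x) * - ((1 / y x) * y' x)))" by (rule ac_cmult[OF E])
  moreover have "C * (exp (- R x) * - ((1 / y x) * y' x)) = - (y' x / y x) * (1 / y x)" for x
  proof -
    have "C * (exp (- R x) * - ((1 / y x) * y' x)) = (C * exp (- R x)) * - ((1 / y x) * y' x)" by simp
    also have "\<dots> = - (y' x / y x) * (1 / y x)" unfolding inv[symmetric] by simp
    finally show ?thesis .
  qed
  ultimately show ?thesis unfolding inv by simp
qed

section \<open>Miura map, form and operator in terms of the primitive\<close>

lemma miura_apply:
  "\<phi> \<in> test_fun \<Longrightarrow> miura r \<phi> = - (LINT x|lborel. of_real (r x) * vderiv \<phi> x)
      + (LINT x|lborel. of_real ((r x)\<^sup>2) * \<phi> x)"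
  by (simp add: miura_def add_dist_def deriv_dist_def dist_of_def test_fun_vderiv)

lemma L2_loc_square: "r \<in> L2_loc \<Longrightarrow> loc_int (\<lambda>x. (r x)\<^sup>2)" for r :: "real \<Rightarrow> real"
  using L2_loc_mult[of r r] by (simp add: power2_eq_square)

text \<open>In the sense of distributions \<open>r' + r^2 = Q' + z' + r^2 = Q'\<close>. A positive
  solution and a nonnegative form both lead to a Miura preimage through this computation.\<close>

lemma miura_of_ac:
  fixes Q r :: "real \<Rightarrow> real"
  assumes q: "q \<in> extensional test_fun" and Q: "Q \<in> L2_loc"
    and qQ: "\<And>\<phi>. \<phi> \<in> test_fun \<Longrightarrow> q \<phi> = - (LINT x|lborel. of_real (Q x) * vderiv \<phi> x)"
    and r: "r \<in> L2_loc" and z: "ac z (\<lambda>x. - (r x)\<^sup>2)" and rz: "AE x in lborel. r x = Q x + z x"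
  shows "q = miura r"
proof (rule extensionalityI[OF q])
  show "miura r \<in> extensional test_fun" by (simp add: miura_def add_dist_def)
  fix \<phi> assume \<phi>: "\<phi> \<in> test_fun"
  have \<phi>': "vderiv \<phi> \<in> test_fun" by (rule test_fun_vderiv[OF \<phi>])
  note cz = ac_of_real[OF z]
  have i: "integrable lborel (\<lambda>x. of_real (Q x) * vderiv \<phi> x)"
      "integrable lborel (\<lambda>x. of_real (z x) * vderiv \<phi> x)"
    by (intro integrable_mult_test \<phi>' loc_int_of_real L2_loc_loc_int Q loc_int_continuous ac_continuous[OF
        cz])+
  have ir: "integrable lborel (\<lambda>x. of_real (r x) * vderiv \<phi> x)"
    by (intro integrable_mult_test \<phi>' loc_int_of_real L2_loc_loc_int r)
  have "(LINT x|lborel. of_real (r x) * vderiv \<phi> x)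
      = (LINT x|lborel. of_real (Q x) * vderiv \<phi> x + of_real (z x) * vderiv \<phi> x)"
    using i ir by (intro integral_cong_AE) (use rz in \<open>auto elim!: eventually_mono simp: distrib_right\<close>)
  also have "\<dots> = (LINT x|lborel. of_real (Q x) * vderiv \<phi> x) + (LINT x|lborel. of_real ((r x)\<^sup>2) * \<phi> x)"
    using i ac_ibp_test[OF cz \<phi>] by simp
  finally show "q \<phi> = miura r \<phi>" by (simp add: miura_apply[OF \<phi>] qQ[OF \<phi>])
qed

lemma schroedinger_form_eq:
  fixes Q :: "real \<Rightarrow> real"
  assumes qQ: "\<And>\<phi>. \<phi> \<in> test_fun \<Longrightarrow> q \<phi> = - (LINT x|lborel. of_real (Q x) * vderiv \<phi> x)" and \<phi>: "\<phi> \<in> test_fun"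
  shows "schroedinger_form q \<phi> = of_real (L2_sq (vderiv \<phi>) - 2 * (LINT x|lborel. Q x * (\<phi> x \<bullet> vderiv \<phi> x)))"
proof -
  have "q (\<lambda>x. complex_of_real ((norm (\<phi> x))\<^sup>2))
      = - (LINT x|lborel. of_real (Q x) * of_real (2 * (\<phi> x \<bullet> vderiv \<phi> x)))"
    unfolding qQ[OF test_fun_norm_square[OF \<phi>]] vderiv_norm_square[OF \<phi>] ..
  also have "\<dots> = - of_real (LINT x|lborel. 2 * (Q x * (\<phi> x \<bullet> vderiv \<phi> x)))"
    unfolding integral_complex_of_real[symmetric] by (simp add: mult.left_commute)
  also have "\<dots> = of_real (- 2 * (LINT x|lborel. Q x * (\<phi> x \<bullet> vderiv \<phi> x)))" by simp
  finally show ?thesis by (simp add: schroedinger_form_def L2_sq_def)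
qed

lemma schroedinger_nonneg_iff:
  fixes Q :: "real \<Rightarrow> real"
  assumes "\<And>\<phi>. \<phi> \<in> test_fun \<Longrightarrow> q \<phi> = - (LINT x|lborel. of_real (Q x) * vderiv \<phi> x)"
  shows "schroedinger_nonneg q \<longleftrightarrow> form_nonneg Q"
  unfolding schroedinger_nonneg_def form_nonneg_def
  by (intro ball_cong refl) (simp only: schroedinger_form_eq[OF assms] nonneg_Reals_of_real_iff)

lemma miura_nonneg:
  fixes r :: "real \<Rightarrow> real"
  assumes r: "r \<in> L2_loc"
  shows "schroedinger_nonneg (miura r)"
  unfolding schroedinger_nonneg_def
proof
  fix \<phi> assume \<phi>: "\<phi> \<in> test_fun"
  obtain R where R: "\<And>x. \<phi> x \<noteq> 0 \<Longrightarrow> \<bar>x\<bar> < R" using test_fun_bounds[OF \<phi>] by blast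
  have c: "continuous_on UNIV \<phi>" "continuous_on UNIV (vderiv \<phi>)"
    using \<phi> by (auto intro: smooth_continuous test_fun_smooth smooth_vderiv)
  have \<phi>s: "-R \<le> x \<and> x \<le> R" if "\<phi> x \<noteq> 0" for x using R[OF that] by auto
  have i1: "integrable lborel (\<lambda>x. (norm (vderiv \<phi> x))\<^sup>2)"
      by (rule sq_int_integrable[OF test_fun_sq_int[OF test_fun_vderiv[OF \<phi>]]])
  have i2: "integrable lborel (\<lambda>x. r x * (2 * (\<phi> x \<bullet> vderiv \<phi> x)))"
  proof (rule integrable_supported)
    show "loc_int (\<lambda>x. r x * (2 * (\<phi> x \<bullet> vderiv \<phi> x)))"
      using loc_int_mult_continuous[OF L2_loc_loc_int[OF r], of "\<lambda>x. 2 * (\<phi> x \<bullet> vderiv \<phi> x)"] c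
      by (simp add: mult.commute continuous_intros)
    show "-R \<le> x \<and> x \<le> R" if "r x * (2 * (\<phi> x \<bullet> vderiv \<phi> x)) \<noteq> 0" for x
      using that by (intro \<phi>s) auto
  qed
  have i3: "integrable lborel (\<lambda>x. (r x)\<^sup>2 * (norm (\<phi> x))\<^sup>2)"
  proof (rule integrable_supported)
    show "loc_int (\<lambda>x. (r x)\<^sup>2 * (norm (\<phi> x))\<^sup>2)"
      using loc_int_mult_continuous[OF L2_loc_square[OF r], of "\<lambda>x. (norm (\<phi> x))\<^sup>2"] c
      by (simp add: mult.commute continuous_intros)
    show "-R \<le> x \<and> x \<le> R" if "(r x)\<^sup>2 * (norm (\<phi> x))\<^sup>2 \<noteq> 0" for x
      using that by (intro \<phi>s) auto
  qed
  have "miura r (\<lambda>x. complex_of_real ((norm (\<phi> x))\<^sup>2))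
    = - (LINT x|lborel. of_real (r x) * of_real (2 * (\<phi> x \<bullet> vderiv \<phi> x))) + (LINT x|lborel. of_real ((r x)\<^sup>2) *
        of_real ((norm (\<phi> x))\<^sup>2))"
    unfolding miura_apply[OF test_fun_norm_square[OF \<phi>]] vderiv_norm_square[OF \<phi>] ..
  also have "\<dots> = of_real (- (LINT x|lborel. r x * (2 * (\<phi> x \<bullet> vderiv \<phi> x)))
      + (LINT x|lborel. (r x)\<^sup>2 * (norm (\<phi> x))\<^sup>2))"
    unfolding of_real_mult[symmetric] integral_complex_of_real by simp
  finally have "schroedinger_form (miura r) \<phi>
    = of_real ((LINT x|lborel. (norm (vderiv \<phi> x))\<^sup>2) + (- (LINT x|lborel. r x * (2 * (\<phi> x \<bullet> vderiv \<phi> x))) +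
        (LINT x|lborel. (r x)\<^sup>2 * (norm (\<phi> x))\<^sup>2)))"
    by (simp add: schroedinger_form_def)
  also have "(LINT x|lborel. (norm (vderiv \<phi> x))\<^sup>2) + (- (LINT x|lborel. r x * (2 * (\<phi> x \<bullet> vderiv \<phi> x)))
      + (LINT x|lborel. (r x)\<^sup>2 * (norm (\<phi> x))\<^sup>2))
    = (LINT x|lborel. (norm (vderiv \<phi> x))\<^sup>2 - r x * (2 * (\<phi> x \<bullet> vderiv \<phi> x)) + (r x)\<^sup>2 * (norm (\<phi> x))\<^sup>2)"
    using i1 i2 i3 by simp
  also have "\<dots> = (LINT x|lborel. (norm (vderiv \<phi> x - r x *\<^sub>R \<phi> x))\<^sup>2)"
  proof (rule Bochner_Integration.integral_cong)
    fix x
    show "(norm (vderiv \<phi> x))\<^sup>2 - r x * (2 * (\<phi> x \<bullet> vderiv \<phi> x)) + (r x)\<^sup>2 * (norm (\<phi> x))\<^sup>2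
        = (norm (vderiv \<phi> x - r x *\<^sub>R \<phi> x))\<^sup>2"
      unfolding power2_norm_eq_inner by (simp add: inner_diff inner_commute power2_eq_square algebra_simps)
  qed simp
  finally show "schroedinger_form (miura r) \<phi> \<in> \<real>\<^sub>\<ge>\<^sub>0" by simp
qed

text \<open>The operator is defined with chosen functions \<open>L2_primitive q\<close> and
  \<open>weak_deriv y\<close>. The first is \<open>Q\<close> plus a constant almost everywhere, the
  second is \<open>y'\<close> almost everywhere, and the two contributions of the constant cancel by
  integration by parts.\<close>

lemma schroedinger_apply:
  fixes Q :: "real \<Rightarrow> real"
  assumes q: "q \<in> extensional test_fun" and Q: "Q \<in> L2_loc"
    and qQ: "\<And>\<phi>. \<phi> \<in> test_fun \<Longrightarrow> q \<phi> = - (LINT x|lborel. of_real (Q x) * vderiv \<phi> x)"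
    and y: "ac y y'" "y' \<in> L2_loc" and \<phi>: "\<phi> \<in> test_fun"
  shows "schroedinger q y \<phi> = - (LINT x|lborel. (of_real (Q x) * y x - y' x) * vderiv \<phi> x)
    - (LINT x|lborel. (of_real (Q x) * y' x) * \<phi> x)"
proof -
  have \<phi>': "vderiv \<phi> \<in> test_fun" by (rule test_fun_vderiv[OF \<phi>])
  have cy: "continuous_on UNIV y" by (rule ac_continuous[OF y(1)])
  define Qc where "Qc x = complex_of_real (Q x)" for x
  have Qc: "Qc \<in> L2_loc" unfolding Qc_def[abs_def] by (rule L2_loc_of_real[OF Q])
  have "deriv_dist (dist_of Qc) = q"
    by (rule extensionalityI[OF _ q]) (simp_all add: deriv_dist_def dist_of_def qQ Qc_def test_fun_vderiv)
  then have "\<exists>Q. Q \<in> L2_loc \<and> deriv_dist (dist_of Q) = q" using Qc by blast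
  from someI_ex[OF this] obtain Q1 where Q1: "L2_primitive q = Q1" "Q1 \<in> L2_loc" "deriv_dist (dist_of Q1) = q"
    by (auto simp: L2_primitive_def)
  obtain c where "AE x in lborel. Q1 x - Qc x = c"
  proof (rule du_Bois_Reymond[of "\<lambda>x. Q1 x - Qc x"])
    show "loc_int (\<lambda>x. Q1 x - Qc x)" by (intro loc_int_diff L2_loc_loc_int Q1 Qc)
    fix \<psi> assume \<psi>: "\<psi> \<in> test_fun"
    then have "q \<psi> = - (LINT x|lborel. Q1 x * vderiv \<psi> x)"
      using Q1(3)[symmetric] by (simp add: deriv_dist_def dist_of_def test_fun_vderiv)
    then show "(LINT x|lborel. (Q1 x - Qc x) * vderiv \<psi> x) = 0"
      using qQ[OF \<psi>] integrable_mult_test[OF L2_loc_loc_int[OF Q1(2)] test_fun_vderiv[OF \<psi>]]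
        integrable_mult_test[OF L2_loc_loc_int[OF Qc] test_fun_vderiv[OF \<psi>]]
      by (simp add: left_diff_distrib Qc_def)
  qed blast
  then have Q1c: "AE x in lborel. Q1 x = Qc x + c" by (auto elim!: eventually_mono simp: algebra_simps)
  have "deriv_dist (dist_of y) = dist_of y'"
    by (rule extensionalityI[of _ test_fun]) (simp_all add: deriv_dist_def dist_of_def test_fun_vderiv
        ac_ibp_test[OF y(1)])
  then have "\<exists>g. g \<in> L2_loc \<and> deriv_dist (dist_of y) = dist_of g" using y(2) by blast
  then have "weak_deriv y \<in> L2_loc \<and> deriv_dist (dist_of y) = dist_of (weak_deriv y)"
    unfolding weak_deriv_def by (rule someI_ex)
  then obtain g where g: "weak_deriv y = g" "g \<in> L2_loc" "deriv_dist (dist_of y) = dist_of g"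
    by blast
  have "AE x in lborel. g x - y' x = 0"
  proof (rule fundamental_lemma_UNIV)
    show "loc_int (\<lambda>x. g x - y' x)" by (intro loc_int_diff L2_loc_loc_int g y)
    fix \<psi> assume \<psi>: "\<psi> \<in> test_fun"
    have "dist_of g \<psi> = dist_of y' \<psi>" using g(3) \<open>deriv_dist (dist_of y) = dist_of y'\<close> by simp
    then show "(LINT x|lborel. (g x - y' x) * \<psi> x) = 0"
      using \<psi> integrable_mult_test[OF L2_loc_loc_int[OF g(2)] \<psi>] integrable_mult_test[OF L2_loc_loc_int[OF
          y(2)] \<psi>]
      by (simp add: left_diff_distrib dist_of_def)
  qed
  then have gy: "AE x in lborel. g x = y' x" by (auto elim!: eventually_mono)
  have Qy: "loc_int (\<lambda>x. Qc x * y x)" using loc_int_mult_continuous[OF L2_loc_loc_int[OF Qc] cy]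
      by (simp add: mult.commute)
  have Q1y: "loc_int (\<lambda>x. Q1 x * y x)" using loc_int_mult_continuous[OF L2_loc_loc_int[OF Q1(2)] cy]
      by (simp add: mult.commute)
  note i = integrable_mult_test[OF Qy \<phi>'] integrable_mult_test[OF Q1y \<phi>'] integrable_mult_test[OF
      loc_int_continuous[OF cy] \<phi>']
    integrable_mult_test[OF L2_loc_mult[OF Qc y(2)] \<phi>] integrable_mult_test[OF L2_loc_mult[OF Q1(2) g(2)] \<phi>]
    integrable_mult_test[OF L2_loc_loc_int[OF y(2)] \<phi>] integrable_mult_test[OF L2_loc_loc_int[OF y(2)] \<phi>']
  have "(LINT x|lborel. (Q1 x * y x) * vderiv \<phi> x)
      = (LINT x|lborel. (Qc x * y x) * vderiv \<phi> x + c * (y x * vderiv \<phi> x))"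
    using i by (intro integral_cong_AE) (use Q1c in \<open>auto elim!: eventually_mono simp: algebra_simps\<close>)
  then have 1: "(LINT x|lborel. (Q1 x * y x) * vderiv \<phi> x)
      = (LINT x|lborel. (Qc x * y x) * vderiv \<phi> x) + c * (LINT x|lborel. y x * vderiv \<phi> x)"
    using i by simp
  have "AE x in lborel. (Q1 x * g x) * \<phi> x = (Qc x * y' x) * \<phi> x + c * (y' x * \<phi> x)"
    using Q1c gy by eventually_elim (simp add: algebra_simps)
  then have "(LINT x|lborel. (Q1 x * g x) * \<phi> x) = (LINT x|lborel. (Qc x * y' x) * \<phi> x + c * (y' x * \<phi> x))"
    using i by (intro integral_cong_AE) auto
  then have 2: "(LINT x|lborel. (Q1 x * g x) * \<phi> x)
      = (LINT x|lborel. (Qc x * y' x) * \<phi> x) + c * (LINT x|lborel. y' x * \<phi> x)"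
    using i by simp
  have "schroedinger q y \<phi> = - (LINT x|lborel. (Q1 x * y x) * vderiv \<phi> x)
      - (LINT x|lborel. (Q1 x * g x) * \<phi> x)
      - (LINT x|lborel. y x * vderiv (vderiv \<phi>) x)"
    using \<phi> \<phi>' test_fun_vderiv[OF \<phi>']
    by (simp add: schroedinger_def potential_prod_def diff_dist_def deriv_dist_def dist_of_def Q1(1) g(1))
  also have "\<dots> = - (LINT x|lborel. (Qc x * y x) * vderiv \<phi> x) - (LINT x|lborel. (Qc x * y' x) * \<phi> x)
      + (LINT x|lborel. y' x * vderiv \<phi> x)"
    unfolding 1 2 ac_ibp_test[OF y(1) \<phi>] ac_ibp_test[OF y(1) \<phi>'] by simp
  also have "\<dots> = - (LINT x|lborel. (Qc x * y x - y' x) * vderiv \<phi> x) - (LINT x|lborel. (Qc x * y' x) * \<phi> x)"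
    using i by (simp add: left_diff_distrib)
  finally show ?thesis by (simp add: Qc_def)
qed

lemma real_parts_ac:
  assumes "ac (\<lambda>x. complex_of_real (y x)) y1" "y1 \<in> L2_loc"
  shows "ac y (\<lambda>x. Re (y1 x))" "(\<lambda>x. Re (y1 x)) \<in> L2_loc"
  using ac_Re[OF assms(1)] L2_loc_Re[OF assms(2)] by simp_all

lemma real_weak_derivative_ac:
  fixes f g :: "real \<Rightarrow> real"
  assumes f: "loc_int f" and g: "loc_int g"
    and eq: "\<And>\<phi>. \<phi> \<in> test_fun \<Longrightarrow>
      (LINT x|lborel. of_real (f x) * vderiv \<phi> x) = - (LINT x|lborel. of_real (g x) * \<phi> x)"
  obtains F where "ac F g" "AE x in lborel. f x = F x"
proof -
  obtain F where F: "ac F (\<lambda>x. complex_of_real (g x))" "AE x in lborel. complex_of_real (f x) = F x"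
    by (rule weak_derivative_ac[OF loc_int_of_real[OF f] loc_int_of_real[OF g] eq]) fast+
  show thesis
  proof (rule that)
    show "ac (\<lambda>x. Re (F x)) g" using ac_Re[OF F(1)] by simp
    show "AE x in lborel. f x = Re (F x)" using F(2) by eventually_elim (metis Re_complex_of_real)
  qed
qed

lemma L2_loc_divide:
  fixes f y :: "real \<Rightarrow> real"
  assumes "f \<in> L2_loc" "continuous_on UNIV y" "\<And>x. y x > 0"
  shows "(\<lambda>x. f x / y x) \<in> L2_loc"
proof -
  have "y x \<noteq> 0" for x using assms(3)[of x] by simp
  then have "continuous_on UNIV (\<lambda>x. 1 / y x)" using assms(2) by (intro continuous_intros) auto
  from L2_loc_mult_continuous[OF assms(1) this] show ?thesis by simp
qed

section \<open>The implications between the three statements\<close>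

context
  fixes q :: functional and Q :: "real \<Rightarrow> real"
  assumes ext: "q \<in> extensional test_fun" and Q: "Q \<in> L2_loc"
    and qQ: "\<And>\<phi>. \<phi> \<in> test_fun \<Longrightarrow> q \<phi> = - (LINT x|lborel. of_real (Q x) * vderiv \<phi> x)"
begin

text \<open>Let \<open>S\<close> be the continuous version of \<open>Q - r\<close>, so
  \<open>S' = r^2\<close>. With \<open>y' = r y\<close> the function \<open>Q y - y'\<close> is
  \<open>S y\<close> almost everywhere, and \<open>(S y)' = S y' + r^2 y = Q y'\<close>, which is
  the weak equation.\<close>

lemma miura_imp_positive_solution:
  assumes r: "r \<in> L2_loc" and qr: "q = miura r"
  obtains y :: "real \<Rightarrow> real" where "continuous_on UNIV y" "\<And>x. 0 < y x"
    "dist_of (\<lambda>x. complex_of_real (y x)) \<in> sobolev_loc 1"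
    "schroedinger q (\<lambda>x. complex_of_real (y x)) = zero_dist"
proof -
  obtain R where R: "ac R r" using ac_exists[OF L2_loc_loc_int[OF r]] by blast
  define y where "y x = exp (R x)" for x
  define y' where "y' x = y x * r x" for x
  have y: "ac y y'" unfolding y_def[abs_def] y'_def[abs_def] by (rule ac_exp[OF R])
  have cy: "continuous_on UNIV y" by (rule ac_continuous[OF y])
  have y'L: "y' \<in> L2_loc" unfolding y'_def[abs_def] by (rule L2_loc_mult_continuous[OF r cy])
  note yc = ac_of_real[OF y] and y'c = L2_loc_of_real[OF y'L]
  obtain S where S: "ac S (\<lambda>x. (r x)\<^sup>2)" "AE x in lborel. Q x - r x = S x"
  proof (rule real_weak_derivative_ac)
    show "loc_int (\<lambda>x. Q x - r x)" by (intro loc_int_diff L2_loc_loc_int Q r)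
    show "loc_int (\<lambda>x. (r x)\<^sup>2)" by (rule L2_loc_square[OF r])
    fix \<phi> assume \<phi>: "\<phi> \<in> test_fun"
    have "integrable lborel (\<lambda>x. of_real (Q x) * vderiv \<phi> x)"
        "integrable lborel (\<lambda>x. of_real (r x) * vderiv \<phi> x)"
      by (intro integrable_mult_test test_fun_vderiv \<phi> loc_int_of_real L2_loc_loc_int Q r)+
    moreover have "(LINT x|lborel. of_real (Q x) * vderiv \<phi> x)
        = (LINT x|lborel. of_real (r x) * vderiv \<phi> x) - (LINT x|lborel. of_real ((r x)\<^sup>2) * \<phi> x)"
      using qQ[OF \<phi>] miura_apply[OF \<phi>, of r] unfolding qr by (simp add: algebra_simps)
    ultimately show "(LINT x|lborel. of_real (Q x - r x) * vderiv \<phi> x)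
        = - (LINT x|lborel. of_real ((r x)\<^sup>2) * \<phi> x)"
      by (simp add: left_diff_distrib)
  qed fast
  have Sy: "ac (\<lambda>x. S x * y x) (\<lambda>x. S x * y' x + (r x)\<^sup>2 * y x)" by (rule ac_mult[OF S(1) y])
  have [measurable]: "Q \<in> borel_measurable borel" "S \<in> borel_measurable borel" "y \<in> borel_measurable borel"
      "y' \<in> borel_measurable borel" "r \<in> borel_measurable borel"
    using Q y'L r cy ac_continuous[OF S(1)] by (auto intro: L2_loc_measurable borel_measurable_continuous_onI)
  have "schroedinger q (\<lambda>x. complex_of_real (y x)) \<phi> = 0" if \<phi>: "\<phi> \<in> test_fun" for \<phi>
  proof -
    have [measurable]: "\<phi> \<in> borel_measurable borel" "vderiv \<phi> \<in> borel_measurable borel"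
      using \<phi> test_fun_vderiv[OF \<phi>] by (auto intro: sq_int_measurable test_fun_sq_int)
    have "AE x in lborel. (of_real (Q x) * complex_of_real (y x) - complex_of_real (y' x)) * vderiv \<phi> x
        = complex_of_real (S x * y x) * vderiv \<phi> x"
      using S(2)
    proof eventually_elim
      case (elim x)
      have "of_real (Q x) * complex_of_real (y x) - complex_of_real (y' x)
          = complex_of_real (y x * (Q x - r x))"
        by (simp add: y'_def algebra_simps)
      then show ?case by (simp add: elim mult.commute)
    qed
    then have 1: "(LINT x|lborel. (of_real (Q x) * complex_of_real (y x)
        - complex_of_real (y' x)) * vderiv \<phi> x) = (LINT x|lborel. complex_of_real (S x * y x) * vderiv \<phi> x)"
      by (intro integral_cong_AE) auto
    have "AE x in lborel. (of_real (Q x) * complex_of_real (y' x)) * \<phi> x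
        = complex_of_real (S x * y' x + (r x)\<^sup>2 * y x) * \<phi> x"
      using S(2)
    proof eventually_elim
      case (elim x)
      have "S x * y' x + (r x)\<^sup>2 * y x = Q x * y' x"
        unfolding elim[symmetric] by (simp add: y'_def power2_eq_square algebra_simps)
      then show ?case by simp
    qed
    then have 2: "(LINT x|lborel. (of_real (Q x) * complex_of_real (y' x)) * \<phi> x)
        = (LINT x|lborel. complex_of_real (S x * y' x + (r x)\<^sup>2 * y x) * \<phi> x)"
      by (intro integral_cong_AE) auto
    have "schroedinger q (\<lambda>x. complex_of_real (y x)) \<phi>
        = - (LINT x|lborel. (of_real (Q x) * complex_of_real (y x) - complex_of_real (y' x)) * vderiv \<phi> x)
          - (LINT x|lborel. (of_real (Q x) * complex_of_real (y' x)) * \<phi> x)"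
      by (rule schroedinger_apply[OF ext Q qQ yc y'c \<phi>])
    also have "\<dots> = 0"
      unfolding 1 2 ac_ibp_test[OF ac_of_real[OF Sy] \<phi>] by simp
    finally show ?thesis .
  qed
  then have z: "schroedinger q (\<lambda>x. complex_of_real (y x)) = zero_dist"
    by (intro extensionalityI[of _ test_fun]) (simp_all add: zero_dist_def schroedinger_def diff_dist_def)
  show thesis
    by (rule that[OF cy _ ac_sobolev_loc[OF yc y'c] z]) (simp add: y_def)
qed

lemma positive_solution_imp_miura:
  fixes y :: "real \<Rightarrow> real"
  assumes cy: "continuous_on UNIV y" and pos: "\<And>x. 0 < y x"
    and y: "dist_of (\<lambda>x. complex_of_real (y x)) \<in> sobolev_loc 1"
    and z: "schroedinger q (\<lambda>x. complex_of_real (y x)) = zero_dist"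
  shows "q \<in> miura ` L2_loc"
proof -
  have "continuous_on UNIV (\<lambda>x. complex_of_real (y x))" by (intro continuous_intros cy)
  then obtain y1 where y1: "y1 \<in> L2_loc" "ac (\<lambda>x. complex_of_real (y x)) y1"
    by (rule sobolev_loc_1_ac[OF _ y])
  define y' where "y' x = Re (y1 x)" for x
  have acy: "ac y y'" and y'L: "y' \<in> L2_loc"
    using real_parts_ac[OF y1(2,1)] by (simp_all add: y'_def[abs_def])
  have Qy: "loc_int (\<lambda>x. Q x * y x)" using loc_int_mult_continuous[OF L2_loc_loc_int[OF Q] cy]
      by (simp add: mult.commute)
  \<comment> \<open>\<open>w\<close> is the continuous version of \<open>Q y - y'\<close>; the
    equation says that its derivative is \<open>Q y'\<close>.\<close>
  obtain w where w: "ac w (\<lambda>x. Q x * y' x)" "AE x in lborel. Q x * y x - y' x = w x"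
  proof (rule real_weak_derivative_ac)
    show "loc_int (\<lambda>x. Q x * y x - y' x)" by (intro loc_int_diff Qy L2_loc_loc_int y'L)
    show "loc_int (\<lambda>x. Q x * y' x)" by (rule L2_loc_mult[OF Q y'L])
    fix \<phi> assume \<phi>: "\<phi> \<in> test_fun"
    have "schroedinger q (\<lambda>x. complex_of_real (y x)) \<phi> = 0" using z \<phi> by (simp add: zero_dist_def)
    then show "(LINT x|lborel. of_real (Q x * y x - y' x) * vderiv \<phi> x)
        = - (LINT x|lborel. of_real (Q x * y' x) * \<phi> x)"
      using schroedinger_apply[OF ext Q qQ ac_of_real[OF acy] L2_loc_of_real[OF y'L] \<phi>]
      by (simp add: eq_neg_iff_add_eq_0 neg_eq_iff_add_eq_0)
  qed fast
  define r where "r x = y' x / y x" for x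
  have r: "r \<in> L2_loc" unfolding r_def[abs_def] by (rule L2_loc_divide[OF y'L cy pos])
  have nz: "y x \<noteq> 0" for x using pos[of x] by simp
  have rQ: "AE x in lborel. r x = Q x + - (w x * (1 / y x))"
    using w(2)
  proof eventually_elim
    case (elim x)
    then have "y' x = Q x * y x - w x" by simp
    then show ?case using nz[of x] by (simp add: r_def diff_divide_distrib)
  qed
  \<comment> \<open>The product rule alone does not give the derivative as \<open>- r^2\<close>: the
    relation \<open>w / y = Q - r\<close> holds only almost everywhere and enters through
    \<open>ac_cong_AE\<close>.\<close>
  have "ac (\<lambda>x. - (w x * (1 / y x))) (\<lambda>x. - (w x * (- (y' x / y x) * (1 / y x)) + (Q x * y' x) * (1 / y x)))"
    by (intro ac_minus ac_mult w ac_inverse acy pos)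
  then have "ac (\<lambda>x. - (w x * (1 / y x))) (\<lambda>x. - (r x)\<^sup>2)"
  proof (rule ac_cong_AE)
    show "(\<lambda>x. - (r x)\<^sup>2) \<in> borel_measurable borel" using L2_loc_measurable[OF r] by simp
    show "AE x in lborel. - (w x * (- (y' x / y x) * (1 / y x)) + (Q x * y' x) * (1 / y x)) = - (r x)\<^sup>2"
      using rQ
    proof eventually_elim
      case (elim x)
      have "w x * (- (y' x / y x) * (1 / y x)) + (Q x * y' x) * (1 / y x) = r x * (Q x + - (w x * (1 / y x)))"
        by (simp add: r_def algebra_simps)
      then show ?case unfolding elim[symmetric] by (simp add: power2_eq_square)
    qed
  qed
  from miura_of_ac[OF ext Q qQ r this rQ] show ?thesis using r by blast
qed

text \<open>For the solution of the first-order system \<open>Q y + u\<close> serves as the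
  derivative of \<open>y\<close>, so \<open>r\<close> is \<open>Q + u / y\<close> at every point and
  no Sobolev space intervenes; the solution demanded by the second statement is then obtained from
  \<open>r\<close>.\<close>

lemma nonneg_imp_miura:
  assumes "schroedinger_nonneg q"
  shows "q \<in> miura ` L2_loc"
proof -
  have "form_nonneg Q" using assms schroedinger_nonneg_iff[OF qQ] by simp
  then have dis: "u b = 0" if "sol Q y u" "y a = 0" "y b = 0" "a < b" for y u a b
    using form_nonneg_disconjugate[OF Q _ that] by blast
  obtain y u where y: "sol Q y u" "\<And>x. y x > 0"
  proof (rule disconjugate_positive_solution[OF Q])
    show "u b = 0" if "sol Q y u" "y a = 0" "y b = 0" "a < b" for y u a b by (rule dis[OF that])
  qed (rule that)
  have nz: "y x \<noteq> 0" for x using y(2)[of x] by simp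
  define p where "p x = Q x * y x + u x" for x
  have acy: "ac y p" and acu: "ac u (\<lambda>x. - Q x * p x)" using y(1) by (simp_all add: sol_def p_def[abs_def])
  define r where "r x = Q x + u x * (1 / y x)" for x
  have rp: "r x = p x / y x" for x using nz[of x] by (simp add: r_def p_def add_divide_distrib)
  have "continuous_on UNIV (\<lambda>x. u x * (1 / y x))"
    using sol_continuous[OF y(1)] nz by (intro continuous_intros) auto
  then have r: "r \<in> L2_loc" unfolding r_def[abs_def] by (intro L2_loc_add Q L2_loc_continuous)
  have "ac (\<lambda>x. u x * (1 / y x)) (\<lambda>x. u x * (- (p x / y x) * (1 / y x)) + (- Q x * p x) * (1 / y x))"
    by (intro ac_mult acu ac_inverse acy y)
  moreover have "u x * (- (p x / y x) * (1 / y x)) + (- Q x * p x) * (1 / y x) = - (r x)\<^sup>2" for x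
  proof -
    have "u x * (- (p x / y x) * (1 / y x)) + (- Q x * p x) * (1 / y x)
        = - (p x / y x) * (Q x + u x * (1 / y x))"
      by (simp add: algebra_simps)
    then show ?thesis unfolding rp[symmetric] r_def[symmetric] by (simp add: power2_eq_square)
  qed
  ultimately have "ac (\<lambda>x. u x * (1 / y x)) (\<lambda>x. - (r x)\<^sup>2)" by simp
  from miura_of_ac[OF ext Q qQ r this] have "q = miura r" by (auto simp: r_def[abs_def])
  then show ?thesis using r by blast
qed

end

theorem theorem1p1:
  fixes q :: functional
  assumes "q \<in> sobolev_loc (-1)" and "real_valued_dist q"
  shows "(q \<in> miura ` L2_loc \<longleftrightarrow>
            (\<exists>y :: real \<Rightarrow> real. continuous_on UNIV y \<and> (\<forall>x. 0 < y x) \<and>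
               dist_of (\<lambda>x. complex_of_real (y x)) \<in> sobolev_loc 1 \<and>
               schroedinger q (\<lambda>x. complex_of_real (y x)) = zero_dist)) \<and>
         (q \<in> miura ` L2_loc \<longleftrightarrow> schroedinger_nonneg q)"
proof -
  obtain Q :: "real \<Rightarrow> real" where Q: "Q \<in> L2_loc"
    "\<And>\<phi>. \<phi> \<in> test_fun \<Longrightarrow> q \<phi> = - (LINT x|lborel. of_real (Q x) * vderiv \<phi> x)"
    by (rule real_valued_primitive[OF assms]) fast
  have ext: "q \<in> extensional test_fun"
    using assms(1) by (auto simp: sobolev_loc_def distributions_def)
  show ?thesis
  proof (intro conjI iffI)
    assume "q \<in> miura ` L2_loc"
    then obtain r where r: "r \<in> L2_loc" "q = miura r" by blast
    show "\<exists>y :: real \<Rightarrow> real. continuous_on UNIV y \<and> (\<forall>x. 0 < y x) \<and>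
        dist_of (\<lambda>x. complex_of_real (y x)) \<in> sobolev_loc 1 \<and>
        schroedinger q (\<lambda>x. complex_of_real (y x)) = zero_dist"
    proof (rule miura_imp_positive_solution[OF ext Q r])
      fix y :: "real \<Rightarrow> real"
      assume "continuous_on UNIV y" "\<And>x. 0 < y x" "dist_of (\<lambda>x. complex_of_real (y x)) \<in> sobolev_loc 1"
        "schroedinger q (\<lambda>x. complex_of_real (y x)) = zero_dist"
      then show ?thesis by (intro exI[of _ y]) simp
    qed
  next
    assume "\<exists>y :: real \<Rightarrow> real. continuous_on UNIV y \<and> (\<forall>x. 0 < y x) \<and>
        dist_of (\<lambda>x. complex_of_real (y x)) \<in> sobolev_loc 1 \<and>
        schroedinger q (\<lambda>x. complex_of_real (y x)) = zero_dist"
    then show "q \<in> miura ` L2_loc" using positive_solution_imp_miura[OF ext Q] by blast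
  next
    assume "q \<in> miura ` L2_loc"
    then show "schroedinger_nonneg q" using miura_nonneg by blast
  next
    assume "schroedinger_nonneg q"
    then show "q \<in> miura ` L2_loc" using nonneg_imp_miura[OF ext Q] by blast
  qed
qed

end
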